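(* Let $\Gamma=\Gamma(S_{d_0},HF)$ be a finitely generated saturated directed group acting on $T_{\bar d}$ with $\bar d$ bounded and $F$ a nontrivial finite group, and let $\mu$ be the step law described below. Then for every $\varepsilon>0$ and all $n$ large enough, $$\left|\frac{\log H_{\Gamma,\mu}(n)}{\log n}-\beta(n)\right|\le\varepsilon.$$ In particular $\limsup_n\frac{\log H_{\Gamma,\mu}(n)}{\log n}=\limsup_n\beta(n)$ and $\liminf_n\frac{\log H_{\Gamma,\mu}(n)}{\log n}=\liminf_n\beta(n)$.
   Context: $\bar d=(d_j)_{j\ge0}$ is a bounded sequence of integers $d_j\ge2$, $\sigma\bar d=(d_1,d_2,\dots)$. $T_{\bar d}$ is the spherically homogeneous rooted tree with vertices the finite sequences $i_1\dots i_k$, $i_j\in\{1,\dots,d_{j-1}\}$; $\partial T_{\bar d}$ its boundary; $1^\infty=111\dots$. Products of automorphisms follow $(gf)(x)=f(g(x))$. Each $g\in\mathrm{Aut}(T_{\bar d})$ is written $g=(g_1,\dots,g_{d_0})\tau$ ($g_t\in\mathrm{Aut}(T_{\sigma\bar d})$, $\tau\in S_{d_0}$, $g(ty)=\tau(t)g_t(y)$); rooted automorphisms ($g_t=1$ for all $t$) form a copy of $S_{d_0}$. $H_{\bar d}$ is defined recursively: $h\in H_{\bar d}$ iff $h=(h',\sigma_2,\dots,\sigma_{d_0})$ with $h'\in H_{\sigma\bar d}$ and $\sigma_2,\dots,\sigma_{d_0}$ rooted automorphisms of $T_{\sigma\bar d}$; thus $H_{\bar d}\cong\prod_{l\ge1}S_{d_l}^{\,d_{l-1}-1}$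 (the coordinates $\sigma_2,\dots,\sigma_{d_0}$ giving the factors $S_{d_1}$, the rest recursively from $h'$). For a finite group $F$, $F\wr_{\partial T_{\bar d}}\mathrm{Aut}(T_{\bar d})=\{\varphi:\partial T_{\bar d}\to F\}\rtimes\mathrm{Aut}(T_{\bar d})$ with $(g.\varphi)(x)=\varphi(g(x))$ and $(\varphi g)(\varphi'g')=\varphi(g.\varphi')gg'$; $\varphi_f$ ($f\in F$) equals $f$ at $1^\infty$ and is trivial elsewhere. A finitely generated saturated directed group $\Gamma(S_{d_0},HF)$ is the subgroup of this wreath product generated by the rooted group $S_{d_0}$, a finite subgroup $H\le H_{\bar d}$ such that the pushforward of the uniform measure on $H$ to each factor $S_{d_l}$ is uniform, and $\{\varphi_f:f\in F\}$; $HF=\{h\varphi_f\}\cong H\times F$. The measure $\mu$ is the law of $sks'$ with $s,s'$ uniform on $S_{d_0}$ and $k$ uniform on $HF$, independent ("equidistributed on $S_{d_0}HFS_{d_0}$"). $H_{\Gamma,\mu}(n)=-\sum_\gamma\mu^{*n}(\gamma)\log\mu^{*n}(\gamma)$. Exponent sequence: $p_i=\frac{d_i-1}{d_i^2}$, $k(n)=\min\{k\ge0:p_0p_1\cdots p_kn\le1\}$, $\beta(n)=\frac{\log(d_0d_1\cdots d_{k(n)})}{\log n}$. *)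

theory Defs
  imports "HOL-Probability.Probability" "HOL-Algebra.Group" "HOL-Combinatorics.Permutations"
begin

text \<open>Spherically homogeneous rooted tree T_d. Vertices are finite sequences
  i_1 ... i_k (stored as lists, position j holds i_{j+1}) with entries in {1..d j}.
  Boundary points are infinite sequences x with x j in {1..d j}.\<close>

definition tverts :: "(nat \<Rightarrow> nat) \<Rightarrow> nat list set" where
  "tverts d = {v. \<forall>j<length v. v ! j \<in> {1..d j}}"

definition tbdry :: "(nat \<Rightarrow> nat) \<Rightarrow> (nat \<Rightarrow> nat) set" where
  "tbdry d = {x. \<forall>j. x j \<in> {1..d j}}"

text \<open>The ray 1^infinity.\<close>
definition ones :: "nat \<Rightarrow> nat" where
  "ones = (\<lambda>_. 1)"

text \<open>Automorphisms of the rooted tree, as maps on vertices (identity outside the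
  vertex set): level- and prefix-preserving bijections of the vertex set.\<close>
definition tree_aut :: "(nat \<Rightarrow> nat) \<Rightarrow> (nat list \<Rightarrow> nat list) set" where
  "tree_aut d = {g. bij_betw g (tverts d) (tverts d)
      \<and> (\<forall>v\<in>tverts d. length (g v) = length v)
      \<and> (\<forall>v\<in>tverts d. v \<noteq> [] \<longrightarrow> g (butlast v) = butlast (g v))
      \<and> (\<forall>v. v \<notin> tverts d \<longrightarrow> g v = v)}"

text \<open>Induced action on the boundary (identity off the boundary).\<close>
definition bd_act :: "(nat \<Rightarrow> nat) \<Rightarrow> (nat list \<Rightarrow> nat list) \<Rightarrow> (nat \<Rightarrow> nat) \<Rightarrow> (nat \<Rightarrow> nat)" where
  "bd_act d g x = (if x \<in> tbdry d then (\<lambda>j. g (map x [0..<Suc j]) ! j) else x)"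

text \<open>Rooted automorphism given by a permutation tau of {1..d 0}: g(t y) = tau(t) y.\<close>
definition rooted :: "(nat \<Rightarrow> nat) \<Rightarrow> (nat \<Rightarrow> nat) \<Rightarrow> nat list \<Rightarrow> nat list" where
  "rooted d \<tau> v = (if v \<in> tverts d \<and> v \<noteq> [] then \<tau> (hd v) # tl v else v)"

text \<open>The group H_d: an element is given by permutations sig l t of {1..d l}
  (l \<ge> 1, t in {2..d (l-1)}); it fixes the ray 1^infinity and acts on the subtree
  rooted at 1^(l-1) t as the rooted automorphism sig l t.  Unfolding the recursive
  definition h = (h', sig_2, ..., sig_{d_0}) gives exactly this map.\<close>
fun hmap_aux :: "(nat \<Rightarrow> nat \<Rightarrow> nat \<Rightarrow> nat) \<Rightarrow> nat \<Rightarrow> nat list \<Rightarrow> nat list" where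
  "hmap_aux sig l [] = []"
| "hmap_aux sig l (a # w) =
     (if a = 1 then 1 # hmap_aux sig (Suc l) w
      else (case w of [] \<Rightarrow> [a] | b # w' \<Rightarrow> a # sig (Suc l) a b # w'))"

definition hmap :: "(nat \<Rightarrow> nat) \<Rightarrow> (nat \<Rightarrow> nat \<Rightarrow> nat \<Rightarrow> nat) \<Rightarrow> nat list \<Rightarrow> nat list" where
  "hmap d sig v = (if v \<in> tverts d then hmap_aux sig 0 v else v)"

definition Hd :: "(nat \<Rightarrow> nat) \<Rightarrow> (nat list \<Rightarrow> nat list) set" where
  "Hd d = {hmap d sig | sig. \<forall>l\<ge>1. \<forall>t\<in>{2..d (l - 1)}. sig l t permutes {1..d l}}"

text \<open>The coordinate of h in the factor S_{d_l} indexed by t in {2..d (l-1)}: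
  the permutation by which h acts at the vertex 1^(l-1) t.\<close>
definition hcoord :: "(nat \<Rightarrow> nat) \<Rightarrow> (nat list \<Rightarrow> nat list) \<Rightarrow> nat \<Rightarrow> nat \<Rightarrow> nat \<Rightarrow> nat" where
  "hcoord d h l t = (\<lambda>i. if i \<in> {1..d l} then h (replicate (l - 1) 1 @ [t, i]) ! l else i)"

text \<open>Permutational wreath product F wr_{boundary} Aut(T). Elements are pairs (phi, g);
  phi is normalised to be 1 off the boundary.  Product convention (g f)(x) = f(g(x)),
  so the automorphism part of g g' is g' o g, and (g.phi)(x) = phi(g(x)).\<close>
type_synonym ('f) welem = "((nat \<Rightarrow> nat) \<Rightarrow> 'f) \<times> (nat list \<Rightarrow> nat list)"

definition wmult :: "('f, 'z) monoid_scheme \<Rightarrow> (nat \<Rightarrow> nat) \<Rightarrow> 'f welem \<Rightarrow> 'f welem \<Rightarrow> 'f welem" where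
  "wmult F d a b = ((\<lambda>x. if x \<in> tbdry d then fst a x \<otimes>\<^bsub>F\<^esub> fst b (bd_act d (snd a) x) else \<one>\<^bsub>F\<^esub>),
                     snd b \<circ> snd a)"

definition wone :: "('f, 'z) monoid_scheme \<Rightarrow> 'f welem" where
  "wone F = ((\<lambda>x. \<one>\<^bsub>F\<^esub>), id)"

text \<open>phi_f: equal to f at 1^infinity and trivial elsewhere.\<close>
definition phi_el :: "('f, 'z) monoid_scheme \<Rightarrow> 'f \<Rightarrow> 'f welem" where
  "phi_el F f = ((\<lambda>x. if x = ones then f else \<one>\<^bsub>F\<^esub>), id)"

text \<open>The rooted group S_{d_0} inside the wreath product.\<close>
definition rooted_grp :: "('f, 'z) monoid_scheme \<Rightarrow> (nat \<Rightarrow> nat) \<Rightarrow> 'f welem set" where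
  "rooted_grp F d = {((\<lambda>x. \<one>\<^bsub>F\<^esub>), rooted d \<tau>) | \<tau>. \<tau> permutes {1..d 0}}"

text \<open>HF = { h phi_f : h in H, f in F }.\<close>
definition HF_set :: "('f, 'z) monoid_scheme \<Rightarrow> (nat \<Rightarrow> nat) \<Rightarrow> (nat list \<Rightarrow> nat list) set \<Rightarrow> 'f welem set" where
  "HF_set F d H = {wmult F d ((\<lambda>x. \<one>\<^bsub>F\<^esub>), h) (phi_el F f) | h f. h \<in> H \<and> f \<in> carrier F}"

text \<open>The step law mu: law of s k s' with s, s' uniform on S_{d_0}, k uniform on HF.\<close>
definition step_law :: "('f, 'z) monoid_scheme \<Rightarrow> (nat \<Rightarrow> nat) \<Rightarrow> (nat list \<Rightarrow> nat list) set \<Rightarrow> 'f welem pmf" where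
  "step_law F d H =
     do { s \<leftarrow> pmf_of_set (rooted_grp F d);
          k \<leftarrow> pmf_of_set (HF_set F d H);
          s' \<leftarrow> pmf_of_set (rooted_grp F d);
          return_pmf (wmult F d (wmult F d s k) s') }"

text \<open>Convolution powers mu^{*n}: law of X_1 ... X_n with X_i iid of law mu.\<close>
primrec conv_pow :: "('f, 'z) monoid_scheme \<Rightarrow> (nat \<Rightarrow> nat) \<Rightarrow> 'f welem pmf \<Rightarrow> nat \<Rightarrow> 'f welem pmf" where
  "conv_pow F d \<mu> 0 = return_pmf (wone F)"
| "conv_pow F d \<mu> (Suc n) = bind_pmf (conv_pow F d \<mu> n) (\<lambda>a. map_pmf (\<lambda>b. wmult F d a b) \<mu>)"

text \<open>Shannon entropy (natural logarithm) of a finitely supported law.\<close>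
definition pmf_entropy :: "'a pmf \<Rightarrow> real" where
  "pmf_entropy p = - (\<Sum>\<gamma>\<in>set_pmf p. pmf p \<gamma> * ln (pmf p \<gamma>))"

definition rw_entropy :: "('f, 'z) monoid_scheme \<Rightarrow> (nat \<Rightarrow> nat) \<Rightarrow> (nat list \<Rightarrow> nat list) set \<Rightarrow> nat \<Rightarrow> real" where
  "rw_entropy F d H n = pmf_entropy (conv_pow F d (step_law F d H) n)"

text \<open>Exponent sequence.\<close>
definition pexp :: "(nat \<Rightarrow> nat) \<Rightarrow> nat \<Rightarrow> real" where
  "pexp d i = (real (d i) - 1) / (real (d i))^2"

definition kfun :: "(nat \<Rightarrow> nat) \<Rightarrow> nat \<Rightarrow> nat" where
  "kfun d n = (LEAST k. (\<Prod>i\<le>k. pexp d i) * real n \<le> 1)"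

definition beta :: "(nat \<Rightarrow> nat) \<Rightarrow> nat \<Rightarrow> real" where
  "beta d n = ln (real (\<Prod>i\<le>kfun d n. d i)) / ln (real n)"

end

theory Submission
  imports Defs "HOL-Real_Asymp.Real_Asymp"
begin

text \<open>
  Follow a uniformly random vertex v of level k under the walk and record, along its trajectory, a
  symbol \<open>True\<close> whenever it sits at \<open>1^k\<close> when the HF letter acts, and \<open>False\<close> whenever it sits at
  \<open>1^(k-1) t\<close> with \<open>t \<noteq> 1\<close>, where that letter resamples what lies below. By saturation, the record at
  level k+1 is a function of the record at level k and fresh uniform digits: a \<open>False\<close> resamples the
  digit, and a \<open>True\<close> emits whether the digit is 1. A record with m maximal blocks of \<open>True\<close> hence
  produces as many blocks as there are runs of ones among m independent bits of bias 1/d, that is about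
  m (d-1)/d^2 of them, with variance of the order of the mean. Starting from n blocks, about
  \<open>p_0 ... p_(k-1) n\<close> blocks survive at level k.

  Lower bound: conditionally on the tree letters, the lamp configuration is at least as spread as
  independent uniform values at the visited level-k vertices, so the entropy is at least \<open>log |F|\<close> times
  their expected number, which by the second moment method is a fixed proportion of the level as long
  as \<open>p_0 ... p_(k-1) n \<ge> 1\<close>.

  Upper bound: the n-th position of the walk can be reconstructed from the permutation of level k and,
  for each vertex of that level, its sequence of letters with adjacent letters of the same kind
  multiplied together. This sequence has length at most twice the number of blocks plus one, so once
  \<open>p_0 ... p_(k-1) n \<le> 1\<close> the code has expected length of the order of \<open>D log D\<close>, D being the size of the
  level. Since k(n) is the threshold between the two regimes and is O(log n), both bounds agree up to
  factors polynomial in log n.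
\<close>

section \<open>Records of visits and their propagation through the levels\<close>

text \<open>The flag tells whether the symbol preceding the list was \<open>True\<close>.\<close>

fun blocks :: "bool \<Rightarrow> bool list \<Rightarrow> nat" where
  "blocks p [] = 0"
| "blocks p (b # w) = (if b \<and> \<not> p then 1 else 0) + blocks b w"

text \<open>Expectation of \<open>\<Phi>\<close> over the record emitted by one level with m digits and current digit z, when
  it is fed the record w.\<close>

fun layer :: "nat \<Rightarrow> nat \<Rightarrow> (bool list \<Rightarrow> real) \<Rightarrow> bool list \<Rightarrow> real" where
  "layer m z \<Phi> [] = \<Phi> []"
| "layer m z \<Phi> (b # w) = (if b then layer m z (\<lambda>u. \<Phi> ((z = 1) # u)) w
      else (\<Sum>z'\<in>{1..m}. layer m z' \<Phi> w) / real m)"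

text \<open>The record emitted at one level is the input of the next, so this is the expectation of
  \<open>\<Phi>\<close> over the record at depth \<open>length v\<close>, given the current digits v
  and the input w at the root.\<close>

fun cascade :: "(nat \<Rightarrow> nat) \<Rightarrow> nat list \<Rightarrow> (bool list \<Rightarrow> real) \<Rightarrow> bool list \<Rightarrow> real" where
  "cascade d [] \<Phi> w = \<Phi> w"
| "cascade d (z # zs) \<Phi> w = layer (d 0) z (cascade (\<lambda>i. d (Suc i)) zs \<Phi>) w"

text \<open>Expectation of f over the number of runs of ones in m independent bits of bias q; the flag tells
  whether a one precedes them.\<close>

fun run_mean :: "real \<Rightarrow> (nat \<Rightarrow> real) \<Rightarrow> bool \<Rightarrow> nat \<Rightarrow> real" where
  "run_mean q f p 0 = f 0"
| "run_mean q f p (Suc m) =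
     q * run_mean q (\<lambda>c. f ((if p then 0 else 1) + c)) True m + (1 - q) * run_mean q f False m"

section \<open>One level: from blocks of the input to runs of independent bits\<close>

lemma layer_add: "layer m z (\<lambda>u. \<Phi> u + \<Psi> u) w = layer m z \<Phi> w + layer m z \<Psi> w"
  by (induction w arbitrary: z \<Phi> \<Psi>) (auto simp: sum.distrib add_divide_distrib)

lemma layer_cmult: "layer m z (\<lambda>u. c * \<Phi> u) w = c * layer m z \<Phi> w"
  by (induction w arbitrary: z \<Phi>) (auto simp: sum_distrib_left)

lemma layer_sum: "layer m z (\<lambda>u. \<Sum>i\<in>I. \<Phi> i u) w = (\<Sum>i\<in>I. layer m z (\<Phi> i) w)"
proof (induction w arbitrary: z \<Phi>)
  case (Cons b w)
  have "(\<Sum>z'\<in>{1..m}. \<Sum>i\<in>I. layer m z' (\<Phi> i) w) = (\<Sum>i\<in>I. \<Sum>z'\<in>{1..m}. layer m z' (\<Phi> i) w)"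
    by (rule sum.swap)
  then show ?case using Cons by (simp add: sum_divide_distrib)
qed simp

lemma layer_divide: "layer m z (\<lambda>u. \<Phi> u / c) w = layer m z \<Phi> w / c"
  using layer_cmult[of m z "1/c" \<Phi> w] by simp

lemma layer_mono: "(\<And>u. \<Phi> u \<le> \<Psi> u) \<Longrightarrow> layer m z \<Phi> w \<le> layer m z \<Psi> w"
  by (induction w arbitrary: z \<Phi> \<Psi>) (auto intro!: divide_right_mono sum_mono)

text \<open>Between two resamplings every reading of the digit emits the same symbol. Each block of
  \<open>True\<close> in the input thus yields one independent bit, up to repetition, equal to one
  with probability 1/m, and output blocks are runs of ones among these bits. The two claims are
  proved together: in the first the digit is uniform and unread since it was drawn, in the second z
  has just been read, so the symbol emitted last was \<open>z = 1\<close>.\<close>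

lemma layer_blocks:
  assumes "m \<ge> 1"
  shows "(\<Sum>z\<in>{1..m}. layer m z (\<lambda>u. f (blocks p u)) w) / real m
           = run_mean (1 / real m) f p (blocks False w)"
    and "layer m z (\<lambda>u. f (blocks (z = 1) u)) w = run_mean (1 / real m) f (z = 1) (blocks True w)"
proof (induction w arbitrary: f p z)
  case Nil
  { case 1 show ?case using assms by simp }
  { case 2 show ?case by simp }
next
  case (Cons b w)
  { case 1
    show ?case
    proof (cases b)
      case True
      \<comment> \<open>The digit 1 emits \<open>True\<close>, the other m - 1 digits emit
        \<open>False\<close>; afterwards the digit counts as read, so the second claim applies to
        each term.\<close>
      have "(\<Sum>z\<in>{1..m}. layer m z (\<lambda>u. f (blocks p ((z = 1) # u))) w)
        = layer m 1 (\<lambda>u. f (blocks p (True # u))) w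
          + (\<Sum>z\<in>{2..m}. layer m z (\<lambda>u. f (blocks p ((z = 1) # u))) w)"
        using assms by (subst sum.atLeast_Suc_atMost) (auto simp: numeral_2_eq_2)
      also have "layer m 1 (\<lambda>u. f (blocks p (True # u))) w
         = run_mean (1 / real m) (\<lambda>c. f ((if p then 0 else 1) + c)) True (blocks True w)"
        using Cons.IH(2)[where z = 1 and f = "\<lambda>c. f ((if p then 0 else 1) + c)"] by (cases p) simp_all
      also have "(\<Sum>z\<in>{2..m}. layer m z (\<lambda>u. f (blocks p ((z = 1) # u))) w)
         = (\<Sum>z\<in>{2..m}. run_mean (1 / real m) f False (blocks True w))"
      proof (rule sum.cong)
        fix z assume "z \<in> {2..m}"
        then show "layer m z (\<lambda>u. f (blocks p ((z = 1) # u))) w = run_mean (1 / real m) f False (blocks True w)"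
          using Cons.IH(2)[where z = z and f = f] by simp
      qed simp
      finally show ?thesis using assms True by (simp add: field_simps of_nat_diff)
    next
      case False
      then show ?thesis using Cons.IH(1)[of f p] assms by simp
    qed }
  { case 2
    show ?case
    proof (cases b)
      case True
      show ?thesis using Cons.IH(2)[where z = z and f = f] True by simp
    next
      case False
      then show ?thesis using Cons.IH(1)[of f "z = 1"] by simp
    qed }
qed

section \<open>Moments of the number of runs\<close>

lemma run_mean_add: "run_mean q (\<lambda>c. f c + g c) p m = run_mean q f p m + run_mean q g p m"
  by (induction m arbitrary: f g p) (auto simp: algebra_simps)

lemma run_mean_cmult: "run_mean q (\<lambda>c. a * f c) p m = a * run_mean q f p m"
  by (induction m arbitrary: f p) (auto simp: algebra_simps)

lemma run_mean_const: "run_mean q (\<lambda>c. a) p m = a"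
  by (induction m arbitrary: p) (auto simp: algebra_simps)

text \<open>A bit starts a run when it is one and its predecessor is zero, which has probability q -
  q^2; the first bit has probability q without a preceding one and 0 with it, hence the correction
  term.\<close>

lemma run_mean_first:
  "run_mean q real p m = (if m = 0 then 0 else real m * (q - q\<^sup>2) + (if p then q\<^sup>2 - q else q\<^sup>2))"
proof (induction m arbitrary: p)
  case (Suc m)
  have "run_mean q (\<lambda>c. 1 + real c) True m = 1 + run_mean q real True m"
    by (simp add: run_mean_add run_mean_const)
  then show ?case using Suc by (auto simp: algebra_simps power2_eq_square)
qed simp

text \<open>Two consecutive positions cannot both start a run and positions further apart are independent,
  which gives the closed form.\<close>

lemma run_mean_falling:
  "run_mean q (\<lambda>c. real c * (real c - 1)) p (Suc (Suc m)) =
     (if p then 0 else 2 * q * (q - q\<^sup>2) * real m) + (q - q\<^sup>2)\<^sup>2 * real m * (real m - 1)"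
proof (induction m arbitrary: p)
  case 0
  show ?case by (simp add: numeral_2_eq_2)
next
  case (Suc m)
  let ?g = "\<lambda>c. real c * (real c - 1)"
  \<comment> \<open>A newly opened run turns c (c - 1) into (1 + c) c = c (c - 1) + 2 c, so the
    first moment enters the recursion.\<close>
  have "run_mean q (\<lambda>c. (1 + real c) * real c) True (Suc (Suc m))
      = run_mean q (\<lambda>c. ?g c + 2 * real c) True (Suc (Suc m))"
    by (rule arg_cong[where f = "\<lambda>f. run_mean q f True (Suc (Suc m))"]) (auto simp: algebra_simps)
  also have "\<dots> = run_mean q ?g True (Suc (Suc m)) + 2 * run_mean q real True (Suc (Suc m))"
    by (simp only: run_mean_add run_mean_cmult)
  finally have *: "run_mean q (\<lambda>c. (1 + real c) * real c) True (Suc (Suc m)) =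
     (q - q\<^sup>2)\<^sup>2 * real m * (real m - 1) + 2 * ((real m + 1) * (q - q\<^sup>2))"
    using Suc[of True] by (simp only: run_mean_first) (simp add: algebra_simps)
  show ?case
    unfolding run_mean.simps(2)[of q _ p "Suc (Suc m)"]
    using * Suc[of True] Suc[of False]
    by (simp del: run_mean.simps) (simp add: algebra_simps power2_eq_square)
qed

text \<open>The variance is at most the mean, since the closed form bounds the factorial moment by
  the square of the mean. For m = 0 the quantity M = m (q - q^2) + q^2 exceeds the mean, which keeps
  one formula for all m.\<close>

lemma run_mean_square_le:
  assumes "0 \<le> q" "q \<le> 1"
  shows "run_mean q (\<lambda>c. (real c)\<^sup>2) False m
     \<le> (real m * (q - q\<^sup>2) + q\<^sup>2)\<^sup>2 + (real m * (q - q\<^sup>2) + q\<^sup>2)"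
proof -
  define p where "p = q - q\<^sup>2"
  have p: "0 \<le> p" using assms by (simp add: p_def power2_eq_square mult_left_le)
  have split: "run_mean q (\<lambda>c. (real c)\<^sup>2) False m
     = run_mean q (\<lambda>c. real c * (real c - 1)) False m + run_mean q real False m"
    unfolding run_mean_add[symmetric]
    by (rule arg_cong[where f = "\<lambda>f. run_mean q f False m"]) (auto simp: algebra_simps power2_eq_square)
  \<comment> \<open>The closed form for the factorial moment starts at m = 2.\<close>
  consider "m = 0" | "m = 1" | j where "m = Suc (Suc j)" by (metis One_nat_def not0_implies_Suc)
  then show ?thesis
  proof cases
    case 3
    have "2 * q * p * real j + p\<^sup>2 * real j * (real j - 1) \<le> ((real j + 2) * p + q\<^sup>2)\<^sup>2"
    proof -
      \<comment> \<open>Substitute q = p + q^2.\<close>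
      have "2 * q * p * real j = 2 * p\<^sup>2 * real j + 2 * p * q\<^sup>2 * real j"
        by (simp add: p_def power2_eq_square algebra_simps)
      moreover have "((real j + 2) * p + q\<^sup>2)\<^sup>2 - (2 * p\<^sup>2 * real j + 2 * p * q\<^sup>2 * real j + p\<^sup>2 * real j * (real j - 1))
        = p\<^sup>2 * (3 * real j + 4) + 4 * p * q\<^sup>2 + (q\<^sup>2)\<^sup>2"
        by (simp add: power2_eq_square algebra_simps)
      moreover have "0 \<le> p\<^sup>2 * (3 * real j + 4) + 4 * p * q\<^sup>2 + (q\<^sup>2)\<^sup>2" using p by simp
      ultimately show ?thesis by linarith
    qed
    moreover have "run_mean q (\<lambda>c. (real c)\<^sup>2) False m
       = 2 * q * p * real j + p\<^sup>2 * real j * (real j - 1) + ((real j + 2) * p + q\<^sup>2)"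
      using split run_mean_falling[of q False j] run_mean_first[of q False m]
      by (simp add: 3 p_def del: run_mean.simps)
    ultimately show ?thesis
      unfolding p_def[symmetric] by (simp add: 3 add.commute del: run_mean.simps)
  next
    case 2
    then show ?thesis using assms by (simp add: power2_eq_square)
  qed (use assms in \<open>simp\<close>)
qed

section \<open>Levels of the tree and averages over them\<close>

definition level :: "(nat \<Rightarrow> nat) \<Rightarrow> nat \<Rightarrow> nat list set" where
  "level d k = {v \<in> tverts d. length v = k}"

lemma Cons_in_tverts: "z # zs \<in> tverts d \<longleftrightarrow> z \<in> {1..d 0} \<and> zs \<in> tverts (\<lambda>i. d (Suc i))"
proof -
  have "(\<forall>j<Suc n. P j) \<longleftrightarrow> P 0 \<and> (\<forall>j<n. P (Suc j))" for n and P :: "nat \<Rightarrow> bool"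
    using less_Suc_eq_0_disj by auto
  then show ?thesis by (simp add: tverts_def)
qed

lemma level_0: "level d 0 = {[]}"
  by (auto simp: level_def tverts_def)

lemma level_Suc: "level d (Suc k) = (\<lambda>(z, zs). z # zs) ` ({1..d 0} \<times> level (\<lambda>i. d (Suc i)) k)"
  by (auto simp: level_def Cons_in_tverts length_Suc_conv image_iff)

lemma sum_level_Suc:
  "(\<Sum>v\<in>level d (Suc k). g v) = (\<Sum>z\<in>{1..d 0}. \<Sum>zs\<in>level (\<lambda>i. d (Suc i)) k. g (z # zs))"
  unfolding level_Suc by (subst sum.reindex) (auto simp: inj_on_def sum.cartesian_product split_def)

lemma finite_level: "finite (level d k)"
  by (induction k arbitrary: d) (auto simp: level_0 level_Suc)

lemma card_level: "card (level d k) = (\<Prod>i<k. d i)"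
proof (induction k arbitrary: d)
  case (Suc k)
  then show ?case
    unfolding level_Suc by (subst card_image) (auto simp: inj_on_def card_cartesian_product prod.lessThan_Suc_shift simp del: prod.lessThan_Suc)
qed (simp add: level_0)

definition level_mean :: "(nat \<Rightarrow> nat) \<Rightarrow> nat \<Rightarrow> (bool list \<Rightarrow> real) \<Rightarrow> bool list \<Rightarrow> real" where
  "level_mean d k \<Phi> w = (\<Sum>v\<in>level d k. cascade d v \<Phi> w) / real (card (level d k))"

lemma level_mean_0: "level_mean d 0 \<Phi> w = \<Phi> w"
  by (simp add: level_mean_def level_0)

text \<open>The first digit of a uniform vertex is uniform and independent of the others, and
  \<open>layer\<close> is linear, so the lower levels can be averaged inside it.\<close>

lemma level_mean_Suc:
  "level_mean d (Suc k) \<Phi> w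
     = (\<Sum>z\<in>{1..d 0}. layer (d 0) z (level_mean (\<lambda>i. d (Suc i)) k \<Phi>) w) / real (d 0)"
  unfolding level_mean_def sum_level_Suc card_level
  by (simp add: layer_sum layer_divide sum_divide_distrib[symmetric] prod.lessThan_Suc_shift mult.commute del: prod.lessThan_Suc)

lemma cascade_mono: "(\<And>u. \<Phi> u \<le> \<Psi> u) \<Longrightarrow> cascade d v \<Phi> w \<le> cascade d v \<Psi> w"
  by (induction v arbitrary: d w) (auto intro: layer_mono)

lemma cascade_add: "cascade d v (\<lambda>u. \<Phi> u + \<Psi> u) w = cascade d v \<Phi> w + cascade d v \<Psi> w"
proof (induction v arbitrary: d w)
  case (Cons z v)
  then have "cascade d v (\<lambda>u. \<Phi> u + \<Psi> u) = (\<lambda>w. cascade d v \<Phi> w + cascade d v \<Psi> w)" for d by blast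
  then show ?case by (simp add: layer_add)
qed simp

lemma cascade_cmult: "cascade d v (\<lambda>u. c * \<Phi> u) w = c * cascade d v \<Phi> w"
proof (induction v arbitrary: d w)
  case (Cons z v)
  then have "cascade d v (\<lambda>u. c * \<Phi> u) = (\<lambda>w. c * cascade d v \<Phi> w)" for d by blast
  then show ?case by (simp add: layer_cmult)
qed simp

lemma level_mean_mono: "(\<And>u. \<Phi> u \<le> \<Psi> u) \<Longrightarrow> level_mean d k \<Phi> w \<le> level_mean d k \<Psi> w"
  unfolding level_mean_def by (intro divide_right_mono sum_mono cascade_mono) auto

lemma level_mean_add: "level_mean d k (\<lambda>u. \<Phi> u + \<Psi> u) w = level_mean d k \<Phi> w + level_mean d k \<Psi> w"
  by (simp add: level_mean_def cascade_add sum.distrib add_divide_distrib)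

lemma level_mean_cmult: "level_mean d k (\<lambda>u. c * \<Phi> u) w = c * level_mean d k \<Phi> w"
  by (simp add: level_mean_def cascade_cmult sum_distrib_left)

text \<open>Induction step for all moment bounds: a bound on the lower levels in terms of the number
  of blocks they receive is integrated against the law of that number from
  \<open>layer_blocks\<close>.\<close>

lemma level_mean_Suc_le:
  assumes "d 0 \<ge> 1" and "\<And>u. level_mean (\<lambda>i. d (Suc i)) k \<Phi> u \<le> f (blocks False u)"
  shows "level_mean d (Suc k) \<Phi> w \<le> run_mean (1 / real (d 0)) f False (blocks False w)"
proof -
  have "level_mean d (Suc k) \<Phi> w
     \<le> (\<Sum>z\<in>{1..d 0}. layer (d 0) z (\<lambda>u. f (blocks False u)) w) / real (d 0)"
    unfolding level_mean_Suc by (intro divide_right_mono sum_mono layer_mono assms(2)) auto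
  then show ?thesis using layer_blocks(1)[OF assms(1)] by simp
qed

lemma level_mean_Suc_ge:
  assumes "d 0 \<ge> 1" and "\<And>u. level_mean (\<lambda>i. d (Suc i)) k \<Phi> u \<ge> f (blocks False u)"
  shows "level_mean d (Suc k) \<Phi> w \<ge> run_mean (1 / real (d 0)) f False (blocks False w)"
proof -
  have "level_mean d (Suc k) \<Phi> w
     \<ge> (\<Sum>z\<in>{1..d 0}. layer (d 0) z (\<lambda>u. f (blocks False u)) w) / real (d 0)"
    unfolding level_mean_Suc by (intro divide_right_mono sum_mono layer_mono assms(2)) auto
  then show ?thesis using layer_blocks(1)[OF assms(1)] by simp
qed

section \<open>Survival rates and moments of the number of blocks at level k\<close>

lemma pexp_eq: "d i \<ge> 1 \<Longrightarrow> pexp d i = 1 / real (d i) - (1 / real (d i))\<^sup>2"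
  by (simp add: pexp_def field_simps power2_eq_square)

lemma pexp_nonneg: "d i \<ge> 1 \<Longrightarrow> 0 \<le> pexp d i"
  by (simp add: pexp_def)

lemma pexp_pos: "d i \<ge> 2 \<Longrightarrow> 0 < pexp d i"
  by (simp add: pexp_def)

lemma pexp_le: "pexp d i \<le> 1 / 4"
proof (cases "d i = 0")
  case False
  have "0 \<le> (real (d i) - 2)\<^sup>2" by simp
  then show ?thesis using False by (simp add: pexp_def field_simps power2_eq_square)
qed (simp add: pexp_def)

lemma prod_pexp_le: "(\<And>i. d i \<ge> 1) \<Longrightarrow> (\<Prod>i<k. pexp d i) \<le> (1 / 4) ^ k"
  using prod_mono[of "{..<k}" "pexp d" "\<lambda>_. 1/4"] pexp_le pexp_nonneg[of d] by (simp del: One_nat_def)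

lemma prod_pexp_Suc: "(\<Prod>i<Suc k. pexp d i) = pexp d 0 * (\<Prod>i<k. pexp (\<lambda>i. d (Suc i)) i)"
  by (simp add: prod.lessThan_Suc_shift pexp_def del: prod.lessThan_Suc)

text \<open>Each level multiplies the number of blocks by \<open>pexp\<close> up to an error q^2
  \<le> 1/4 coming from the first bit. Lower levels damp this error by at most
  \<open>(1/4)^k\<close>, so the errors are summable; the term \<open>1 - (1/4)^k\<close> is chosen
  to absorb them in the induction.\<close>

lemma level_mean_blocks_le:
  assumes "\<And>i. d i \<ge> 2"
  shows "level_mean d k (\<lambda>u. real (blocks False u)) w
    \<le> (\<Prod>i<k. pexp d i) * real (blocks False w) + (1 - (1 / 4) ^ k)"
  using assms
proof (induction k arbitrary: d w)
  case (Suc k)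
  define P where "P = (\<Prod>i<k. pexp (\<lambda>i. d (Suc i)) i)"
  define q where "q = 1 / real (d 0)"
  have d0: "2 \<le> d 0" using Suc.prems by simp
  have P0: "0 \<le> P" unfolding P_def using Suc.prems
    by (intro prod_nonneg) (auto intro!: pexp_nonneg order_trans[OF _ Suc.prems])
  have P1: "P \<le> (1/4)^k" unfolding P_def using Suc.prems
    by (intro prod_pexp_le) (auto intro!: order_trans[OF _ Suc.prems])
  have q: "q\<^sup>2 \<le> 1/4" using d0 unfolding q_def
    using power_mono[of "1 / real (d 0)" "1/2" 2] by (auto simp: field_simps power2_eq_square)
  let ?m = "blocks False w"
  have "level_mean d (Suc k) (\<lambda>u. real (blocks False u)) w
    \<le> run_mean q (\<lambda>c. P * real c + (1 - (1/4)^k)) False ?m"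
    unfolding q_def P_def using d0 by (intro level_mean_Suc_le Suc.IH Suc.prems) simp
  also have "\<dots> = P * run_mean q real False ?m + (1 - (1/4)^k)"
    by (simp add: run_mean_add run_mean_cmult run_mean_const)
  also have "\<dots> \<le> P * (real ?m * pexp d 0 + q\<^sup>2) + (1 - (1/4)^k)"
    using d0 P0 by (auto simp: run_mean_first pexp_eq q_def)
  also have "\<dots> \<le> P * (real ?m * pexp d 0) + (1 - (1 / 4) ^ Suc k)"
  proof -
    \<comment> \<open>The allowance grows by 3/4 of \<open>(1/4)^k\<close>, three times what the new
      error needs.\<close>
    have "P * q\<^sup>2 \<le> (1/4)^k * (1/4)" using P1 q P0 by (intro mult_mono) auto
    moreover have "0 \<le> (1/4 :: real)^k" by simp
    ultimately have "P * q\<^sup>2 + (1 - (1/4)^k) \<le> 1 - (1/4) ^ Suc k" unfolding power_Suc by linarith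
    then show ?thesis by (simp add: distrib_left)
  qed
  also have "P * (real ?m * pexp d 0) = (\<Prod>i<Suc k. pexp d i) * real ?m"
    unfolding prod_pexp_Suc P_def by simp
  finally show ?case .
qed (simp add: level_mean_0)

lemma level_mean_blocks_ge:
  assumes "\<And>i. d i \<ge> 2"
  shows "level_mean d k (\<lambda>u. real (blocks False u)) w
    \<ge> (\<Prod>i<k. pexp d i) * real (blocks False w)"
  using assms
proof (induction k arbitrary: d w)
  case (Suc k)
  define P where "P = (\<Prod>i<k. pexp (\<lambda>i. d (Suc i)) i)"
  define q where "q = 1 / real (d 0)"
  have d0: "2 \<le> d 0" using Suc.prems by simp
  have P0: "0 \<le> P" unfolding P_def using Suc.prems
    by (intro prod_nonneg) (auto intro!: pexp_nonneg order_trans[OF _ Suc.prems])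
  let ?m = "blocks False w"
  have "(\<Prod>i<Suc k. pexp d i) * real ?m = P * (real ?m * pexp d 0)"
    unfolding prod_pexp_Suc P_def by simp
  also have "\<dots> \<le> P * run_mean q real False ?m"
    using d0 P0 by (auto simp: run_mean_first pexp_eq q_def intro!: mult_left_mono)
  also have "\<dots> = run_mean q (\<lambda>c. P * real c) False ?m"
    by (simp add: run_mean_cmult)
  also have "\<dots> \<le> level_mean d (Suc k) (\<lambda>u. real (blocks False u)) w"
    unfolding q_def P_def using d0 by (intro level_mean_Suc_ge Suc.IH Suc.prems) simp
  finally show ?case .
qed (simp add: level_mean_0)

text \<open>The variance added at a level is at most the mean there, and its effect further down is
  damped geometrically. The coefficient is 0 at k = 0, where the bound is an equality, and stays
  below 2.\<close>

lemma level_mean_blocks_square_le: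
  assumes "\<And>i. d i \<ge> 2"
  shows "level_mean d k (\<lambda>u. (real (blocks False u))\<^sup>2) w
    \<le> ((\<Prod>i<k. pexp d i) * real (blocks False w))\<^sup>2
      + 2 * (1 - (1 / 4) ^ k) * ((\<Prod>i<k. pexp d i) * real (blocks False w) + 1)"
  using assms
proof (induction k arbitrary: d w)
  case (Suc k)
  define P where "P = (\<Prod>i<k. pexp (\<lambda>i. d (Suc i)) i)"
  define q where "q = 1 / real (d 0)"
  define p where "p = pexp d 0"
  define e :: real where "e = (1/4)^k"
  have d0: "2 \<le> d 0" using Suc.prems by simp
  have P0: "0 \<le> P" unfolding P_def using Suc.prems
    by (intro prod_nonneg) (auto intro!: pexp_nonneg order_trans[OF _ Suc.prems])
  have P1: "P \<le> e" unfolding P_def e_def using Suc.prems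
    by (intro prod_pexp_le) (auto intro!: order_trans[OF _ Suc.prems])
  have e: "0 \<le> e" "e \<le> 1" by (auto simp: e_def power_le_one)
  have q01: "0 \<le> q" "q \<le> 1" using d0 by (auto simp: q_def)
  have q: "q\<^sup>2 \<le> 1/4" using d0 unfolding q_def
    using power_mono[of "1 / real (d 0)" "1/2" 2] by (auto simp: field_simps power2_eq_square)
  have p0: "0 \<le> p" using d0 unfolding p_def by (intro pexp_nonneg) auto
  have pq: "p = q - q\<^sup>2" using d0 unfolding p_def q_def by (intro pexp_eq) auto
  define m where "m = real (blocks False w)"
  have m0: "0 \<le> m" by (simp add: m_def)
  let ?R = "run_mean q"
  have "level_mean d (Suc k) (\<lambda>u. (real (blocks False u))\<^sup>2) w
    \<le> ?R (\<lambda>c. (P * real c)\<^sup>2 + 2 * (1 - e) * (P * real c + 1)) False (blocks False w)"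
    unfolding q_def P_def e_def using d0 by (intro level_mean_Suc_le Suc.IH Suc.prems) simp
  also have "\<dots> = P\<^sup>2 * ?R (\<lambda>c. (real c)\<^sup>2) False (blocks False w)
       + 2 * (1 - e) * (P * ?R real False (blocks False w) + 1)"
    by (simp add: run_mean_add run_mean_cmult run_mean_const power_mult_distrib)
  also have "\<dots> \<le> P\<^sup>2 * ((m * p + q\<^sup>2)\<^sup>2 + (m * p + q\<^sup>2)) + 2 * (1 - e) * (P * (m * p + q\<^sup>2) + 1)"
  proof (intro add_mono mult_left_mono order_refl)
    show "?R (\<lambda>c. (real c)\<^sup>2) False (blocks False w) \<le> (m * p + q\<^sup>2)\<^sup>2 + (m * p + q\<^sup>2)"
      using run_mean_square_le[OF q01] unfolding m_def pq by simp
    show "?R real False (blocks False w) \<le> m * p + q\<^sup>2"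
      unfolding m_def pq run_mean_first by auto
  qed (use P0 e in auto)
  also have "\<dots> \<le> (P * (m * p))\<^sup>2 + 2 * (1 - e / 4) * (P * (m * p) + 1)"
  proof -
    \<comment> \<open>X is the main term; each remaining product is bounded using P \<le> e and q^2
      \<le> 1/4.\<close>
    define X where "X = P * (m * p)"
    have X0: "0 \<le> X" using P0 m0 p0 by (simp add: X_def)
    have a: "P * q\<^sup>2 \<le> e / 4" using mult_mono[OF P1 q] P0 e by simp
    have a0: "0 \<le> P * q\<^sup>2" using P0 by simp
    have "P * X \<le> e * X" using P1 X0 by (rule mult_right_mono)
    moreover have "P * (P * q\<^sup>2) \<le> e * (e / 4)" using P1 a e(1) a0 by (rule mult_mono)
    moreover have "P * q\<^sup>2 * X \<le> e / 4 * X" using a X0 by (rule mult_right_mono)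
    moreover have "(P * q\<^sup>2)\<^sup>2 \<le> (e / 4)\<^sup>2" using a a0 by (rule power_mono)
    moreover have "(1 - e) * (P * q\<^sup>2) \<le> (1 - e) * (e / 4)" using a e by (intro mult_left_mono) auto
    ultimately have e1: "P * X \<le> e * X" "P * (P * q\<^sup>2) \<le> e * (e / 4)" "P * q\<^sup>2 * X \<le> e / 4 * X"
      "(P * q\<^sup>2)\<^sup>2 \<le> (e / 4)\<^sup>2" "(1 - e) * (P * q\<^sup>2) \<le> (1 - e) * (e / 4)" .
    have ee: "e * e \<le> e" using e by (simp add: mult_left_le)
    have "P\<^sup>2 * ((m * p + q\<^sup>2)\<^sup>2 + (m * p + q\<^sup>2)) + 2 * (1 - e) * (P * (m * p + q\<^sup>2) + 1)
       = X\<^sup>2 + 2 * (P * q\<^sup>2 * X) + (P * q\<^sup>2)\<^sup>2 + P * X + P * (P * q\<^sup>2)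
         + 2 * (1 - e) * (X + 1) + 2 * ((1 - e) * (P * q\<^sup>2))"
      by (simp add: X_def power2_eq_square algebra_simps)
    also have "\<dots> \<le> X\<^sup>2 + 2 * (e / 4 * X) + (e/4)\<^sup>2 + e * X + e * (e / 4)
         + 2 * (1 - e) * (X + 1) + 2 * ((1 - e) * (e / 4))"
      using e1 by linarith
    also have "\<dots> \<le> X\<^sup>2 + 2 * (1 - e / 4) * (X + 1)"
    proof -
      \<comment> \<open>The terms linear in X cancel: 2 is the least coefficient for which this
        estimate closes.\<close>
      have "X\<^sup>2 + 2 * (1 - e / 4) * (X + 1) - (X\<^sup>2 + 2 * (e / 4 * X) + (e/4)\<^sup>2 + e * X + e * (e / 4)
         + 2 * (1 - e) * (X + 1) + 2 * ((1 - e) * (e / 4))) = e + 3 / 16 * (e * e)"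
        by (simp add: power2_eq_square field_simps)
      then show ?thesis using e(1) mult_nonneg_nonneg[OF e(1) e(1)] by linarith
    qed
    finally show ?thesis unfolding X_def .
  qed
  also have "P * (m * p) = (\<Prod>i<Suc k. pexp d i) * m"
    unfolding prod_pexp_Suc P_def p_def by simp
  finally show ?case unfolding m_def e_def by simp
qed (simp add: level_mean_0)

lemma blocks_pos_iff: "blocks p w > 0 \<or> p \<longleftrightarrow> True \<in> set w \<or> p"
proof (induction w arbitrary: p)
  case (Cons b w)
  show ?case using Cons[of b] by (cases b) auto
qed simp

text \<open>Once the expected number of blocks is at least 1, its second moment is at most five
  times X^2, so a block is present with probability at least 1/5.\<close>

lemma level_mean_visit_ge:
  assumes "\<And>i. d i \<ge> 2" and "(\<Prod>i<k. pexp d i) * real (blocks False w) \<ge> 1"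
  shows "level_mean d k (\<lambda>u. of_bool (True \<in> set u)) w \<ge> 1 / 5"
proof -
  define X where "X = (\<Prod>i<k. pexp d i) * real (blocks False w)"
  have X: "X \<ge> 1" using assms by (simp add: X_def)
  \<comment> \<open>This a maximises 2 a X - 5 a^2 X^2, with maximum 1/5.\<close>
  define a where "a = 1 / (5 * X)"
  \<comment> \<open>Second moment method, linearised: \<open>1 - (1 - a m)^2\<close> is at most 1 and vanishes at m = 0.\<close>
  have pt: "2 * a * real (blocks False u) + - (a\<^sup>2) * (real (blocks False u))\<^sup>2 \<le> of_bool (True \<in> set u)" for u
  proof (cases "True \<in> set u")
    case True
    have "0 \<le> (1 - a * real (blocks False u))\<^sup>2" by simp
    then show ?thesis using True by (simp add: power2_eq_square algebra_simps)
  next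
    case False
    then have "blocks False u = 0" using blocks_pos_iff[of False u] by simp
    then show ?thesis by simp
  qed
  have M: "level_mean d k (\<lambda>u. (real (blocks False u))\<^sup>2) w \<le> 5 * X\<^sup>2"
  proof -
    have "level_mean d k (\<lambda>u. (real (blocks False u))\<^sup>2) w \<le> X\<^sup>2 + 2 * (1 - (1 / 4) ^ k) * (X + 1)"
      using level_mean_blocks_square_le[OF assms(1)] unfolding X_def .
    also have "2 * (1 - (1 / 4) ^ k) * (X + 1) \<le> 2 * (X + 1)"
      using X mult_right_mono[of "2 * (1 - (1 / 4) ^ k)" 2 "X + 1"] by simp
    also have "X\<^sup>2 + 2 * (X + 1) \<le> 5 * X\<^sup>2"
    proof -
      have "X \<le> X\<^sup>2" "1 \<le> X\<^sup>2" using X by (auto simp: power2_eq_square intro: order_trans[OF _ mult_mono[of 1 X 1 X]])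
      then show ?thesis by simp
    qed
    finally show ?thesis by simp
  qed
  have "1 / 5 = 2 * a * X - a\<^sup>2 * (5 * X\<^sup>2)" using X by (simp add: a_def power2_eq_square)
  also have "\<dots> \<le> 2 * a * level_mean d k (\<lambda>u. real (blocks False u)) w
      - a\<^sup>2 * level_mean d k (\<lambda>u. (real (blocks False u))\<^sup>2) w"
    using level_mean_blocks_ge[of d k w, OF assms(1)] M X
    by (intro diff_mono mult_left_mono) (auto simp: X_def a_def)
  also have "\<dots> = level_mean d k (\<lambda>u. 2 * a * real (blocks False u) + - (a\<^sup>2) * (real (blocks False u))\<^sup>2) w"
    by (simp only: level_mean_add level_mean_cmult)
  also have "\<dots> \<le> level_mean d k (\<lambda>u. of_bool (True \<in> set u)) w"
    by (intro level_mean_mono pt)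
  finally show ?thesis .
qed

section \<open>Tree automorphisms and their action on rays\<close>

fun conc :: "nat list \<Rightarrow> (nat \<Rightarrow> nat) \<Rightarrow> nat \<Rightarrow> nat" where
  "conc [] y = y"
| "conc (z # zs) y = case_nat z (conc zs y)"

lemma conc_nth: "conc v y j = (if j < length v then v ! j else y (j - length v))"
  by (induction v arbitrary: j) (auto split: nat.splits)

lemma conc_prefix: "map (conc v y) [0..<length v] = v"
  by (rule nth_equalityI) (auto simp: conc_nth)

lemma conc_prefix_suffix: "conc (map x [0..<k]) (\<lambda>j. x (j + k)) = x"
  by (rule ext) (auto simp: conc_nth)

lemma conc_suffix: "(\<lambda>j. conc v y (j + length v)) = y"
  by (rule ext) (auto simp: conc_nth)

lemma conc_eq_iff: "length v = length v' \<Longrightarrow> conc v y = conc v' y' \<longleftrightarrow> v = v' \<and> y = y'"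
  by (metis conc_prefix conc_suffix)

lemma conc_tbdry: "conc v y \<in> tbdry d \<longleftrightarrow> v \<in> tverts d \<and> y \<in> tbdry (\<lambda>i. d (length v + i))"
proof -
  have "(\<forall>j. P j) \<longleftrightarrow> (\<forall>j<n. P j) \<and> (\<forall>j. P (n + j))" for n and P :: "nat \<Rightarrow> bool"
    by (metis le_add_diff_inverse not_less)
  from this[of "\<lambda>j. conc v y j \<in> {1..d j}" "length v"]
  show ?thesis by (simp add: tbdry_def tverts_def conc_nth)
qed

lemma prefix_tverts: "x \<in> tbdry d \<Longrightarrow> map x [0..<n] \<in> tverts d"
  by (simp add: tbdry_def tverts_def)

lemma conc_replicate_ones: "conc (replicate k 1) y = ones \<longleftrightarrow> y = ones"
proof -
  have "conc (replicate k 1) ones = ones" by (rule ext) (simp add: conc_nth ones_def)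
  then show ?thesis using conc_eq_iff[of "replicate k 1" "replicate k 1" y ones] by simp
qed

section \<open>Prefix-compatible vertex maps and the boundary action\<close>

definition vertex_map :: "(nat \<Rightarrow> nat) \<Rightarrow> (nat list \<Rightarrow> nat list) \<Rightarrow> bool" where
  "vertex_map d g \<longleftrightarrow>
     (\<forall>v\<in>tverts d. g v \<in> tverts d \<and> length (g v) = length v \<and> (\<forall>i. take i (g v) = g (take i v)))
     \<and> (\<forall>v. v \<notin> tverts d \<longrightarrow> g v = v)"

text \<open>The inverse is required to be prefix-compatible as well, so that surjectivity and
  injectivity pass from vertices to rays.\<close>

definition vertex_perm :: "(nat \<Rightarrow> nat) \<Rightarrow> (nat list \<Rightarrow> nat list) \<Rightarrow> bool" where
  "vertex_perm d g \<longleftrightarrow> vertex_map d g \<and> (\<exists>g'. vertex_map d g' \<and> g \<circ> g' = id \<and> g' \<circ> g = id)"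

lemma vertex_perm_map: "vertex_perm d g \<Longrightarrow> vertex_map d g"
  by (simp add: vertex_perm_def)

lemma take_tverts: "v \<in> tverts d \<Longrightarrow> take i v \<in> tverts d"
  by (simp add: tverts_def)

lemma vertex_map_id: "vertex_map d id"
  by (simp add: vertex_map_def)

lemma vertex_map_comp: "vertex_map d g \<Longrightarrow> vertex_map d f \<Longrightarrow> vertex_map d (g \<circ> f)"
  unfolding vertex_map_def by (auto simp: take_tverts)

lemma vertex_perm_id: "vertex_perm d id"
  unfolding vertex_perm_def using vertex_map_id by (auto intro!: exI[of _ id])

lemma vertex_perm_comp:
  assumes "vertex_perm d g" "vertex_perm d f"
  shows "vertex_perm d (g \<circ> f)"
proof -
  obtain g' f' where *: "vertex_map d g'" "g \<circ> g' = id" "g' \<circ> g = id"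
    "vertex_map d f'" "f \<circ> f' = id" "f' \<circ> f = id"
    using assms unfolding vertex_perm_def by blast
  then have "(g \<circ> f) \<circ> (f' \<circ> g') = id" "(f' \<circ> g') \<circ> (g \<circ> f) = id"
    by (metis comp_assoc comp_id)+
  moreover have "vertex_map d (f' \<circ> g')" using * by (intro vertex_map_comp)
  ultimately show ?thesis
    using assms vertex_map_comp unfolding vertex_perm_def by blast
qed

lemma vertex_perm_inj: "vertex_perm d g \<Longrightarrow> inj g"
  unfolding vertex_perm_def by (metis inj_on_id inj_on_imageI2)

lemma vertex_map_level: "vertex_map d g \<Longrightarrow> v \<in> level d k \<Longrightarrow> g v \<in> level d k"
  by (auto simp: vertex_map_def level_def)

text \<open>\<open>bd_act\<close> reads its j-th digit off the image of the prefix of length j + 1;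
  prefix compatibility makes these digits agree with the image of any longer prefix.\<close>

lemma bd_act_prefix:
  assumes "vertex_map d g" "x \<in> tbdry d"
  shows "map (bd_act d g x) [0..<n] = g (map x [0..<n])"
proof -
  have len: "length (g (map x [0..<n])) = n" for n
    using assms prefix_tverts[OF assms(2)] by (auto simp: vertex_map_def)
  show ?thesis
  proof (rule nth_equalityI)
    fix i assume "i < length (map (bd_act d g x) [0..<n])"
    then have i: "i < n" by simp
    then have "take (Suc i) (map x [0..<n]) = map x [0..<Suc i]"
      by (simp add: take_map)
    then have "take (Suc i) (g (map x [0..<n])) = g (map x [0..<Suc i])"
      using assms prefix_tverts[OF assms(2), of n] unfolding vertex_map_def by metis
    then have "g (map x [0..<Suc i]) ! i = g (map x [0..<n]) ! i"
      by (metis lessI nth_take)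
    then show "map (bd_act d g x) [0..<n] ! i = g (map x [0..<n]) ! i"
      using assms(2) i by (simp add: bd_act_def del: upt_Suc)
  qed (simp add: len)
qed

lemma bd_act_tbdry:
  assumes "vertex_map d g" "x \<in> tbdry d"
  shows "bd_act d g x \<in> tbdry d"
proof -
  have "bd_act d g x j \<in> {1..d j}" for j
  proof -
    have "map (bd_act d g x) [0..<Suc j] \<in> tverts d"
      unfolding bd_act_prefix[OF assms] using assms prefix_tverts[OF assms(2)]
      by (auto simp: vertex_map_def simp del: upt_Suc)
    then show ?thesis unfolding tverts_def using nth_map_upt[of j "Suc j" 0 "bd_act d g x"]
      by (auto simp del: upt_Suc)
  qed
  then show ?thesis by (simp add: tbdry_def)
qed

lemma bd_act_comp:
  assumes "vertex_map d f" "x \<in> tbdry d"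
  shows "bd_act d (g \<circ> f) x = bd_act d g (bd_act d f x)"
  using assms bd_act_tbdry[OF assms] bd_act_prefix[OF assms]
  by (auto simp: bd_act_def[of d "g \<circ> f"] bd_act_def[of d g] simp del: upt_Suc)

lemma bd_act_id: "bd_act d id x = x"
  by (rule ext) (simp add: bd_act_def nth_append)

lemma bd_act_surj:
  assumes "vertex_perm d g" "x \<in> tbdry d"
  obtains x' where "x' \<in> tbdry d" "bd_act d g x' = x"
proof -
  obtain g' where "vertex_map d g'" "g \<circ> g' = id" using assms unfolding vertex_perm_def by blast
  then have "bd_act d g (bd_act d g' x) = x" "bd_act d g' x \<in> tbdry d"
    using assms bd_act_comp[of d g' x g] bd_act_tbdry bd_act_id by metis+
  then show thesis using that by blast
qed

lemma bd_act_inj: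
  assumes "vertex_perm d g" "x \<in> tbdry d" "y \<in> tbdry d" "bd_act d g x = bd_act d g y"
  shows "x = y"
proof -
  obtain g' where "vertex_map d g'" "g' \<circ> g = id" using assms unfolding vertex_perm_def by blast
  then have "bd_act d g' (bd_act d g x) = x" "bd_act d g' (bd_act d g y) = y"
    using assms bd_act_comp[of d g _ g'] bd_act_id by (metis vertex_perm_map)+
  then show ?thesis using assms by metis
qed

lemma ones_tbdry: "(\<And>i. d i \<ge> 1) \<Longrightarrow> ones \<in> tbdry d"
  by (simp add: ones_def tbdry_def)

text \<open>Every vertex is a prefix of a ray, for instance of the one continued by ones.\<close>

lemma vertex_map_eqI:
  assumes "vertex_map d g" "vertex_map d g'" "\<And>i. d i \<ge> 1"
    and "\<And>x. x \<in> tbdry d \<Longrightarrow> bd_act d g x = bd_act d g' x"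
  shows "g = g'"
proof
  fix v
  show "g v = g' v"
  proof (cases "v \<in> tverts d")
    case True
    then have x: "conc v ones \<in> tbdry d" using assms(3) by (simp add: conc_tbdry ones_tbdry)
    show ?thesis
      using assms bd_act_prefix[OF assms(1) x, of "length v"] bd_act_prefix[OF assms(2) x, of "length v"] x
      by (simp add: conc_prefix)
  qed (use assms in \<open>simp add: vertex_map_def\<close>)
qed

section \<open>Rooted automorphisms\<close>

lemma rooted_simps: "rooted d \<tau> [] = []"
  "z # zs \<in> tverts d \<Longrightarrow> rooted d \<tau> (z # zs) = \<tau> z # zs"
  by (auto simp: rooted_def)

lemma vertex_map_rooted:
  assumes "\<tau> permutes {1..d 0}"
  shows "vertex_map d (rooted d \<tau>)"
  unfolding vertex_map_def
proof (intro conjI ballI allI)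
  fix v assume v: "v \<in> tverts d"
  have in1: "\<tau> z \<in> {1..d 0} \<longleftrightarrow> z \<in> {1..d 0}" for z using permutes_in_image[OF assms] .
  show "rooted d \<tau> v \<in> tverts d"
    using v in1 by (cases v) (auto simp: rooted_simps Cons_in_tverts)
  show "length (rooted d \<tau> v) = length v" using v by (cases v) (auto simp: rooted_simps)
  show "take i (rooted d \<tau> v) = rooted d \<tau> (take i v)" for i
    using v take_tverts[OF v, of i]
    by (cases v; cases i) (auto simp: rooted_simps)
qed (simp add: rooted_def)

lemma vertex_perm_rooted:
  assumes "\<tau> permutes {1..d 0}"
  shows "vertex_perm d (rooted d \<tau>)"
proof -
  have *: "rooted d \<rho> \<circ> rooted d \<pi> = id" if "\<pi> permutes {1..d 0}" "\<rho> \<circ> \<pi> = id" for \<pi> \<rho>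
  proof
    fix v
    have "rooted d \<pi> v \<in> tverts d \<longleftrightarrow> v \<in> tverts d"
      using vertex_map_rooted[of \<pi> d] that(1) unfolding vertex_map_def by metis
    then show "(rooted d \<rho> \<circ> rooted d \<pi>) v = id v"
      using pointfree_idE[OF that(2)] by (cases v) (auto simp: rooted_def)
  qed
  show ?thesis
    unfolding vertex_perm_def
    using *[OF assms, of "Hilbert_Choice.inv \<tau>"] *[OF permutes_inv[OF assms], of \<tau>] assms
    by (intro conjI exI[of _ "rooted d (Hilbert_Choice.inv \<tau>)"] vertex_map_rooted permutes_inv)
       (auto simp: permutes_inv_o)
qed

lemma bd_act_rooted_conc:
  assumes "conc (z # zs) y \<in> tbdry d"
  shows "bd_act d (rooted d \<tau>) (conc (z # zs) y) = conc (\<tau> z # zs) y"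
proof
  fix j
  have "map (conc (z # zs) y) [0..<Suc j] = z # map (conc zs y) [0..<j]"
    by (rule nth_equalityI) (auto simp: nth_Cons simp del: upt_Suc split: nat.splits)
  moreover have "map (conc (z # zs) y) [0..<Suc j] \<in> tverts d"
    using assms by (rule prefix_tverts)
  ultimately have "bd_act d (rooted d \<tau>) (conc (z # zs) y) j = (\<tau> z # map (conc zs y) [0..<j]) ! j"
    using assms by (simp add: bd_act_def rooted_simps del: upt_Suc conc.simps)
  then show "bd_act d (rooted d \<tau>) (conc (z # zs) y) j = conc (\<tau> z # zs) y j"
    by (cases j) (simp_all del: upt_Suc)
qed

section \<open>Elements of \<open>Hd\<close>: inverses, action on rays and sections\<close>

definition sig_ok :: "(nat \<Rightarrow> nat) \<Rightarrow> (nat \<Rightarrow> nat \<Rightarrow> nat \<Rightarrow> nat) \<Rightarrow> nat \<Rightarrow> bool" where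
  "sig_ok d sig l \<longleftrightarrow> (\<forall>i. \<forall>t\<in>{2..d i}. sig (Suc (l + i)) t permutes {1..d (Suc i)})"

text \<open>Descending along a digit 1 shifts the tree, while \<open>sig\<close> keeps its absolute
  level; the offset l records the difference.\<close>

lemma sig_ok_Suc: "sig_ok d sig l \<Longrightarrow> sig_ok (\<lambda>i. d (Suc i)) sig (Suc l)"
  unfolding sig_ok_def by (metis add_Suc add_Suc_right)

lemma sig_okD0: "sig_ok d sig l \<Longrightarrow> t \<in> {2..d 0} \<Longrightarrow> sig (Suc l) t permutes {1..d (Suc 0)}"
  unfolding sig_ok_def by (metis add.right_neutral)

lemma length_hmap_aux: "length (hmap_aux sig l v) = length v"
  by (induction sig l v rule: hmap_aux.induct) (auto split: list.splits)

lemma take_hmap_aux: "take i (hmap_aux sig l v) = hmap_aux sig l (take i v)"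
proof (induction v arbitrary: l i)
  case (Cons a w)
  show ?case
  proof (cases i)
    case (Suc j)
    show ?thesis
    proof (cases "a = 1")
      case True
      then show ?thesis using Cons Suc by simp
    next
      case False
      then show ?thesis using Suc by (cases w; cases j) simp_all
    qed
  qed simp
qed simp

lemma hmap_aux_tverts:
  "sig_ok d sig l \<Longrightarrow> v \<in> tverts d \<Longrightarrow> hmap_aux sig l v \<in> tverts d"
proof (induction v arbitrary: d l)
  case (Cons a w)
  have aw: "a \<in> {1..d 0}" "w \<in> tverts (\<lambda>i. d (Suc i))" using Cons.prems by (auto simp: Cons_in_tverts)
  show ?case
  proof (cases "a = 1")
    case True
    then show ?thesis using Cons.IH[OF sig_ok_Suc[OF Cons.prems(1)] aw(2)] aw by (simp add: Cons_in_tverts)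
  next
    case False
    then have "sig (Suc l) a permutes {1..d (Suc 0)}" using aw Cons.prems by (intro sig_okD0) auto
    from permutes_in_image[OF this] show ?thesis
      using False aw by (cases w) (auto simp: Cons_in_tverts)
  qed
qed simp

text \<open>The map preserves the digits that select a coordinate, the leading ones and the first t
  different from 1, so inverting each coordinate undoes it.\<close>

lemma hmap_aux_inv:
  "sig_ok d sig l \<Longrightarrow> v \<in> tverts d
     \<Longrightarrow> hmap_aux (\<lambda>l t. Hilbert_Choice.inv (sig l t)) l (hmap_aux sig l v) = v"
proof (induction v arbitrary: d l)
  case (Cons a w)
  have aw: "a \<in> {1..d 0}" "w \<in> tverts (\<lambda>i. d (Suc i))" using Cons.prems by (auto simp: Cons_in_tverts)
  show ?case
  proof (cases "a = 1")
    case True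
    then show ?thesis using Cons.IH[OF sig_ok_Suc[OF Cons.prems(1)] aw(2)] by simp
  next
    case False
    then have "sig (Suc l) a permutes {1..d (Suc 0)}" using aw Cons.prems by (intro sig_okD0) auto
    from permutes_inj[OF this] show ?thesis
      using False by (cases w) (auto simp: inv_f_f)
  qed
qed simp

lemma sig_ok_inv: "sig_ok d sig l \<Longrightarrow> sig_ok d (\<lambda>l t. Hilbert_Choice.inv (sig l t)) l"
  unfolding sig_ok_def by (auto intro: permutes_inv)

lemma hmap_aux_cong:
  "sig_ok d sig l \<Longrightarrow> v \<in> tverts d \<Longrightarrow> (\<And>i t. t \<in> {2..d i} \<Longrightarrow> sig' (Suc (l + i)) t = sig (Suc (l + i)) t)
     \<Longrightarrow> hmap_aux sig' l v = hmap_aux sig l v"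
proof (induction v arbitrary: d l)
  case (Cons a w)
  have aw: "a \<in> {1..d 0}" "w \<in> tverts (\<lambda>i. d (Suc i))" using Cons.prems by (auto simp: Cons_in_tverts)
  show ?case
  proof (cases "a = 1")
    case True
    have "hmap_aux sig' (Suc l) w = hmap_aux sig (Suc l) w"
    proof (rule Cons.IH[OF sig_ok_Suc[OF Cons.prems(1)] aw(2)])
      fix i t assume "t \<in> {2..d (Suc i)}"
      from Cons.prems(3)[OF this] show "sig' (Suc (Suc l + i)) t = sig (Suc (Suc l + i)) t" by simp
    qed
    then show ?thesis using True by simp
  next
    case False
    then have "sig' (Suc l) a = sig (Suc l) a" using aw Cons.prems(3)[of a 0] by simp
    then show ?thesis using False by (cases w) auto
  qed
qed simp

lemma vertex_map_hmap: "sig_ok d sig 0 \<Longrightarrow> vertex_map d (hmap d sig)"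
  unfolding vertex_map_def hmap_def
  by (auto simp: length_hmap_aux take_hmap_aux hmap_aux_tverts take_tverts)

lemma vertex_perm_hmap:
  assumes "sig_ok d sig 0"
  shows "vertex_perm d (hmap d sig)"
proof -
  define sig' where "sig' = (\<lambda>l t. Hilbert_Choice.inv (sig l t))"
  have ok': "sig_ok d sig' 0" unfolding sig'_def by (rule sig_ok_inv[OF assms])
  have 1: "hmap d sig' \<circ> hmap d sig = id"
    using hmap_aux_inv[OF assms] hmap_aux_tverts[OF assms] by (auto simp: hmap_def sig'_def)
  \<comment> \<open>Inverting twice returns \<open>sig\<close> where it is a permutation, and only
    such coordinates are read on the tree.\<close>
  have "hmap_aux sig 0 v = hmap_aux (\<lambda>l t. Hilbert_Choice.inv (sig' l t)) 0 v" if v: "v \<in> tverts d" for v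
  proof (rule hmap_aux_cong[OF sig_ok_inv[OF ok'] v])
    fix i t assume "t \<in> {2..d i}"
    then have "sig (Suc i) t permutes {1..d (Suc i)}" using assms unfolding sig_ok_def by (metis add_0)
    from permutes_inv_inv[OF this]
    show "sig (Suc (0 + i)) t = Hilbert_Choice.inv (sig' (Suc (0 + i)) t)" by (simp add: sig'_def)
  qed
  then have 2: "hmap d sig \<circ> hmap d sig' = id"
    using hmap_aux_inv[OF ok'] hmap_aux_tverts[OF ok'] by (auto simp: hmap_def)
  show ?thesis
    unfolding vertex_perm_def using 1 2 vertex_map_hmap assms ok' by blast
qed

definition hray :: "(nat \<Rightarrow> nat \<Rightarrow> nat \<Rightarrow> nat) \<Rightarrow> nat \<Rightarrow> (nat \<Rightarrow> nat) \<Rightarrow> nat \<Rightarrow> nat" where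
  "hray sig l x = (\<lambda>j. hmap_aux sig l (map x [0..<Suc j]) ! j)"

lemma bd_act_hmap: "x \<in> tbdry d \<Longrightarrow> bd_act d (hmap d sig) x = hray sig 0 x"
  by (auto simp: bd_act_def hray_def hmap_def prefix_tverts simp del: upt_Suc)

lemma hray_case_nat:
  "hray sig l (case_nat z y) =
     (if z = 1 then case_nat 1 (hray sig (Suc l) y) else case_nat z (y(0 := sig (Suc l) z (y 0))))"
proof
  fix j
  have m: "map (case_nat z y) [0..<Suc n] = z # map y [0..<n]" for n
    by (rule nth_equalityI) (auto simp: nth_Cons simp del: upt_Suc split: nat.splits)
  have m': "map y [0..<Suc n] = y 0 # map (\<lambda>i. y (Suc i)) [0..<n]" for n
    by (rule nth_equalityI) (auto simp: nth_Cons simp del: upt_Suc split: nat.splits)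
  show "hray sig l (case_nat z y) j =
     (if z = 1 then case_nat 1 (hray sig (Suc l) y) else case_nat z (y(0 := sig (Suc l) z (y 0)))) j"
  proof (cases j)
    case (Suc i)
    show ?thesis unfolding hray_def Suc m
      by (cases i) (auto simp: m' nth_append simp del: upt_Suc)
  qed (simp add: hray_def)
qed

lemma hray_ones: "hray sig l ones = ones"
proof
  have "hmap_aux sig l (replicate n 1) = replicate n 1" for n l
    by (induction n arbitrary: l) auto
  then show "hray sig l ones j = ones j" for j
    unfolding hray_def ones_def by (simp add: map_replicate_const del: upt_Suc replicate_Suc)
qed

text \<open>\<open>hsec\<close> is the section at v of the element with coordinates \<open>sig\<close>, acting on rays below v.\<close>

fun hsec :: "(nat \<Rightarrow> nat \<Rightarrow> nat \<Rightarrow> nat) \<Rightarrow> nat \<Rightarrow> nat list \<Rightarrow> (nat \<Rightarrow> nat) \<Rightarrow> nat \<Rightarrow> nat" where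
  "hsec sig l [] y = hray sig l y"
| "hsec sig l (z # zs) y = (if z = 1 then hsec sig (Suc l) zs y
      else if zs = [] then y(0 := sig (Suc l) z (y 0)) else y)"

lemma hray_conc: "hray sig l (conc v y) = conc (hmap_aux sig l v) (hsec sig l v y)"
proof (induction v arbitrary: l)
  case (Cons z zs)
  show ?case
  proof (cases zs)
    case (Cons b w)
    have "(case_nat b r)(0 := c) = case_nat c r" for c :: nat and r
      by (rule ext) (auto split: nat.splits)
    then show ?thesis using Cons.IH by (auto simp: hray_case_nat Cons)
  qed (auto simp: hray_case_nat fun_upd_def)
qed simp

text \<open>The symbol that a letter of \<open>HF\<close> writes into the record of a vertex at position v, if any.\<close>

fun visit_type :: "nat list \<Rightarrow> bool list" where
  "visit_type [] = [True]"
| "visit_type (z # zs) = (if z = 1 then visit_type zs else if zs = [] then [False] else [])"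

lemma visit_type_True: "visit_type v = [True] \<longleftrightarrow> v = replicate (length v) 1"
  by (induction v) auto

lemma visit_type_cases: "visit_type v = [True] \<or> visit_type v = [False] \<or> visit_type v = []"
  by (induction v) auto

lemma True_in_visit_type: "True \<in> set (visit_type v) \<longleftrightarrow> v = replicate (length v) 1"
  using visit_type_cases[of v] visit_type_True[of v] by auto

lemma visit_type_False: "visit_type v = [False] \<longleftrightarrow> v \<noteq> [] \<and> last v \<noteq> 1 \<and> butlast v = replicate (length v - 1) 1"
proof (induction v)
  case (Cons z zs)
  then show ?case by (cases zs) auto
qed simp

text \<open>This and the next two lemmas give the section at v by visit type: a permutation of one
  digit below 1^(k-1) t, an element of the same directed kind below 1^k, the identity
  elsewhere.\<close>

lemma hsec_visit_False:
  assumes "visit_type v = [False]"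
  shows "hsec sig l v y = y(0 := sig (l + length v) (last v) (y 0))"
  using assms by (induction sig l v y rule: hsec.induct) (auto split: if_splits)

lemma hsec_visit_True:
  assumes "visit_type v = [True]"
  shows "hsec sig l v y = hray sig (l + length v) y"
  using assms by (induction sig l v y rule: hsec.induct) (auto split: if_splits)

lemma hsec_visit_none:
  assumes "visit_type v = []"
  shows "hsec sig l v y = y"
  using assms by (induction sig l v y rule: hsec.induct) (auto split: if_splits)

lemma hcoord_hmap:
  assumes "sig_ok d sig 0" "l \<ge> 1" "t \<in> {2..d (l - 1)}" "\<And>i. d i \<ge> 1"
  shows "hcoord d (hmap d sig) l t = sig l t"
proof
  fix i
  have p: "sig l t permutes {1..d l}" using assms unfolding sig_ok_def
    by (metis One_nat_def Suc_pred add_0 le_eq_less_or_eq less_eq_Suc_le)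
  have "hmap_aux sig n (replicate k 1 @ [t, i]) = replicate k 1 @ [t, sig (Suc (n + k)) t i]" for n k
    using assms(3) by (induction k arbitrary: n) auto
  from this[of 0 "l - 1"] have "hmap_aux sig 0 (replicate (l - 1) 1 @ [t, i]) ! l = sig l t i"
    using assms(2) by (cases l) (simp_all add: nth_append)
  moreover have "i \<in> {1..d l} \<Longrightarrow> replicate (l - 1) 1 @ [t, i] \<in> tverts d"
  proof -
    assume i: "i \<in> {1..d l}"
    obtain m where m: "l = Suc m" using assms(2) by (cases l) auto
    have "(replicate m 1 @ [t, i]) ! j \<in> {1..d j}" if jm: "j < m + 2" for j
    proof -
      consider "j < m" | "j = m" | "j = Suc m" using jm by linarith
      then show ?thesis using assms i m by cases (auto simp: nth_append)
    qed
    then show ?thesis by (simp add: tverts_def m)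
  qed
  ultimately show "hcoord d (hmap d sig) l t i = sig l t i"
    using permutes_not_in[OF p] by (auto simp: hcoord_def hmap_def)
qed

section \<open>The law of the record of a vertex\<close>

definition words :: "'a set \<Rightarrow> nat \<Rightarrow> 'a list set" where
  "words A n = {w. set w \<subseteq> A \<and> length w = n}"

lemma words_0: "words A 0 = {[]}"
  by (auto simp: words_def)

lemma words_Suc: "words A (Suc n) = (\<lambda>(a, w). a # w) ` (A \<times> words A n)"
  by (auto simp: words_def length_Suc_conv image_iff)

lemma sum_words_Suc: "(\<Sum>w\<in>words A (Suc n). g w) = (\<Sum>a\<in>A. \<Sum>w\<in>words A n. g (a # w))"
  unfolding words_Suc by (subst sum.reindex) (auto simp: inj_on_def sum.cartesian_product split_def)

lemma finite_words: "finite A \<Longrightarrow> finite (words A n)"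
  unfolding words_def by (rule finite_lists_length_eq)

lemma card_words: "finite A \<Longrightarrow> card (words A n) = card A ^ n"
  unfolding words_def by (rule card_lists_length_eq)

lemma words_nonempty: "A \<noteq> {} \<Longrightarrow> words A n \<noteq> {}"
  by (induction n) (auto simp: words_0 words_Suc)

text \<open>Composing with a transposition shows that the sum is the same for every point b; summed
  over all points, each permutation contributes the whole sum of f.\<close>

lemma sum_permutes_apply:
  fixes f :: "'a \<Rightarrow> real"
  assumes "finite S" "b \<in> S"
  shows "(\<Sum>\<pi> | \<pi> permutes S. f (\<pi> b)) = real (card {\<pi>. \<pi> permutes S}) * (\<Sum>c\<in>S. f c) / real (card S)"
proof -
  have shift: "(\<Sum>\<pi> | \<pi> permutes S. f (\<pi> c)) = (\<Sum>\<pi> | \<pi> permutes S. f (\<pi> b))" if "c \<in> S" for c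
  proof -
    have "Transposition.transpose b c permutes S" using assms that by (rule_tac permutes_swap_id) auto
    from sum_permutations_compose_right[OF this, of "\<lambda>\<pi>. f (\<pi> b)"] show ?thesis by simp
  qed
  have "real (card S) * (\<Sum>\<pi> | \<pi> permutes S. f (\<pi> b)) = (\<Sum>c\<in>S. \<Sum>\<pi> | \<pi> permutes S. f (\<pi> c))"
    using shift by simp
  also have "\<dots> = (\<Sum>\<pi> | \<pi> permutes S. \<Sum>c\<in>S. f (\<pi> c))" by (rule sum.swap)
  also have "\<dots> = (\<Sum>\<pi> | \<pi> permutes S. \<Sum>c\<in>S. f c)"
  proof (rule sum.cong[OF refl])
    fix \<pi> assume "\<pi> \<in> {\<pi>. \<pi> permutes S}"
    then have "\<pi> permutes S" by simp
    from sum.permute[OF this, of f] show "(\<Sum>c\<in>S. f (\<pi> c)) = (\<Sum>c\<in>S. f c)" by (simp add: o_def)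
  qed
  finally have "real (card S) * (\<Sum>\<pi> | \<pi> permutes S. f (\<pi> b))
     = real (card {\<pi>. \<pi> permutes S}) * (\<Sum>c\<in>S. f c)" by simp
  moreover have "card S > 0" using assms by (auto simp: card_gt_0_iff)
  ultimately show ?thesis by (simp add: field_simps)
qed

lemma cascade_nil: "cascade d v \<Phi> [] = \<Phi> []"
  by (induction v arbitrary: d) auto

lemma cascade_fun:
  "cascade d [] \<Phi> = \<Phi>"
  "cascade d (z # zs) \<Phi> = layer (d 0) z (cascade (\<lambda>i. d (Suc i)) zs \<Phi>)"
  by (rule ext, simp)+

text \<open>A random element of H acts on a vertex like one symbol \<open>True\<close> fed in at the
  root. Leading ones hand \<open>True\<close> on; the first digit different from 1 emits
  \<open>False\<close>, which resamples the next digit just as a uniform coordinate does. If the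
  vertex ends before that, the symbol reached is its visit type.\<close>

lemma cascade_observe:
  assumes "finite I" "I \<noteq> {}" "v \<in> tverts d"
    and "\<And>j t b f. t \<in> {2..d j} \<Longrightarrow> b \<in> {1..d (Suc j)} \<Longrightarrow>
       (\<Sum>i\<in>I. f (sg i (Suc (l + j)) t b)) = real (card I) * (\<Sum>c\<in>{1..d (Suc j)}. f c :: real) / real (d (Suc j))"
  shows "(\<Sum>i\<in>I. cascade d (hmap_aux (sg i) l v) (\<lambda>u. \<Phi> (visit_type v @ u)) w)
       = real (card I) * cascade d v \<Phi> (True # w)"
  using assms(3,4)
proof (induction v arbitrary: d l w)
  case (Cons z zs)
  let ?d = "\<lambda>i. d (Suc i)"
  have zz: "z \<in> {1..d 0}" "zs \<in> tverts ?d" using Cons.prems by (auto simp: Cons_in_tverts)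
  show ?case
  proof (cases "z = 1")
    case True
    have IH: "(\<Sum>i\<in>I. cascade ?d (hmap_aux (sg i) (Suc l) zs) (\<lambda>u. \<Phi> (visit_type zs @ u)) w)
       = real (card I) * cascade ?d zs \<Phi> (True # w)" for w
    proof (rule Cons.IH[OF zz(2)])
      fix j t b and f :: "nat \<Rightarrow> real"
      assume "t \<in> {2..d (Suc j)}" "b \<in> {1..d (Suc (Suc j))}"
      from Cons.prems(2)[OF this, of f]
      show "(\<Sum>i\<in>I. f (sg i (Suc (Suc l + j)) t b)) =
        real (card I) * (\<Sum>c\<in>{1..d (Suc (Suc j))}. f c) / real (d (Suc (Suc j)))" by simp
    qed
    show ?thesis using True by (simp add: layer_sum[symmetric] IH layer_cmult)
  next
    case z: False
    show ?thesis
    proof (cases zs)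
      case Nil
      then show ?thesis using z by (simp add: cascade_fun)
    next
      case (Cons b bs)
      have b: "b \<in> {1..d (Suc 0)}" using zz Cons by (auto simp: Cons_in_tverts)
      have "(\<Sum>i\<in>I. cascade d (hmap_aux (sg i) l (z # zs)) (\<lambda>u. \<Phi> (visit_type (z # zs) @ u)) w)
        = (\<Sum>i\<in>I. (\<lambda>c. cascade d (z # c # bs) \<Phi> w) (sg i (Suc (l + 0)) z b))"
        using z Cons by simp
      also have "\<dots> = real (card I) * (\<Sum>c\<in>{1..d (Suc 0)}. cascade d (z # c # bs) \<Phi> w) / real (d (Suc 0))"
        using z zz b by (intro Cons.prems(2)) auto
      also have "\<dots> = real (card I) * cascade d (z # zs) \<Phi> (True # w)"
        using z Cons by (simp add: cascade_fun layer_sum layer_divide)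
      finally show ?thesis .
    qed
  qed
qed simp

section \<open>Letters of the walk and the law of their records\<close>

locale directed_group =
  fixes d :: "nat \<Rightarrow> nat"
    and H :: "(nat list \<Rightarrow> nat list) set"
    and F :: "('f, 'z) monoid_scheme"
  assumes d_ge2: "\<And>j. d j \<ge> 2"
    and H_sub: "H \<subseteq> Hd d"
    and H_fin: "finite H"
    and H_id: "id \<in> H"
    and H_mult: "\<And>a b. a \<in> H \<Longrightarrow> b \<in> H \<Longrightarrow> b \<circ> a \<in> H"
    and H_unif: "\<And>l t. l \<ge> 1 \<Longrightarrow> t \<in> {2..d (l - 1)} \<Longrightarrow>
                   map_pmf (\<lambda>h. hcoord d h l t) (pmf_of_set H)
                   = pmf_of_set {\<pi>. \<pi> permutes {1..d l}}"
    and F_grp: "group F"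
    and F_fin: "finite (carrier F)"
begin

lemma d_ge1: "d j \<ge> 1"
  using d_ge2[of j] by simp

definition sig_of :: "(nat list \<Rightarrow> nat list) \<Rightarrow> nat \<Rightarrow> nat \<Rightarrow> nat \<Rightarrow> nat" where
  "sig_of h = (SOME sig. sig_ok d sig 0 \<and> h = hmap d sig)"

lemma sig_of:
  assumes "h \<in> H"
  shows "sig_ok d (sig_of h) 0" "h = hmap d (sig_of h)"
proof -
  obtain sig where "h = hmap d sig" "\<forall>l\<ge>1. \<forall>t\<in>{2..d (l - 1)}. sig l t permutes {1..d l}"
    using assms H_sub unfolding Hd_def by blast
  moreover from this(2) have "sig_ok d sig 0" unfolding sig_ok_def by (metis One_nat_def Suc_le_mono add_0 diff_Suc_1 le0)
  ultimately have "\<exists>sig. sig_ok d sig 0 \<and> h = hmap d sig" by blast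
  from someI_ex[OF this] show "sig_ok d (sig_of h) 0" "h = hmap d (sig_of h)"
    unfolding sig_of_def by auto
qed

lemma hcoord_eq:
  assumes "h \<in> H" "l \<ge> 1" "t \<in> {2..d (l - 1)}"
  shows "hcoord d h l t = sig_of h l t"
  using hcoord_hmap[OF sig_of(1)[OF assms(1)] assms(2,3) d_ge1] sig_of(2)[OF assms(1)] by simp

text \<open>Saturation in the form required by \<open>cascade_observe\<close> with offset 0: a
  coordinate of a uniform element of H is a uniform permutation, so it sends b to a uniform
  point.\<close>

lemma sum_H_coord:
  fixes f :: "nat \<Rightarrow> real"
  assumes "t \<in> {2..d j}" "b \<in> {1..d (Suc j)}"
  shows "(\<Sum>h\<in>H. f (sig_of h (Suc (0 + j)) t b)) = real (card H) * (\<Sum>c\<in>{1..d (Suc j)}. f c) / real (d (Suc j))"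
proof -
  let ?P = "{\<pi>. \<pi> permutes {1..d (Suc j)}}"
  have fP: "finite ?P" by (rule finite_permutations) simp
  have nP: "?P \<noteq> {}" using permutes_id by blast
  have nH: "H \<noteq> {}" using H_id by blast
  have "measure_pmf.expectation (map_pmf (\<lambda>h. hcoord d h (Suc j) t) (pmf_of_set H)) (\<lambda>\<pi>. f (\<pi> b))
     = measure_pmf.expectation (pmf_of_set ?P) (\<lambda>\<pi>. f (\<pi> b))"
    using H_unif[of "Suc j" t] assms by simp
  then have "(\<Sum>h\<in>H. f (hcoord d h (Suc j) t b)) / real (card H) = (\<Sum>\<pi>\<in>?P. f (\<pi> b)) / real (card ?P)"
    using nH H_fin nP fP by (simp add: integral_pmf_of_set)
  moreover have "(\<Sum>\<pi>\<in>?P. f (\<pi> b)) = real (card ?P) * (\<Sum>c\<in>{1..d (Suc j)}. f c) / real (card {1..d (Suc j)})"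
    using assms by (intro sum_permutes_apply) auto
  moreover have "card ?P > 0" "card H > 0" using fP nP H_fin nH by (auto simp: card_gt_0_iff)
  moreover have "(\<Sum>h\<in>H. f (hcoord d h (Suc j) t b)) = (\<Sum>h\<in>H. f (sig_of h (Suc j) t b))"
    using hcoord_eq[of _ "Suc j" t] assms by simp
  ultimately show ?thesis by (simp add: field_simps)
qed

definition perms :: "(nat \<Rightarrow> nat) set" where
  "perms = {\<tau>. \<tau> permutes {1..d 0}}"

lemma finite_perms: "finite perms"
  unfolding perms_def by (rule finite_permutations) simp

lemma perms_nonempty: "perms \<noteq> {}"
  unfolding perms_def using permutes_id by blast

definition triples :: "((nat \<Rightarrow> nat) \<times> (nat list \<Rightarrow> nat list) \<times> (nat \<Rightarrow> nat)) set" where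
  "triples = perms \<times> H \<times> perms"

lemma finite_triples: "finite triples"
  using finite_perms H_fin by (simp add: triples_def)

text \<open>Since (gf)(x) = f(g(x)), the left factor s acts first.\<close>

definition act :: "(nat \<Rightarrow> nat) \<times> (nat list \<Rightarrow> nat list) \<times> (nat \<Rightarrow> nat) \<Rightarrow> nat list \<Rightarrow> nat list" where
  "act a = rooted d (snd (snd a)) \<circ> fst (snd a) \<circ> rooted d (fst a)"

text \<open>The HF letter meets the vertex after s has moved it, so the type is taken there, while
  the next letter starts from the fully moved vertex.\<close>

fun visits :: "nat list \<Rightarrow> ((nat \<Rightarrow> nat) \<times> (nat list \<Rightarrow> nat list) \<times> (nat \<Rightarrow> nat)) list \<Rightarrow> bool list" where
  "visits v [] = []"
| "visits v (a # w) = visit_type (rooted d (fst a) v) @ visits (act a v) w"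

lemma H_perm: "h \<in> H \<Longrightarrow> vertex_perm d h"
  using vertex_perm_hmap[OF sig_of(1)] sig_of(2) by metis

lemma rooted_perm: "\<tau> \<in> perms \<Longrightarrow> vertex_perm d (rooted d \<tau>)"
  unfolding perms_def by (simp add: vertex_perm_rooted)

lemma act_perm: "a \<in> triples \<Longrightarrow> vertex_perm d (act a)"
  unfolding act_def triples_def
  by (intro vertex_perm_comp rooted_perm H_perm) (auto simp: mem_Times_iff)

text \<open>A uniform rooted permutation resamples the first digit, which is the effect of feeding
  \<open>False\<close> at the root; at level 0 there is no digit to resample.\<close>

lemma sum_rooted_cascade:
  assumes "v \<in> level d k" "k \<ge> 1"
  shows "(\<Sum>s\<in>perms. cascade d (rooted d s v) \<Phi> w) = real (card perms) * cascade d v \<Phi> (False # w)"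
proof -
  obtain z zs where v: "v = z # zs" using assms by (cases v) (auto simp: level_def)
  then have z: "z # zs \<in> tverts d" "z \<in> {1..d 0}" using assms by (auto simp: level_def Cons_in_tverts)
  have "(\<Sum>s\<in>perms. cascade d (rooted d s v) \<Phi> w) = (\<Sum>s | s permutes {1..d 0}. cascade d (s z # zs) \<Phi> w)"
    using z by (simp add: v perms_def rooted_simps)
  also have "\<dots> = real (card perms) * (\<Sum>c\<in>{1..d 0}. cascade d (c # zs) \<Phi> w) / real (card {1..d 0})"
    unfolding perms_def using z by (intro sum_permutes_apply) auto
  finally show ?thesis by (simp add: v)
qed

lemma sum_H_cascade:
  assumes "v \<in> level d k"
  shows "(\<Sum>h\<in>H. cascade d (h v) (\<lambda>u. \<Phi> (visit_type v @ u)) w) = real (card H) * cascade d v \<Phi> (True # w)"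
proof -
  have v: "v \<in> tverts d" using assms by (simp add: level_def)
  have "h v = hmap_aux (sig_of h) 0 v" if "h \<in> H" for h
    using sig_of(2)[OF that] v by (metis hmap_def)
  then have "(\<Sum>h\<in>H. cascade d (h v) (\<lambda>u. \<Phi> (visit_type v @ u)) w)
     = (\<Sum>h\<in>H. cascade d (hmap_aux (sig_of h) 0 v) (\<lambda>u. \<Phi> (visit_type v @ u)) w)" by simp
  also have "\<dots> = real (card H) * cascade d v \<Phi> (True # w)"
    using H_fin H_id v sum_H_coord by (intro cascade_observe) auto
  finally show ?thesis .
qed

text \<open>The factors s, h, s' feed \<open>False\<close>, \<open>True\<close>,
  \<open>False\<close> in this order; they are averaged out from the last to the first.\<close>

lemma sum_triples_cascade:
  assumes "v \<in> level d k" "k \<ge> 1"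
  shows "(\<Sum>a\<in>triples. cascade d (act a v) (\<lambda>u. \<Phi> (visit_type (rooted d (fst a) v) @ u)) w)
     = real (card triples) * cascade d v \<Phi> (False # True # False # w)"
proof -
  have s: "rooted d s v \<in> level d k" if "s \<in> perms" for s
    using rooted_perm[OF that] vertex_map_level[OF vertex_perm_map] assms by blast
  have hs: "h u \<in> level d k" if "u \<in> level d k" "h \<in> H" for h u
    using H_perm[OF that(2)] vertex_map_level[OF vertex_perm_map] that(1) by blast
  have "(\<Sum>a\<in>triples. cascade d (act a v) (\<lambda>u. \<Phi> (visit_type (rooted d (fst a) v) @ u)) w)
    = (\<Sum>s\<in>perms. \<Sum>h\<in>H. \<Sum>s'\<in>perms.
         cascade d (rooted d s' (h (rooted d s v))) (\<lambda>u. \<Phi> (visit_type (rooted d s v) @ u)) w)"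
    unfolding triples_def act_def by (simp add: sum.cartesian_product split_def)
  also have "\<dots> = (\<Sum>s\<in>perms. \<Sum>h\<in>H. real (card perms) *
         cascade d (h (rooted d s v)) (\<lambda>u. \<Phi> (visit_type (rooted d s v) @ u)) (False # w))"
    using sum_rooted_cascade[OF hs[OF s] assms(2)] by (intro sum.cong refl) auto
  also have "\<dots> = real (card perms) * (\<Sum>s\<in>perms. \<Sum>h\<in>H.
         cascade d (h (rooted d s v)) (\<lambda>u. \<Phi> (visit_type (rooted d s v) @ u)) (False # w))"
    by (simp add: sum_distrib_left)
  also have "\<dots> = real (card perms) * (\<Sum>s\<in>perms. real (card H) *
         cascade d (rooted d s v) \<Phi> (True # False # w))"
    using sum_H_cascade[OF s] by simp
  also have "\<dots> = real (card perms) * (real (card H) * (\<Sum>s\<in>perms.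
         cascade d (rooted d s v) \<Phi> (True # False # w)))"
    by (simp add: sum_distrib_left)
  also have "\<dots> = real (card triples) * cascade d v \<Phi> (False # True # False # w)"
    using sum_rooted_cascade[OF assms] by (simp add: triples_def card_cartesian_product del: cascade.simps)
  finally show ?thesis .
qed

definition letters :: "(((nat \<Rightarrow> nat) \<times> (nat list \<Rightarrow> nat list) \<times> (nat \<Rightarrow> nat)) \<times> 'f) set" where
  "letters = triples \<times> carrier F"

lemma sum_letters: "(\<Sum>a\<in>letters. g a) = (\<Sum>a\<in>triples. \<Sum>f\<in>carrier F. g (a, f))"
  unfolding letters_def by (simp add: sum.cartesian_product split_def)

definition steps :: "nat \<Rightarrow> bool list" where
  "steps n = concat (replicate n [False, True, False])"

lemma steps_Suc: "steps (Suc n) = False # True # False # steps n"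
  by (simp add: steps_def)

lemma blocks_steps: "blocks False (steps n) = n"
  by (induction n) (auto simp: steps_Suc, simp add: steps_def)

lemma finite_letters: "finite letters"
  by (simp add: letters_def finite_triples F_fin)

text \<open>Induction on n with \<open>\<Phi>\<close> general: the first letter prepends its symbol
  to the record and the others start from the moved vertex. Lamp letters leave the record unchanged
  and contribute only a factor |F|.\<close>

lemma sum_words_visits:
  assumes "v \<in> level d k" "k \<ge> 1"
  shows "(\<Sum>w\<in>words letters n. \<Phi> (visits v (map fst w)))
    = real (card (words letters n)) * cascade d v \<Phi> (steps n)"
  using assms
proof (induction n arbitrary: v \<Phi>)
  case 0
  then show ?case by (simp add: words_0 steps_def cascade_nil)
next
  case (Suc n)
  have "(\<Sum>w\<in>words letters (Suc n). \<Phi> (visits v (map fst w)))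
     = (\<Sum>a\<in>triples. \<Sum>f\<in>carrier F. \<Sum>w\<in>words letters n.
          \<Phi> (visit_type (rooted d (fst a) v) @ visits (act a v) (map fst w)))"
    unfolding sum_words_Suc sum_letters by simp
  also have "\<dots> = (\<Sum>a\<in>triples. \<Sum>f\<in>carrier F. real (card (words letters n))
        * cascade d (act a v) (\<lambda>u. \<Phi> (visit_type (rooted d (fst a) v) @ u)) (steps n))"
  proof (intro sum.cong refl)
    fix a assume "a \<in> triples"
    then have "act a v \<in> level d k"
      using act_perm vertex_map_level[OF vertex_perm_map] Suc.prems by blast
    from Suc.IH[OF this Suc.prems(2), of "\<lambda>u. \<Phi> (visit_type (rooted d (fst a) v) @ u)"]
    show "(\<Sum>w\<in>words letters n. \<Phi> (visit_type (rooted d (fst a) v) @ visits (act a v) (map fst w)))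
      = real (card (words letters n))
        * cascade d (act a v) (\<lambda>u. \<Phi> (visit_type (rooted d (fst a) v) @ u)) (steps n)" .
  qed
  also have "\<dots> = real (card (carrier F)) * real (card (words letters n))
      * (\<Sum>a\<in>triples. cascade d (act a v) (\<lambda>u. \<Phi> (visit_type (rooted d (fst a) v) @ u)) (steps n))"
    by (simp add: sum_distrib_left mult.assoc)
  also have "\<dots> = real (card (words letters (Suc n))) * cascade d v \<Phi> (steps (Suc n))"
    unfolding sum_triples_cascade[OF Suc.prems] steps_Suc card_words[OF finite_letters]
    by (simp add: letters_def card_cartesian_product del: cascade.simps)
  finally show ?case .
qed

lemma sum_level_words_visits:
  assumes "k \<ge> 1"
  shows "(\<Sum>v\<in>level d k. \<Sum>w\<in>words letters n. \<Phi> (visits v (map fst w)))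
    = real (card (words letters n)) * real (card (level d k)) * level_mean d k \<Phi> (steps n)"
proof -
  have "card (level d k) > 0" unfolding card_level using d_ge1 by (simp add: prod_pos Suc_le_lessD)
  then show ?thesis using sum_words_visits[OF _ assms, of _ \<Phi> n]
    by (simp add: level_mean_def sum_distrib_left[symmetric])
qed

end

section \<open>The lower bound\<close>

lemma pmf_of_set_Times:
  assumes "finite A" "A \<noteq> {}" "finite B" "B \<noteq> {}"
  shows "pmf_of_set (A \<times> B) = pair_pmf (pmf_of_set A) (pmf_of_set B)"
proof (rule pmf_eqI)
  fix x :: "'a \<times> 'b"
  show "pmf (pmf_of_set (A \<times> B)) x = pmf (pair_pmf (pmf_of_set A) (pmf_of_set B)) x"
    using assms by (cases x) (simp add: pmf_pair card_cartesian_product indicator_def)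
qed

text \<open>Rewrites entropy as an average over words instead of group elements, the form in which
  both bounds are proved.\<close>

lemma pmf_entropy_map_uniform:
  assumes "finite W" "W \<noteq> {}"
  shows "pmf_entropy (map_pmf X (pmf_of_set W))
    = - (\<Sum>w\<in>W. ln (pmf (map_pmf X (pmf_of_set W)) (X w))) / real (card W)"
proof -
  let ?p = "map_pmf X (pmf_of_set W)"
  have S: "set_pmf ?p = X ` W" using assms by simp
  have "(\<Sum>\<gamma>\<in>set_pmf ?p. pmf ?p \<gamma> * ln (pmf ?p \<gamma>)) = measure_pmf.expectation ?p (\<lambda>\<gamma>. ln (pmf ?p \<gamma>))"
    using assms by (subst integral_measure_pmf_real[of "X ` W"]) (auto simp: mult.commute)
  also have "\<dots> = measure_pmf.expectation (pmf_of_set W) (\<lambda>w. ln (pmf ?p (X w)))"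
    by simp
  also have "\<dots> = (\<Sum>w\<in>W. ln (pmf ?p (X w))) / real (card W)"
    using assms by (simp add: integral_pmf_of_set)
  finally show ?thesis by (simp add: pmf_entropy_def)
qed

text \<open>Sum over all words whose first components spell \<open>\<omega>\<close> and whose second components lie in B.\<close>

fun fiber_sum :: "'b set \<Rightarrow> 'a list \<Rightarrow> (('a \<times> 'b) list \<Rightarrow> real) \<Rightarrow> real" where
  "fiber_sum B [] \<Psi> = \<Psi> []"
| "fiber_sum B (a # \<omega>) \<Psi> = (\<Sum>f\<in>B. fiber_sum B \<omega> (\<lambda>w. \<Psi> ((a, f) # w)))"

lemma sum_words_fiber_sum:
  "(\<Sum>w\<in>words (A \<times> B) n. \<Psi> w) = (\<Sum>\<omega>\<in>words A n. fiber_sum B \<omega> \<Psi>)"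
proof (induction n arbitrary: \<Psi>)
  case (Suc n)
  have "(\<Sum>w\<in>words (A \<times> B) (Suc n). \<Psi> w) = (\<Sum>a\<in>A. \<Sum>f\<in>B. \<Sum>w\<in>words (A \<times> B) n. \<Psi> ((a, f) # w))"
    unfolding sum_words_Suc by (simp add: sum.cartesian_product' split_def)
  also have "\<dots> = (\<Sum>a\<in>A. \<Sum>f\<in>B. \<Sum>\<omega>\<in>words A n. fiber_sum B \<omega> (\<lambda>w. \<Psi> ((a, f) # w)))"
    using Suc by simp
  also have "\<dots> = (\<Sum>a\<in>A. \<Sum>\<omega>\<in>words A n. \<Sum>f\<in>B. fiber_sum B \<omega> (\<lambda>w. \<Psi> ((a, f) # w)))"
    by (intro sum.cong refl) (rule sum.swap)
  finally show ?case by (simp add: sum_words_Suc)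
qed (simp add: words_0)

lemma fiber_sum_mono:
  assumes "\<And>w. map fst w = \<omega> \<Longrightarrow> snd ` set w \<subseteq> B \<Longrightarrow> \<Psi> w \<le> \<Psi>' w"
  shows "fiber_sum B \<omega> \<Psi> \<le> fiber_sum B \<omega> \<Psi>'"
  using assms by (induction \<omega> arbitrary: \<Psi> \<Psi>') (auto intro!: sum_mono)

lemma fiber_sum_cong:
  assumes "\<And>w. map fst w = \<omega> \<Longrightarrow> snd ` set w \<subseteq> B \<Longrightarrow> \<Psi> w = \<Psi>' w"
  shows "fiber_sum B \<omega> \<Psi> = fiber_sum B \<omega> \<Psi>'"
  using fiber_sum_mono[of \<omega> B \<Psi> \<Psi>'] fiber_sum_mono[of \<omega> B \<Psi>' \<Psi>] assms by force

lemma fiber_sum_cmult: "fiber_sum B \<omega> (\<lambda>w. c * \<Psi> w) = c * fiber_sum B \<omega> \<Psi>"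
  by (induction \<omega> arbitrary: \<Psi>) (auto simp: sum_distrib_left)

lemma fiber_sum_zero: "fiber_sum B \<omega> (\<lambda>w. 0) = 0"
  by (induction \<omega>) auto

lemma fiber_sum_sum: "fiber_sum B \<omega> (\<lambda>w. \<Sum>i\<in>I. \<Psi> i w) = (\<Sum>i\<in>I. fiber_sum B \<omega> (\<Psi> i))"
proof (induction \<omega> arbitrary: \<Psi>)
  case (Cons a \<omega>)
  then show ?case by simp (rule sum.swap)
qed simp

section \<open>The walk as an image of uniform words\<close>

context directed_group
begin

text \<open>The lamp value at x of the product of the letters: the orbit of x picks up a lamp letter
  whenever the first rooted factor brings it to 1^infinity.\<close>

fun cocycle :: "(((nat \<Rightarrow> nat) \<times> (nat list \<Rightarrow> nat list) \<times> (nat \<Rightarrow> nat)) \<times> 'f) list \<Rightarrow> (nat \<Rightarrow> nat) \<Rightarrow> 'f" where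
  "cocycle [] x = \<one>\<^bsub>F\<^esub>"
| "cocycle (a # w) x = (if bd_act d (rooted d (fst (fst a))) x = ones then snd a else \<one>\<^bsub>F\<^esub>)
      \<otimes>\<^bsub>F\<^esub> cocycle w (bd_act d (act (fst a)) x)"

primrec walk :: "((nat \<Rightarrow> nat) \<times> (nat list \<Rightarrow> nat list) \<times> (nat \<Rightarrow> nat)) list \<Rightarrow> nat list \<Rightarrow> nat list" where
  "walk [] = id"
| "walk (a # w) = walk w \<circ> act a"

definition elt :: "(((nat \<Rightarrow> nat) \<times> (nat list \<Rightarrow> nat list) \<times> (nat \<Rightarrow> nat)) \<times> 'f) list \<Rightarrow> 'f welem" where
  "elt w = ((\<lambda>x. if x \<in> tbdry d then cocycle w x else \<one>\<^bsub>F\<^esub>), walk (map fst w))"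

definition letter_elt :: "((nat \<Rightarrow> nat) \<times> (nat list \<Rightarrow> nat list) \<times> (nat \<Rightarrow> nat)) \<times> 'f \<Rightarrow> 'f welem" where
  "letter_elt a = ((\<lambda>x. if x \<in> tbdry d \<and> bd_act d (rooted d (fst (fst a))) x = ones then snd a else \<one>\<^bsub>F\<^esub>),
      act (fst a))"

lemma F_one: "\<one>\<^bsub>F\<^esub> \<in> carrier F"
  using F_grp by (simp add: group.is_monoid monoid.one_closed)

lemma F_mult: "a \<in> carrier F \<Longrightarrow> b \<in> carrier F \<Longrightarrow> a \<otimes>\<^bsub>F\<^esub> b \<in> carrier F"
  using F_grp by (simp add: group.is_monoid monoid.m_closed)

lemma F_simps:
  "a \<in> carrier F \<Longrightarrow> \<one>\<^bsub>F\<^esub> \<otimes>\<^bsub>F\<^esub> a = a"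
  "a \<in> carrier F \<Longrightarrow> a \<otimes>\<^bsub>F\<^esub> \<one>\<^bsub>F\<^esub> = a"
  "a \<in> carrier F \<Longrightarrow> b \<in> carrier F \<Longrightarrow> c \<in> carrier F
     \<Longrightarrow> a \<otimes>\<^bsub>F\<^esub> b \<otimes>\<^bsub>F\<^esub> c = a \<otimes>\<^bsub>F\<^esub> (b \<otimes>\<^bsub>F\<^esub> c)"
  using F_grp by (simp_all add: group.is_monoid monoid.l_one monoid.r_one monoid.m_assoc)

lemma cocycle_closed: "snd ` set w \<subseteq> carrier F \<Longrightarrow> cocycle w x \<in> carrier F"
  by (induction w arbitrary: x) (auto simp: F_one F_mult)

lemma walk_perm: "set w \<subseteq> triples \<Longrightarrow> vertex_perm d (walk w)"
  by (induction w) (auto simp: vertex_perm_id intro!: vertex_perm_comp act_perm)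

lemma walk_append: "walk (w @ w') = walk w' \<circ> walk w"
  by (induction w) (auto simp: o_assoc)

lemma ones_in: "ones \<in> tbdry d"
  by (rule ones_tbdry[OF d_ge1])

lemma H_ones:
  assumes "h \<in> H" "x \<in> tbdry d"
  shows "bd_act d h x = ones \<longleftrightarrow> x = ones"
proof -
  have "bd_act d h ones = ones"
    using sig_of(2)[OF assms(1)] bd_act_hmap[OF ones_in] hray_ones by metis
  then show ?thesis using bd_act_inj[OF H_perm[OF assms(1)] assms(2) ones_in] by auto
qed

text \<open>\<open>conv_pow\<close> appends letters on the right while \<open>cocycle\<close> reads
  from the left; the appended letter sees x displaced by the whole walk.\<close>

lemma cocycle_snoc:
  assumes "set w \<subseteq> letters" "b \<in> letters" "x \<in> tbdry d"
  shows "cocycle (w @ [b]) x = cocycle w x \<otimes>\<^bsub>F\<^esub> fst (letter_elt b) (bd_act d (walk (map fst w)) x)"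
  using assms
proof (induction w arbitrary: x)
  case Nil
  then show ?case by (auto simp: letter_elt_def letters_def F_simps F_one bd_act_id bd_act_id[unfolded id_def])
next
  case (Cons a w)
  have a: "vertex_map d (act (fst a))" and fa: "snd a \<in> carrier F"
    using Cons.prems act_perm vertex_perm_map by (auto simp: letters_def)
  have x': "bd_act d (act (fst a)) x \<in> tbdry d" by (rule bd_act_tbdry[OF a Cons.prems(3)])
  have w: "cocycle w y \<in> carrier F" for y
    using Cons.prems by (intro cocycle_closed) (auto simp: letters_def)
  have b: "fst (letter_elt b) y \<in> carrier F" for y
    using Cons.prems F_one by (auto simp: letter_elt_def letters_def)
  have "bd_act d (walk (map fst (a # w))) x = bd_act d (walk (map fst w)) (bd_act d (act (fst a)) x)"
    using bd_act_comp[OF a Cons.prems(3)] by simp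
  then show ?case
    using Cons.IH[OF _ Cons.prems(2) x'] Cons.prems fa w b by (simp add: F_simps F_one o_def)
qed

lemma wmult_elt:
  assumes "set w \<subseteq> letters" "b \<in> letters"
  shows "wmult F d (elt w) (letter_elt b) = elt (w @ [b])"
  using cocycle_snoc[OF assms]
  by (auto simp: wmult_def elt_def walk_append letter_elt_def)

lemma rooted_inj: "inj_on (rooted d) perms"
proof (rule inj_onI)
  fix \<tau> \<tau>' assume *: "\<tau> \<in> perms" "\<tau>' \<in> perms" "rooted d \<tau> = rooted d \<tau>'"
  show "\<tau> = \<tau>'"
  proof
    fix z
    show "\<tau> z = \<tau>' z"
    proof (cases "z \<in> {1..d 0}")
      case True
      then have "[z] \<in> tverts d" by (simp add: tverts_def)
      then show ?thesis using fun_cong[OF *(3), of "[z]"] by (simp add: rooted_simps)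
    next
      case False
      then show ?thesis using * by (auto simp: perms_def permutes_def)
    qed
  qed
qed

lemma rooted_grp_uniform:
  "pmf_of_set (rooted_grp F d) = map_pmf (\<lambda>\<tau>. ((\<lambda>x. \<one>\<^bsub>F\<^esub>), rooted d \<tau>)) (pmf_of_set perms)"
proof -
  have "rooted_grp F d = (\<lambda>\<tau>. ((\<lambda>x. \<one>\<^bsub>F\<^esub>), rooted d \<tau>)) ` perms"
    by (auto simp: rooted_grp_def perms_def)
  moreover have "inj_on (\<lambda>\<tau>. ((\<lambda>x :: nat \<Rightarrow> nat. \<one>\<^bsub>F\<^esub>), rooted d \<tau>)) perms"
    using rooted_inj by (auto simp: inj_on_def)
  ultimately show ?thesis
    using map_pmf_of_set_inj[OF _ perms_nonempty finite_perms] by metis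
qed

text \<open>Elements of H fix 1^infinity, so the lamp of \<open>h phi_f\<close> stays there and the
  pairs (h, f) parametrise \<open>HF\<close> injectively.\<close>

lemma HF_uniform:
  "pmf_of_set (HF_set F d H)
     = map_pmf (\<lambda>(h, f). ((\<lambda>x. if x = ones then f else \<one>\<^bsub>F\<^esub>), h)) (pmf_of_set (H \<times> carrier F))"
proof -
  let ?g = "\<lambda>(h, f). ((\<lambda>x :: nat \<Rightarrow> nat. if x = ones then f else \<one>\<^bsub>F\<^esub>), h)"
  have "wmult F d ((\<lambda>x. \<one>\<^bsub>F\<^esub>), h) (phi_el F f) = ?g (h, f)" if "h \<in> H" "f \<in> carrier F" for h f
    using that H_ones[of h] ones_in by (auto simp: wmult_def phi_el_def F_simps F_one)
  then have "HF_set F d H = ?g ` (H \<times> carrier F)"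
    unfolding HF_set_def by (force simp: image_iff)
  moreover have "inj_on ?g (H \<times> carrier F)"
  proof (rule inj_onI)
    fix p p' assume "?g p = ?g p'"
    then have "snd (?g p) = snd (?g p')" "fst (?g p) ones = fst (?g p') ones" by simp_all
    then show "p = p'" by (auto simp: split_def prod_eq_iff)
  qed
  moreover have "H \<times> carrier F \<noteq> {}" using H_id F_one by auto
  moreover have "finite (H \<times> carrier F)" using H_fin F_fin by simp
  ultimately show ?thesis using map_pmf_of_set_inj[of ?g "H \<times> carrier F"] by metis
qed

lemma wmult_letter:
  assumes "s \<in> perms" "h \<in> H" "s' \<in> perms" "f \<in> carrier F"
  shows "wmult F d (wmult F d ((\<lambda>x. \<one>\<^bsub>F\<^esub>), rooted d s) ((\<lambda>x. if x = ones then f else \<one>\<^bsub>F\<^esub>), h))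
      ((\<lambda>x. \<one>\<^bsub>F\<^esub>), rooted d s') = letter_elt ((s, h, s'), f)"
  using assms(4) by (auto simp: wmult_def letter_elt_def act_def F_simps F_one o_assoc)

lemma step_law_eq: "step_law F d H = map_pmf letter_elt (pmf_of_set letters)"
proof -
  let ?U = "pmf_of_set perms" and ?H = "pmf_of_set H" and ?F = "pmf_of_set (carrier F)"
  have ne: "H \<noteq> {}" "carrier F \<noteq> {}" using H_id F_one by auto
  have "step_law F d H = ?U \<bind> (\<lambda>s. ?H \<bind> (\<lambda>h. ?F \<bind> (\<lambda>f. ?U \<bind> (\<lambda>s'. return_pmf
      (wmult F d (wmult F d ((\<lambda>x. \<one>\<^bsub>F\<^esub>), rooted d s) ((\<lambda>x. if x = ones then f else \<one>\<^bsub>F\<^esub>), h))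
      ((\<lambda>x. \<one>\<^bsub>F\<^esub>), rooted d s'))))))"
    unfolding step_law_def rooted_grp_uniform HF_uniform
      pmf_of_set_Times[OF H_fin ne(1) F_fin ne(2)]
    by (simp add: bind_map_pmf pair_pmf_def bind_assoc_pmf bind_return_pmf)
  also have "\<dots> = ?U \<bind> (\<lambda>s. ?H \<bind> (\<lambda>h. ?F \<bind> (\<lambda>f. ?U \<bind> (\<lambda>s'. return_pmf (letter_elt ((s, h, s'), f))))))"
    using H_fin ne F_fin finite_perms perms_nonempty
    by (intro bind_pmf_cong refl) (simp add: wmult_letter)
  \<comment> \<open>The independent draws of f and s' are exchanged to match the order of the
    components of \<open>letters\<close>.\<close>
  also have "\<dots> = ?U \<bind> (\<lambda>s. ?H \<bind> (\<lambda>h. ?U \<bind> (\<lambda>s'. ?F \<bind> (\<lambda>f. return_pmf (letter_elt ((s, h, s'), f))))))"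
    by (intro bind_pmf_cong refl bind_commute_pmf)
  also have "\<dots> = map_pmf letter_elt (pair_pmf (pair_pmf ?U (pair_pmf ?H ?U)) ?F)"
    by (simp add: pair_pmf_def map_pmf_def bind_assoc_pmf bind_return_pmf)
  also have "pair_pmf (pair_pmf ?U (pair_pmf ?H ?U)) ?F = pmf_of_set letters"
    unfolding letters_def triples_def
    using H_fin ne F_fin finite_perms perms_nonempty by (simp add: pmf_of_set_Times)
  finally show ?thesis .
qed

lemma letters_nonempty: "letters \<noteq> {}"
  using perms_nonempty H_id F_one by (auto simp: letters_def triples_def)

lemma words_snoc: "words A (Suc n) = (\<lambda>(w, a). w @ [a]) ` (words A n \<times> A)"
  by (auto simp: words_def length_Suc_conv_rev image_iff)

lemma conv_pow_eq: "conv_pow F d (step_law F d H) n = map_pmf elt (pmf_of_set (words letters n))"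
proof (induction n)
  case 0
  show ?case by (auto simp: words_0 elt_def wone_def pmf_of_set_singleton)
next
  case (Suc n)
  let ?W = "words letters n"
  have W: "finite ?W" "?W \<noteq> {}" using finite_words[OF finite_letters] words_nonempty[OF letters_nonempty] by auto
  have "conv_pow F d (step_law F d H) (Suc n)
    = pmf_of_set ?W \<bind> (\<lambda>w. pmf_of_set letters \<bind> (\<lambda>b. return_pmf (wmult F d (elt w) (letter_elt b))))"
    unfolding conv_pow.simps Suc unfolding step_law_eq
    by (simp add: bind_map_pmf map_pmf_def bind_assoc_pmf bind_return_pmf)
  also have "\<dots> = pmf_of_set ?W \<bind> (\<lambda>w. pmf_of_set letters \<bind> (\<lambda>b. return_pmf (elt (w @ [b]))))"
    using W finite_letters letters_nonempty
    by (intro bind_pmf_cong refl) (auto simp: wmult_elt words_def)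
  also have "\<dots> = map_pmf elt (map_pmf (\<lambda>(w, a). w @ [a]) (pmf_of_set (?W \<times> letters)))"
    using W finite_letters letters_nonempty
    by (simp add: pmf_of_set_Times pair_pmf_def map_pmf_def bind_assoc_pmf bind_return_pmf)
  also have "map_pmf (\<lambda>(w, a). w @ [a]) (pmf_of_set (?W \<times> letters)) = pmf_of_set (words letters (Suc n))"
    unfolding words_snoc using W finite_letters letters_nonempty
    by (intro map_pmf_of_set_inj) (auto simp: inj_on_def)
  finally show ?case .
qed

section \<open>Visited vertices and the spread of the lamps\<close>

definition visited :: "nat \<Rightarrow> ((nat \<Rightarrow> nat) \<times> (nat list \<Rightarrow> nat list) \<times> (nat \<Rightarrow> nat)) list \<Rightarrow> nat list set" where
  "visited k \<omega> = {v \<in> level d k. True \<in> set (visits v \<omega>)}"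

lemma finite_visited: "finite (visited k \<omega>)"
  by (simp add: visited_def finite_level)

lemma visited_Cons:
  assumes "a \<in> triples"
  shows "v \<in> visited k (a # \<omega>) \<longleftrightarrow>
    v \<in> level d k \<and> (rooted d (fst a) v = replicate k 1 \<or> act a v \<in> visited k \<omega>)"
proof (cases "v \<in> level d k")
  case True
  have r: "fst a \<in> perms" using assms by (auto simp: triples_def)
  have "rooted d (fst a) v \<in> level d k" "act a v \<in> level d k"
    using vertex_map_level[OF vertex_perm_map[OF rooted_perm[OF r]] True]
      vertex_map_level[OF vertex_perm_map[OF act_perm[OF assms]] True] .
  then show ?thesis using True by (auto simp: visited_def True_in_visit_type level_def)
qed (simp add: visited_def)

text \<open>A lamp letter can only reach x when its orbit is at 1^infinity, and then the prefix of
  length k is at 1^k, which is a visit.\<close>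

lemma cocycle_trivial:
  assumes "set (map fst w) \<subseteq> triples" "x \<in> tbdry d" "map x [0..<k] \<notin> visited k (map fst w)"
  shows "cocycle w x = \<one>\<^bsub>F\<^esub>"
  using assms
proof (induction w arbitrary: x)
  case (Cons a w)
  let ?v = "map x [0..<k]"
  have a: "fst a \<in> triples" and r: "fst (fst a) \<in> perms" using Cons.prems by (auto simp: triples_def)
  have v: "?v \<in> level d k" using prefix_tverts[OF Cons.prems(2)] by (simp add: level_def)
  have am: "vertex_map d (act (fst a))" and rm: "vertex_map d (rooted d (fst (fst a)))"
    using act_perm[OF a] rooted_perm[OF r] vertex_perm_map by auto
  have nv: "rooted d (fst (fst a)) ?v \<noteq> replicate k 1" "act (fst a) ?v \<notin> visited k (map fst w)"
    using Cons.prems(3) visited_Cons[OF a, of ?v k "map fst w"] v by auto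
  have "bd_act d (rooted d (fst (fst a))) x \<noteq> ones"
  proof
    assume "bd_act d (rooted d (fst (fst a))) x = ones"
    then have "map ones [0..<k] = rooted d (fst (fst a)) ?v"
      using bd_act_prefix[OF rm Cons.prems(2), of k] by simp
    moreover have "map ones [0..<k] = replicate k 1"
      unfolding ones_def by (simp add: map_replicate_const)
    ultimately show False using nv by simp
  qed
  moreover have "cocycle w (bd_act d (act (fst a)) x) = \<one>\<^bsub>F\<^esub>"
    using Cons.prems nv(2) bd_act_prefix[OF am Cons.prems(2), of k]
    by (intro Cons.IH bd_act_tbdry[OF am]) auto
  ultimately show ?case by (simp add: F_simps F_one)
qed simp

text \<open>Given the tree letters, each visited vertex forces the lamp value at one of its visits, so a
  prescribed lamp configuration is met by at most a fraction \<open>|F|^(-|visited|)\<close> of the lamp letters.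
  The auxiliary surjection \<open>G\<close> is the displacement by the letters already read.\<close>

lemma fiber_count:
  assumes "\<omega> \<in> words triples n" "k \<ge> 1"
    and "\<And>x. x \<in> tbdry d \<Longrightarrow> G x \<in> tbdry d" "\<And>y. y \<in> tbdry d \<Longrightarrow> \<exists>x\<in>tbdry d. G x = y"
  shows "fiber_sum (carrier F) \<omega> (\<lambda>w. of_bool (\<forall>x\<in>tbdry d. cocycle w (G x) = \<psi> x))
      * real (card (carrier F)) ^ card (visited k \<omega>) \<le> real (card (carrier F)) ^ n"
  using assms(1,3,4)
proof (induction \<omega> arbitrary: n G \<psi>)
  case Nil
  then show ?case by (simp add: words_def visited_def)
next
  case (Cons a \<omega>)
  let ?q = "real (card (carrier F))"
  let ?fs = "fiber_sum (carrier F)"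
  obtain m where n: "n = Suc m" and \<omega>: "\<omega> \<in> words triples m" and a: "a \<in> triples"
    using Cons.prems(1) by (cases n) (auto simp: words_def)
  have "card (carrier F) \<noteq> 0" using F_one F_fin by auto
  then have q: "?q \<ge> 1" by simp
  have ap: "vertex_perm d (act a)" by (rule act_perm[OF a])
  have rp: "vertex_perm d (rooted d (fst a))" using a by (intro rooted_perm) (auto simp: triples_def)
  define G' where "G' x = bd_act d (act a) (G x)" for x
  have G'1: "G' x \<in> tbdry d" if "x \<in> tbdry d" for x
    unfolding G'_def using Cons.prems(2)[OF that] by (rule bd_act_tbdry[OF vertex_perm_map[OF ap]])
  have G'2: "\<exists>x\<in>tbdry d. G' x = y" if y: "y \<in> tbdry d" for y
    using bd_act_surj[OF ap y] Cons.prems(3) unfolding G'_def by metis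
  define e where "e f x = (if bd_act d (rooted d (fst a)) (G x) = ones then f else \<one>\<^bsub>F\<^esub>)" for f x
  define N where "N f = ?fs \<omega> (\<lambda>w. of_bool (\<forall>x\<in>tbdry d. e f x \<otimes>\<^bsub>F\<^esub> cocycle w (G' x) = \<psi> x))" for f
  have N0: "0 \<le> N f" for f
  proof -
    have "?fs \<omega> (\<lambda>w. 0) \<le> N f" unfolding N_def by (intro fiber_sum_mono) simp
    then show ?thesis by (simp add: fiber_sum_zero)
  qed
  have IH: "N f * ?q ^ card (visited k \<omega>) \<le> ?q ^ m" if f: "f \<in> carrier F" for f
  proof -
    have ef: "e f x \<in> carrier F" for x using f F_one by (simp add: e_def)
    \<comment> \<open>The first lamp factor is known once f is fixed, so it moves to the other side
      and changes the target configuration of the induction hypothesis.\<close>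
    have "N f \<le> ?fs \<omega> (\<lambda>w. of_bool (\<forall>x\<in>tbdry d. cocycle w (G' x) = inv\<^bsub>F\<^esub> (e f x) \<otimes>\<^bsub>F\<^esub> \<psi> x))"
      unfolding N_def
    proof (rule fiber_sum_mono)
      fix w :: "(((nat \<Rightarrow> nat) \<times> (nat list \<Rightarrow> nat list) \<times> (nat \<Rightarrow> nat)) \<times> 'f) list"
      assume "snd ` set w \<subseteq> carrier F"
      then have c: "cocycle w y \<in> carrier F" for y by (rule cocycle_closed)
      have "inv\<^bsub>F\<^esub> (e f x) \<otimes>\<^bsub>F\<^esub> (e f x \<otimes>\<^bsub>F\<^esub> cocycle w y) = cocycle w y" for x y
        using group.inv_closed[OF F_grp ef[of x]] group.l_inv[OF F_grp ef[of x]] ef[of x] c[of y]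
          F_simps(3)[of "inv\<^bsub>F\<^esub> (e f x)" "e f x" "cocycle w y"]
        by (simp add: F_simps)
      then have "\<forall>x\<in>tbdry d. e f x \<otimes>\<^bsub>F\<^esub> cocycle w (G' x) = \<psi> x \<Longrightarrow>
          \<forall>x\<in>tbdry d. cocycle w (G' x) = inv\<^bsub>F\<^esub> (e f x) \<otimes>\<^bsub>F\<^esub> \<psi> x" by metis
      then show "(of_bool (\<forall>x\<in>tbdry d. e f x \<otimes>\<^bsub>F\<^esub> cocycle w (G' x) = \<psi> x) :: real)
        \<le> of_bool (\<forall>x\<in>tbdry d. cocycle w (G' x) = inv\<^bsub>F\<^esub> (e f x) \<otimes>\<^bsub>F\<^esub> \<psi> x)" by auto
    qed
    then have "N f * ?q ^ card (visited k \<omega>)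
       \<le> ?fs \<omega> (\<lambda>w. of_bool (\<forall>x\<in>tbdry d. cocycle w (G' x) = inv\<^bsub>F\<^esub> (e f x) \<otimes>\<^bsub>F\<^esub> \<psi> x))
          * ?q ^ card (visited k \<omega>)" using q by (intro mult_right_mono) auto
    also have "\<dots> \<le> ?q ^ m" by (rule Cons.IH[OF \<omega> G'1 G'2])
    finally show ?thesis .
  qed
  \<comment> \<open>y0 is the ray lit by the first letter and v0 its level-k prefix; v0 is the only
    vertex that this letter can newly visit.\<close>
  obtain y0 where y0: "y0 \<in> tbdry d" "bd_act d (rooted d (fst a)) y0 = ones"
    using bd_act_surj[OF rp ones_in] by blast
  define v0 where "v0 = map y0 [0..<k]"
  have v0: "rooted d (fst a) v0 = replicate k 1"
    using bd_act_prefix[OF vertex_perm_map[OF rp] y0(1), of k]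
    unfolding v0_def y0(2) ones_def by (simp add: map_replicate_const)
  define B where "B = {v \<in> level d k. act a v \<in> visited k \<omega>}"
  have sub: "visited k (a # \<omega>) \<subseteq> insert v0 B"
    using visited_Cons[OF a, of _ k \<omega>] v0 injD[OF vertex_perm_inj[OF rp]] by (auto simp: B_def)
  have finB: "finite B" by (simp add: B_def finite_level)
  have "card (act a ` B) \<le> card (visited k \<omega>)"
    by (intro card_mono finite_visited) (auto simp: B_def)
  then have cardB: "card B \<le> card (visited k \<omega>)"
    using vertex_perm_inj[OF ap] by (subst (asm) card_image) (auto intro: inj_on_subset)
  have eq: "?fs (a # \<omega>) (\<lambda>w. of_bool (\<forall>x\<in>tbdry d. cocycle w (G x) = \<psi> x)) = (\<Sum>f\<in>carrier F. N f)"
    by (simp add: N_def e_def G'_def)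
  show ?case
  proof (cases "v0 \<in> B")
    case True
    \<comment> \<open>Here v0 is visited again later, the number of visited vertices does not grow,
      and f may be arbitrary.\<close>
    then have "card (visited k (a # \<omega>)) \<le> card (visited k \<omega>)"
      using card_mono[OF _ sub] finB cardB by (simp add: insert_absorb)
    then have "(\<Sum>f\<in>carrier F. N f) * ?q ^ card (visited k (a # \<omega>))
        \<le> (\<Sum>f\<in>carrier F. N f) * ?q ^ card (visited k \<omega>)"
      using q N0 by (intro mult_left_mono power_increasing sum_nonneg) auto
    also have "\<dots> \<le> (\<Sum>f\<in>carrier F. ?q ^ m)"
      unfolding sum_distrib_right by (intro sum_mono IH)
    finally show ?thesis unfolding eq n by simp
  next
    case False
    obtain x0 where x0: "x0 \<in> tbdry d" "G x0 = y0" using Cons.prems(3)[OF y0(1)] by blast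
    have v0l: "v0 \<in> level d k" using prefix_tverts[OF y0(1)] by (simp add: v0_def level_def)
    \<comment> \<open>Here v0 is never visited again, so no later lamp letter acts at y0 and the
      first one must equal the prescribed value; this saves the extra factor |F|.\<close>
    have zero: "N f = 0" if "f \<in> carrier F" "f \<noteq> \<psi> x0" for f
    proof -
      have "N f \<le> ?fs \<omega> (\<lambda>w. 0)"
        unfolding N_def
      proof (rule fiber_sum_mono)
        fix w :: "(((nat \<Rightarrow> nat) \<times> (nat list \<Rightarrow> nat list) \<times> (nat \<Rightarrow> nat)) \<times> 'f) list"
        assume w: "map fst w = \<omega>" "snd ` set w \<subseteq> carrier F"
        have "map (G' x0) [0..<k] = act a v0"
          unfolding G'_def x0(2) v0_def by (rule bd_act_prefix[OF vertex_perm_map[OF ap] y0(1)])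
        then have "map (G' x0) [0..<k] \<notin> visited k (map fst w)"
          using False v0l w by (simp add: B_def)
        then have "cocycle w (G' x0) = \<one>\<^bsub>F\<^esub>"
          using w \<omega> by (intro cocycle_trivial[OF _ G'1[OF x0(1)]]) (auto simp: words_def)
        then have "e f x0 \<otimes>\<^bsub>F\<^esub> cocycle w (G' x0) \<noteq> \<psi> x0"
          using that x0 y0 by (simp add: e_def F_simps)
        then have "\<not> (\<forall>x\<in>tbdry d. e f x \<otimes>\<^bsub>F\<^esub> cocycle w (G' x) = \<psi> x)" using x0 by blast
        then show "(of_bool (\<forall>x\<in>tbdry d. e f x \<otimes>\<^bsub>F\<^esub> cocycle w (G' x) = \<psi> x) :: real) \<le> 0" by simp
      qed
      also have "\<dots> = 0" by (rule fiber_sum_zero)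
      finally show ?thesis using N0[of f] by simp
    qed
    have "card (visited k (a # \<omega>)) \<le> Suc (card (visited k \<omega>))"
      using card_mono[OF _ sub] finB cardB card_insert_le_m1[of "Suc (card B)"] False by simp
    then have "(\<Sum>f\<in>carrier F. N f) * ?q ^ card (visited k (a # \<omega>))
        \<le> (\<Sum>f\<in>carrier F. N f) * ?q ^ Suc (card (visited k \<omega>))"
      using q N0 by (intro mult_left_mono power_increasing sum_nonneg) auto
    also have "\<dots> = (\<Sum>f\<in>carrier F \<inter> {\<psi> x0}. N f) * ?q ^ Suc (card (visited k \<omega>))"
      using zero F_fin by (intro arg_cong2[where f = "(*)"] sum.mono_neutral_right) auto
    also have "(\<Sum>f\<in>carrier F \<inter> {\<psi> x0}. N f) * ?q ^ Suc (card (visited k \<omega>)) \<le> ?q ^ n"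
    proof (cases "\<psi> x0 \<in> carrier F")
      case True
      then have "N (\<psi> x0) * ?q ^ card (visited k \<omega>) * ?q \<le> ?q ^ m * ?q"
        using IH q by (intro mult_right_mono) auto
      then show ?thesis using True n by (simp add: mult.commute mult.left_commute)
    qed (use q in simp)
    finally show ?thesis unfolding eq .
  qed
qed

text \<open>With p the law of the walk, the mean of p(elt w) |F|^visited over words is at most 1, by
  counting lamp words over each tree word. Then ln t \<le> t - 1 turns this into a lower bound on
  the mean of -ln p.\<close>

lemma entropy_ge_visited:
  assumes "k \<ge> 1"
  shows "rw_entropy F d H n * real (card (words letters n))
     \<ge> ln (real (card (carrier F))) * (\<Sum>w\<in>words letters n. real (card (visited k (map fst w))))"
proof -
  let ?W = "words letters n"
  let ?q = "real (card (carrier F))"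
  let ?p = "pmf (map_pmf elt (pmf_of_set ?W))"
  let ?O = "\<lambda>\<omega>. card (visited k \<omega>)"
  have W: "finite ?W" "?W \<noteq> {}" using finite_words[OF finite_letters] words_nonempty[OF letters_nonempty] by auto
  then have cW: "real (card ?W) > 0" by (simp add: card_gt_0_iff)
  have "card (carrier F) \<noteq> 0" using F_one F_fin by auto
  then have q: "?q \<ge> 1" by simp
  have pos: "?p (elt w) > 0" if "w \<in> ?W" for w
    using that W by (intro pmf_positive) auto
  have fin: "finite (elt ` ?W)" using W by simp
  have "(\<Sum>w\<in>?W. ?p (elt w) * ?q ^ ?O (map fst w)) \<le> real (card ?W)"
  proof -
    \<comment> \<open>Given \<open>\<omega>\<close>, no group element has conditional probability above \<open>|F|^(-|visited|)\<close>.\<close>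
    have fib: "fiber_sum (carrier F) \<omega> (\<lambda>w. ?p (elt w) * ?q ^ ?O (map fst w)) \<le> ?q ^ n"
      if \<omega>: "\<omega> \<in> words triples n" for \<omega>
    proof -
      have "fiber_sum (carrier F) \<omega> (\<lambda>w. ?p (elt w) * ?q ^ ?O (map fst w))
        = fiber_sum (carrier F) \<omega> (\<lambda>w. \<Sum>\<gamma>\<in>elt ` ?W. (?p \<gamma> * ?q ^ ?O \<omega>) * of_bool (elt w = \<gamma>))"
      proof (rule fiber_sum_cong)
        fix w :: "(((nat \<Rightarrow> nat) \<times> (nat list \<Rightarrow> nat list) \<times> (nat \<Rightarrow> nat)) \<times> 'f) list"
        assume w: "map fst w = \<omega>"
        have "?p (elt w) = (\<Sum>\<gamma>\<in>elt ` ?W. ?p \<gamma> * of_bool (elt w = \<gamma>))"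
        proof (cases "elt w \<in> elt ` ?W")
          case True
          have "(\<Sum>\<gamma>\<in>elt ` ?W. ?p \<gamma> * of_bool (elt w = \<gamma>)) = (\<Sum>\<gamma>\<in>elt ` ?W. if elt w = \<gamma> then ?p \<gamma> else 0)"
            by (intro sum.cong) auto
          then show ?thesis using True fin by simp
        next
          case False
          then have "elt w \<notin> set_pmf (map_pmf elt (pmf_of_set ?W))" using W by simp
          then have "?p (elt w) = 0" by (simp only: set_pmf_iff) simp
          moreover have "(\<Sum>\<gamma>\<in>elt ` ?W. ?p \<gamma> * of_bool (elt w = \<gamma>)) = 0"
            using False by (intro sum.neutral) auto
          ultimately show ?thesis by simp
        qed
        then show "?p (elt w) * ?q ^ ?O (map fst w)
          = (\<Sum>\<gamma>\<in>elt ` ?W. (?p \<gamma> * ?q ^ ?O \<omega>) * of_bool (elt w = \<gamma>))"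
          unfolding w by (simp only: sum_distrib_right) (simp add: mult_ac)
      qed
      also have "\<dots> = (\<Sum>\<gamma>\<in>elt ` ?W. ?p \<gamma> * (fiber_sum (carrier F) \<omega> (\<lambda>w. of_bool (elt w = \<gamma>)) * ?q ^ ?O \<omega>))"
        unfolding fiber_sum_sum fiber_sum_cmult by (simp add: mult_ac)
      \<comment> \<open>Only the lamp part of the group element is compared;
        \<open>fiber_count\<close> is started with no displacement.\<close>
      also have "\<dots> \<le> (\<Sum>\<gamma>\<in>elt ` ?W. ?p \<gamma> * ?q ^ n)"
      proof (intro sum_mono mult_left_mono)
        fix \<gamma>
        have "fiber_sum (carrier F) \<omega> (\<lambda>w. of_bool (elt w = \<gamma>))
          \<le> fiber_sum (carrier F) \<omega> (\<lambda>w. of_bool (\<forall>x\<in>tbdry d. cocycle w (id x) = fst \<gamma> x))"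
          by (intro fiber_sum_mono) (auto simp: elt_def)
        then have "fiber_sum (carrier F) \<omega> (\<lambda>w. of_bool (elt w = \<gamma>)) * ?q ^ ?O \<omega>
          \<le> fiber_sum (carrier F) \<omega> (\<lambda>w. of_bool (\<forall>x\<in>tbdry d. cocycle w (id x) = fst \<gamma> x)) * ?q ^ ?O \<omega>"
          using q by (intro mult_right_mono) auto
        also have "\<dots> \<le> ?q ^ n" by (rule fiber_count[OF \<omega> assms]) auto
        finally show "fiber_sum (carrier F) \<omega> (\<lambda>w. of_bool (elt w = \<gamma>)) * ?q ^ ?O \<omega> \<le> ?q ^ n" .
      qed simp
      also have "\<dots> = ?q ^ n"
        using sum_pmf_eq_1[OF fin, of "map_pmf elt (pmf_of_set ?W)"] W by (simp add: sum_distrib_right[symmetric])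
      finally show ?thesis .
    qed
    have "(\<Sum>w\<in>?W. ?p (elt w) * ?q ^ ?O (map fst w))
      = (\<Sum>\<omega>\<in>words triples n. fiber_sum (carrier F) \<omega> (\<lambda>w. ?p (elt w) * ?q ^ ?O (map fst w)))"
      using sum_words_fiber_sum[of "\<lambda>w. ?p (elt w) * ?q ^ ?O (map fst w)" triples "carrier F" n]
      unfolding letters_def .
    also have "\<dots> \<le> (\<Sum>\<omega>\<in>words triples n. ?q ^ n)" by (intro sum_mono fib)
    also have "\<dots> = real (card ?W)"
      by (simp add: card_words finite_letters finite_triples)
         (simp add: letters_def card_cartesian_product power_mult_distrib)
    finally show ?thesis .
  qed
  moreover have "(\<Sum>w\<in>?W. ln (?p (elt w)) + ln ?q * real (?O (map fst w)))
      \<le> (\<Sum>w\<in>?W. ?p (elt w) * ?q ^ ?O (map fst w) - 1)"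
  proof (rule sum_mono)
    fix w assume "w \<in> ?W"
    then have "0 < ?p (elt w)" by (rule pos)
    moreover have "0 < ?q ^ ?O (map fst w)" using q by simp
    ultimately have "ln (?p (elt w)) + ln ?q * real (?O (map fst w)) = ln (?p (elt w) * ?q ^ ?O (map fst w))"
      using q by (simp add: ln_mult ln_realpow)
    also have "\<dots> \<le> ?p (elt w) * ?q ^ ?O (map fst w) - 1"
      using \<open>0 < ?p (elt w)\<close> \<open>0 < ?q ^ ?O (map fst w)\<close> by (intro ln_le_minus_one) simp
    finally show "ln (?p (elt w)) + ln ?q * real (?O (map fst w)) \<le> ?p (elt w) * ?q ^ ?O (map fst w) - 1" .
  qed
  ultimately have "(\<Sum>w\<in>?W. ln (?p (elt w))) + ln ?q * (\<Sum>w\<in>?W. real (?O (map fst w))) \<le> 0"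
    by (simp add: sum.distrib sum_distrib_left sum_subtractf)
  moreover have "rw_entropy F d H n * real (card ?W) = - (\<Sum>w\<in>?W. ln (?p (elt w)))"
    unfolding rw_entropy_def conv_pow_eq pmf_entropy_map_uniform[OF W] using cW by simp
  ultimately show ?thesis by linarith
qed

text \<open>The expected number of visited vertices is the sum of the visit probabilities over the
  level, which average to at least 1/5.\<close>

lemma entropy_ge:
  assumes "k \<ge> 1" "(\<Prod>i<k. pexp d i) * real n \<ge> 1"
  shows "rw_entropy F d H n \<ge> ln (real (card (carrier F))) * real (\<Prod>i<k. d i) / 5"
proof -
  let ?W = "words letters n"
  have W: "finite ?W" "?W \<noteq> {}" using finite_words[OF finite_letters] words_nonempty[OF letters_nonempty] by auto
  then have cW: "real (card ?W) > 0" by (simp add: card_gt_0_iff)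
  have "card (carrier F) \<noteq> 0" using F_one F_fin by auto
  then have q: "ln (real (card (carrier F))) \<ge> 0" by simp
  have "(\<Sum>w\<in>?W. real (card (visited k (map fst w))))
     = (\<Sum>w\<in>?W. \<Sum>v\<in>level d k. of_bool (True \<in> set (visits v (map fst w))))"
    by (intro sum.cong refl) (simp add: visited_def finite_level Int_def flip: sum.inter_filter)
  also have "\<dots> = (\<Sum>v\<in>level d k. \<Sum>w\<in>?W. of_bool (True \<in> set (visits v (map fst w))))"
    by (rule sum.swap)
  also have "\<dots> = real (card ?W) * real (card (level d k)) * level_mean d k (\<lambda>u. of_bool (True \<in> set u)) (steps n)"
    by (rule sum_level_words_visits[OF assms(1)])
  also have "\<dots> \<ge> real (card ?W) * real (card (level d k)) * (1 / 5)"
    using assms d_ge2 by (intro mult_left_mono level_mean_visit_ge) (auto simp: blocks_steps)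
  finally have "ln (real (card (carrier F))) * (real (card ?W) * real (card (level d k)) * (1 / 5))
     \<le> rw_entropy F d H n * real (card ?W)"
    using entropy_ge_visited[OF assms(1), of n] q by (meson mult_left_mono order_trans)
  then show ?thesis using cW by (simp add: card_level field_simps)
qed

end

section \<open>The upper bound\<close>

text \<open>Gibbs' inequality: any weights of total at most 1 on codes that determine X bound its
  entropy by the mean of the negative log-weight.\<close>

lemma pmf_entropy_le_code:
  fixes Q :: "'c \<Rightarrow> real"
  assumes W: "finite W" "W \<noteq> {}"
    and dec: "\<And>w w'. w \<in> W \<Longrightarrow> w' \<in> W \<Longrightarrow> C w = C w' \<Longrightarrow> X w = X w'"
    and Q: "\<And>w. w \<in> W \<Longrightarrow> Q (C w) > 0" and Q_sum: "(\<Sum>c\<in>C ` W. Q c) \<le> 1"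
  shows "pmf_entropy (map_pmf X (pmf_of_set W)) * real (card W) \<le> (\<Sum>w\<in>W. - ln (Q (C w)))"
proof -
  let ?p = "pmf (map_pmf X (pmf_of_set W))"
  have cW: "real (card W) > 0" using W by (simp add: card_gt_0_iff)
  have pos: "?p (X w) > 0" if "w \<in> W" for w using that W by (intro pmf_positive) auto
  define X' where "X' c = X (inv_into W C c)" for c
  have X': "X' (C w) = X w" if "w \<in> W" for w
    unfolding X'_def using that by (intro dec inv_into_into f_inv_into_f) auto
  \<comment> \<open>The weights are pushed forward from codes to values of X, which can only
    increase the weight attached to a word.\<close>
  define q where "q \<gamma> = (\<Sum>c | c \<in> C ` W \<and> X' c = \<gamma>. Q c)" for \<gamma>
  have qge: "Q (C w) \<le> q (X w)" if "w \<in> W" for w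
    unfolding q_def using that W X' Q by (intro member_le_sum) (auto intro: less_imp_le)
  \<comment> \<open>This is the expectation of q/p under p, hence the total weight of q.\<close>
  have "(\<Sum>w\<in>W. q (X w) / ?p (X w)) / real (card W)
      = measure_pmf.expectation (map_pmf X (pmf_of_set W)) (\<lambda>\<gamma>. q \<gamma> / ?p \<gamma>)"
    using W by (simp add: integral_pmf_of_set)
  also have "\<dots> = (\<Sum>\<gamma>\<in>X ` W. q \<gamma> / ?p \<gamma> * ?p \<gamma>)"
    using W by (subst integral_measure_pmf_real[of "X ` W"]) auto
  also have "\<dots> = (\<Sum>\<gamma>\<in>X ` W. q \<gamma>)"
  proof (rule sum.cong[OF refl])
    fix \<gamma> assume "\<gamma> \<in> X ` W"
    then have "?p \<gamma> > 0" using pos by blast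
    then show "q \<gamma> / ?p \<gamma> * ?p \<gamma> = q \<gamma>" by simp
  qed
  also have "\<dots> = (\<Sum>c\<in>C ` W. Q c)"
    unfolding q_def using W X' by (intro sum.group) auto
  finally have sumq: "(\<Sum>w\<in>W. q (X w) / ?p (X w)) \<le> real (card W)"
    using Q_sum cW by (simp add: field_simps)
  have "(\<Sum>w\<in>W. ln (Q (C w)) - ln (?p (X w))) \<le> (\<Sum>w\<in>W. q (X w) / ?p (X w) - 1)"
  proof (rule sum_mono)
    fix w assume w: "w \<in> W"
    have "ln (Q (C w)) - ln (?p (X w)) \<le> ln (q (X w)) - ln (?p (X w))"
      using Q[OF w] qge[OF w] by simp
    also have "\<dots> = ln (q (X w) / ?p (X w))"
      using Q[OF w] qge[OF w] pos[OF w] by (simp add: ln_div)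
    also have "\<dots> \<le> q (X w) / ?p (X w) - 1"
      using Q[OF w] qge[OF w] pos[OF w] by (intro ln_le_minus_one) auto
    finally show "ln (Q (C w)) - ln (?p (X w)) \<le> q (X w) / ?p (X w) - 1" .
  qed
  then have "(\<Sum>w\<in>W. ln (Q (C w))) - (\<Sum>w\<in>W. ln (?p (X w))) \<le> 0"
    using sumq by (simp add: sum_subtractf)
  then show ?thesis
    unfolding pmf_entropy_map_uniform[OF W] using cW by (simp add: sum_negf)
qed

text \<open>The words of length l have total weight 2^(-l), and the geometric series sums to at most
  2.\<close>

lemma sum_list_weight_le:
  assumes "finite A" "A \<noteq> {}" "finite T" "\<And>t. t \<in> T \<Longrightarrow> set t \<subseteq> A"
  shows "(\<Sum>t\<in>T. (1 / (2 * real (card A))) ^ length t) \<le> 2"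
proof -
  let ?r = "1 / (2 * real (card A))"
  have cA: "real (card A) > 0" using assms by (simp add: card_gt_0_iff)
  obtain N where N: "\<And>t. t \<in> T \<Longrightarrow> length t < N"
    using finite_nat_set_iff_bounded[of "length ` T"] assms(3) by auto
  have "(\<Sum>t\<in>T. ?r ^ length t) \<le> (\<Sum>t\<in>(\<Union>l<N. words A l). ?r ^ length t)"
    using assms N by (intro sum_mono2 finite_UN_I finite_words) (auto simp: words_def)
  also have "\<dots> = (\<Sum>l<N. \<Sum>t\<in>words A l. ?r ^ length t)"
    using assms by (intro sum.UNION_disjoint) (auto simp: finite_words, auto simp: words_def)
  also have "\<dots> = (\<Sum>l<N. (1 / 2) ^ l)"
  proof (rule sum.cong[OF refl])
    fix l
    have "(\<Sum>t\<in>words A l. ?r ^ length t) = (\<Sum>t\<in>words A l. ?r ^ l)"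
      by (intro sum.cong) (auto simp: words_def)
    also have "\<dots> = (real (card A) * ?r) ^ l"
      using assms by (simp add: card_words power_mult_distrib[symmetric])
    also have "real (card A) * ?r = 1 / 2" using cA by simp
    finally show "(\<Sum>t\<in>words A l. ?r ^ length t) = (1 / 2) ^ l" .
  qed
  also have "\<dots> \<le> 2" unfolding sum_gp_strict by simp
  finally show ?thesis .
qed

text \<open>The effect of a letter on the subtree below a level-k vertex: \<open>Turn h f\<close> at \<open>1^k\<close>, \<open>Swap\<close> at a
  vertex \<open>1^(k-1) t\<close> with \<open>t \<noteq> 1\<close>.\<close>

datatype 'f item = Turn "nat list \<Rightarrow> nat list" 'f | Swap "nat \<Rightarrow> nat"

fun is_turn :: "'f item \<Rightarrow> bool" where
  "is_turn (Turn h f) = True"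
| "is_turn (Swap \<pi>) = False"

section \<open>Items acting below a level-k vertex, and their collapse\<close>

context directed_group
begin

text \<open>For h in H this is the section at the fixed vertex 1^k: the first k digits of the image
  are dropped.\<close>

definition turn :: "nat \<Rightarrow> (nat list \<Rightarrow> nat list) \<Rightarrow> (nat \<Rightarrow> nat) \<Rightarrow> nat \<Rightarrow> nat" where
  "turn k h y = (\<lambda>j. bd_act d h (conc (replicate k 1) y) (j + k))"

fun lamp :: "'f item \<Rightarrow> (nat \<Rightarrow> nat) \<Rightarrow> 'f" where
  "lamp (Turn h f) y = (if y = ones then f else \<one>\<^bsub>F\<^esub>)"
| "lamp (Swap \<pi>) y = \<one>\<^bsub>F\<^esub>"

fun move :: "nat \<Rightarrow> 'f item \<Rightarrow> (nat \<Rightarrow> nat) \<Rightarrow> nat \<Rightarrow> nat" where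
  "move k (Turn h f) y = turn k h y"
| "move k (Swap \<pi>) y = y(0 := \<pi> (y 0))"

fun lamps :: "nat \<Rightarrow> 'f item list \<Rightarrow> (nat \<Rightarrow> nat) \<Rightarrow> 'f" where
  "lamps k [] y = \<one>\<^bsub>F\<^esub>"
| "lamps k (i # is) y = lamp i y \<otimes>\<^bsub>F\<^esub> lamps k is (move k i y)"

fun moves :: "nat \<Rightarrow> 'f item list \<Rightarrow> (nat \<Rightarrow> nat) \<Rightarrow> nat \<Rightarrow> nat" where
  "moves k [] y = y"
| "moves k (i # is) y = moves k is (move k i y)"

text \<open>Items of one kind live in a single finite group, \<open>HF\<close> or the permutations
  of one digit, and are multiplied there with the left factor acting first; so merging never leaves
  a finite alphabet.\<close>

fun combine :: "'f item \<Rightarrow> 'f item \<Rightarrow> 'f item list" where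
  "combine (Turn h f) (Turn h' f') = [Turn (h' \<circ> h) (f \<otimes>\<^bsub>F\<^esub> f')]"
| "combine (Swap \<pi>) (Swap \<pi>') = [Swap (\<pi>' \<circ> \<pi>)]"
| "combine i j = [i, j]"

fun collapse :: "'f item list \<Rightarrow> 'f item list" where
  "collapse [] = []"
| "collapse (i # is) = (case collapse is of [] \<Rightarrow> [i] | j # js \<Rightarrow> combine i j @ js)"

definition item_set :: "nat \<Rightarrow> 'f item set" where
  "item_set k = (\<lambda>(h, f). Turn h f) ` (H \<times> carrier F) \<union> Swap ` {\<pi>. \<pi> permutes {1..d k}}"

lemma item_set_simps:
  "Turn h f \<in> item_set k \<longleftrightarrow> h \<in> H \<and> f \<in> carrier F"
  "Swap \<pi> \<in> item_set k \<longleftrightarrow> \<pi> permutes {1..d k}"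
  by (auto simp: item_set_def)

abbreviation bdry_at :: "nat \<Rightarrow> (nat \<Rightarrow> nat) set" where
  "bdry_at k \<equiv> tbdry (\<lambda>i. d (k + i))"

lemma replicate_ones_tverts: "replicate k 1 \<in> tverts d"
  using d_ge1 by (simp add: tverts_def)

lemma conc_ones_bdry: "y \<in> bdry_at k \<Longrightarrow> conc (replicate k 1) y \<in> tbdry d"
  using replicate_ones_tverts by (simp add: conc_tbdry)

lemma turn_eq_hray:
  assumes "h \<in> H" "y \<in> bdry_at k"
  shows "turn k h y = hray (sig_of h) k y"
    and "bd_act d h (conc (replicate k 1) y) = conc (replicate k 1) (turn k h y)"
proof -
  have "visit_type (replicate k 1) = [True]" by (simp add: visit_type_True)
  then have s: "hsec (sig_of h) 0 (replicate k 1) y = hray (sig_of h) k y"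
    using hsec_visit_True[of "replicate k 1" "sig_of h" 0 y] by simp
  have r: "hmap_aux sig l (replicate k 1) = replicate k 1" for sig l
    by (induction k arbitrary: l) auto
  have "bd_act d h (conc (replicate k 1) y) = hray (sig_of h) 0 (conc (replicate k 1) y)"
    using sig_of(2)[OF assms(1)] bd_act_hmap[OF conc_ones_bdry[OF assms(2)]] by metis
  also have "\<dots> = conc (replicate k 1) (hray (sig_of h) k y)"
    unfolding hray_conc s r ..
  finally have *: "bd_act d h (conc (replicate k 1) y) = conc (replicate k 1) (hray (sig_of h) k y)" .
  show 1: "turn k h y = hray (sig_of h) k y"
    unfolding turn_def * using conc_suffix[of "replicate k 1"] by simp
  show "bd_act d h (conc (replicate k 1) y) = conc (replicate k 1) (turn k h y)"
    unfolding 1 * ..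
qed

lemma turn_bdry:
  assumes "h \<in> H" "y \<in> bdry_at k"
  shows "turn k h y \<in> bdry_at k"
proof -
  have "conc (replicate k 1) (turn k h y) \<in> tbdry d"
    using turn_eq_hray(2)[OF assms]
      bd_act_tbdry[OF vertex_perm_map[OF H_perm[OF assms(1)]] conc_ones_bdry[OF assms(2)]] by metis
  then show ?thesis by (simp add: conc_tbdry)
qed

lemma turn_comp:
  assumes "h \<in> H" "h' \<in> H" "y \<in> bdry_at k"
  shows "turn k (h' \<circ> h) y = turn k h' (turn k h y)"
  unfolding turn_def[of k "h' \<circ> h"] turn_def[of k h']
    bd_act_comp[OF vertex_perm_map[OF H_perm[OF assms(1)]] conc_ones_bdry[OF assms(3)]]
    turn_eq_hray(2)[OF assms(1,3)] ..

lemma turn_ones: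
  assumes "h \<in> H" "y \<in> bdry_at k"
  shows "turn k h y = ones \<longleftrightarrow> y = ones"
  using H_ones[OF assms(1) conc_ones_bdry[OF assms(2)]] turn_eq_hray(2)[OF assms]
    conc_replicate_ones[of k y] conc_replicate_ones[of k "turn k h y"] by simp

lemma move_bdry:
  assumes "i \<in> item_set k" "y \<in> bdry_at k"
  shows "move k i y \<in> bdry_at k"
proof (cases i)
  case (Turn h f)
  then show ?thesis using assms turn_bdry by (auto simp: item_set_simps)
next
  case (Swap \<pi>)
  then have p: "\<pi> permutes {1..d k}" using assms by (auto simp: item_set_simps)
  have y: "y j \<in> {1..d (k + j)}" for j using assms(2) by (simp add: tbdry_def)
  have "(y(0 := \<pi> (y 0))) j \<in> {1..d (k + j)}" for j
    using y[of j] y[of 0] permutes_in_image[OF p, of "y 0"] by (cases j) auto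
  then show ?thesis by (simp add: Swap tbdry_def)
qed

lemma lamp_closed: "i \<in> item_set k \<Longrightarrow> lamp i y \<in> carrier F"
  by (cases i) (auto simp: item_set_simps F_one)

lemma lamps_closed: "set is \<subseteq> item_set k \<Longrightarrow> lamps k is y \<in> carrier F"
  by (induction "is" arbitrary: y) (auto simp: F_one F_mult lamp_closed)

lemma combine_items:
  assumes "i \<in> item_set k" "j \<in> item_set k"
  shows "set (combine i j) \<subseteq> item_set k"
  using assms H_mult F_mult
  by (cases i; cases j) (auto simp: item_set_simps permutes_compose)

text \<open>Two turns merge because the section at 1^k fixes 1^infinity: the second lamp letter
  reaches y exactly when the first does. Swaps carry no lamp.\<close>

lemma combine_eval:
  assumes "i \<in> item_set k" "j \<in> item_set k" "set js \<subseteq> item_set k" "y \<in> bdry_at k"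
  shows "lamps k (combine i j @ js) y = lamps k (i # j # js) y"
    and "moves k (combine i j @ js) y = moves k (i # j # js) y"
proof -
  have t: "turn k h ones = ones" if "h \<in> H" for h
    using turn_ones[OF that ones_tbdry] d_ge1 by simp
  have c: "lamp i y \<in> carrier F" "lamp j (move k i y) \<in> carrier F" "lamps k js z \<in> carrier F" for z
    using assms lamp_closed lamps_closed by auto
  show "lamps k (combine i j @ js) y = lamps k (i # j # js) y"
    using assms c by (cases i; cases j)
      (auto simp: F_simps F_one turn_comp turn_ones t item_set_simps)
  show "moves k (combine i j @ js) y = moves k (i # j # js) y"
    using assms by (cases i; cases j) (auto simp: turn_comp item_set_simps)
qed

lemma collapse_items: "set is \<subseteq> item_set k \<Longrightarrow> set (collapse is) \<subseteq> item_set k"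
proof (induction "is")
  case (Cons i "is")
  show ?case
  proof (cases "collapse is")
    case (Cons j js)
    then have "j \<in> item_set k" "set js \<subseteq> item_set k" using Cons.IH Cons.prems by auto
    then show ?thesis using combine_items[of i k j] Cons.prems by (auto simp: Cons)
  qed (use Cons.prems in simp)
qed simp

lemma collapse_eval:
  assumes "set is \<subseteq> item_set k" "y \<in> bdry_at k"
  shows "lamps k (collapse is) y = lamps k is y" "moves k (collapse is) y = moves k is y"
proof -
  have "lamps k (collapse is) y = lamps k is y \<and> moves k (collapse is) y = moves k is y"
    using assms
  proof (induction "is" arbitrary: y)
    case (Cons i "is")
    then have IH: "lamps k (collapse is) (move k i y) = lamps k is (move k i y)"
      "moves k (collapse is) (move k i y) = moves k is (move k i y)"
      using move_bdry by auto
    show ?case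
    proof (cases "collapse is")
      case Nil
      then show ?thesis using IH by simp
    next
      case (Cons j js)
      then have "j \<in> item_set k" "set js \<subseteq> item_set k"
        using collapse_items[of "is" k] Cons.prems by auto
      with combine_eval[of i k j js y] Cons.prems IH Cons show ?thesis by simp
    qed
  qed simp
  then show "lamps k (collapse is) y = lamps k is y" "moves k (collapse is) y = moves k is y" by auto
qed

text \<open>After collapsing the kinds alternate, so each block of turns leaves one
  \<open>Turn\<close> and at most one \<open>Swap\<close> behind it, and only a leading
  \<open>Swap\<close> comes on top. The kind of the head is tracked since it decides whether the
  next item merges.\<close>

lemma collapse_length:
  "length (collapse is) \<le> 2 * blocks False (map is_turn is) + (if is \<noteq> [] \<and> \<not> is_turn (hd is) then 1 else 0)
   \<and> (is \<noteq> [] \<longrightarrow> collapse is \<noteq> [] \<and> is_turn (hd (collapse is)) = is_turn (hd is))"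
proof (induction "is")
  case (Cons i "is")
  show ?case
  proof (cases "is")
    case Nil
    then show ?thesis by (cases "is_turn i") auto
  next
    case ne: (Cons i' is')
    then obtain j js where j: "collapse is = j # js" "is_turn j = is_turn i'"
      using Cons.IH by (cases "collapse is") auto
    show ?thesis
      using Cons.IH j ne by (cases i; cases j; cases "is_turn i'") auto
  qed
qed simp

section \<open>Reconstruction of a group element from its items\<close>

definition item_at :: "((nat \<Rightarrow> nat) \<times> (nat list \<Rightarrow> nat list) \<times> (nat \<Rightarrow> nat)) \<times> 'f \<Rightarrow> nat list \<Rightarrow> 'f item list" where
  "item_at a v = (let u = rooted d (fst (fst a)) v; h = fst (snd (fst a)) in
     if visit_type u = [True] then [Turn h (snd a)]
     else if visit_type u = [False] then [Swap (hcoord d h (length u) (last u))] else [])"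

fun items :: "nat list \<Rightarrow> (((nat \<Rightarrow> nat) \<times> (nat list \<Rightarrow> nat list) \<times> (nat \<Rightarrow> nat)) \<times> 'f) list \<Rightarrow> 'f item list" where
  "items v [] = []"
| "items v (a # w) = item_at a v @ items (act (fst a) v) w"

lemma items_visits: "map is_turn (items v w) = visits v (map fst w)"
proof (induction w arbitrary: v)
  case (Cons a w)
  have "map is_turn (item_at a v) = visit_type (rooted d (fst (fst a)) v)"
    using visit_type_cases[of "rooted d (fst (fst a)) v"] by (auto simp: item_at_def Let_def)
  then show ?case using Cons by simp
qed simp

lemma last_visit_False:
  assumes "u \<in> level d k" "visit_type u = [False]"
  shows "k \<ge> 1" "last u \<in> {2..d (k - 1)}"
proof -
  have u: "u \<noteq> []" "last u \<noteq> 1" "length u = k" "u \<in> tverts d"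
    using assms by (auto simp: visit_type_False level_def)
  then show "k \<ge> 1" by (cases u) auto
  have "u ! (length u - 1) \<in> {1..d (length u - 1)}" using u(1,4) by (simp add: tverts_def)
  then show "last u \<in> {2..d (k - 1)}" using u by (auto simp: last_conv_nth)
qed

text \<open>For k \<ge> 1 rooted factors only change the first digit, which lies above the ray y, so
  y is moved by the section of h alone; the three visit types give a turn, a swap or
  nothing.\<close>

lemma step_eval:
  assumes a: "a \<in> letters" and v: "v \<in> level d k" and k: "k \<ge> 1" and y: "y \<in> bdry_at k"
  shows "set (item_at a v) \<subseteq> item_set k"
    and "bd_act d (act (fst a)) (conc v y) = conc (act (fst a) v) (moves k (item_at a v) y)"
    and "(if bd_act d (rooted d (fst (fst a))) (conc v y) = ones then snd a else \<one>\<^bsub>F\<^esub>) = lamps k (item_at a v) y"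
proof -
  obtain s h s' f where a': "a = ((s, h, s'), f)" by (metis prod.exhaust)
  have mem: "s \<in> perms" "h \<in> H" "s' \<in> perms" "f \<in> carrier F"
    using a a' by (auto simp: letters_def triples_def)
  have rooted_conc: "bd_act d (rooted d \<tau>) (conc u z) = conc (rooted d \<tau> u) z"
    if u: "u \<in> level d k" and z: "z \<in> bdry_at k" for \<tau> u z
  proof -
    obtain b bs where b: "u = b # bs" using u k by (cases u) (auto simp: level_def)
    have "conc (b # bs) z \<in> tbdry d" using u z unfolding b conc_tbdry by (auto simp: level_def)
    then show ?thesis using u bd_act_rooted_conc unfolding b by (simp add: level_def rooted_simps del: conc.simps)
  qed
  define u where "u = rooted d s v"
  have sm: "vertex_map d (rooted d s)" and hm: "vertex_map d h"
    using mem rooted_perm H_perm vertex_perm_map by auto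
  have u: "u \<in> level d k" unfolding u_def by (rule vertex_map_level[OF sm v])
  then have ul: "u \<in> tverts d" "length u = k" by (auto simp: level_def)
  have ub: "conc u y \<in> tbdry d" using ul y by (simp add: conc_tbdry)
  have hu: "h u \<in> level d k" by (rule vertex_map_level[OF hm u])
  have vb: "conc v y \<in> tbdry d" using v y by (simp add: conc_tbdry level_def)
  have hmap: "h u = hmap_aux (sig_of h) 0 u" using sig_of(2)[OF mem(2)] ul by (metis hmap_def)
  define y' where "y' = hsec (sig_of h) 0 u y"
  have h1: "bd_act d h (conc u y) = conc (h u) y'"
    using sig_of(2)[OF mem(2)] bd_act_hmap[OF ub] hray_conc hmap unfolding y'_def by metis
  have y'b: "y' \<in> bdry_at k"
    using bd_act_tbdry[OF hm ub] hu unfolding h1 conc_tbdry by (simp add: level_def)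
  have act1: "bd_act d (act (fst a)) (conc v y) = conc (act (fst a) v) y'"
  proof -
    have "bd_act d (act (fst a)) (conc v y) = bd_act d (rooted d s' \<circ> h) (bd_act d (rooted d s) (conc v y))"
      unfolding act_def a' using bd_act_comp[OF sm vb] by simp
    also have "\<dots> = bd_act d (rooted d s') (conc (h u) y')"
      unfolding rooted_conc[OF v y] u_def[symmetric] bd_act_comp[OF hm ub] h1 ..
    finally show ?thesis unfolding rooted_conc[OF hu y'b] by (simp add: act_def a' u_def)
  qed
  \<comment> \<open>The lamp acts on the ray after s, and \<open>conc u y\<close> is 1^infinity
    exactly when u is 1^k and y is 1^infinity.\<close>
  have first: "bd_act d (rooted d (fst (fst a))) (conc v y) = ones \<longleftrightarrow> visit_type u = [True] \<and> y = ones"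
  proof -
    have "conc u y = ones \<longleftrightarrow> u = replicate k 1 \<and> y = ones"
      using conc_eq_iff[of u "replicate k 1" y ones] conc_replicate_ones[of k ones] ul by simp
    then show ?thesis using rooted_conc[OF v y] ul by (simp add: a' visit_type_True u_def)
  qed
  have it: "item_at a v = (if visit_type u = [True] then [Turn h f]
     else if visit_type u = [False] then [Swap (sig_of h k (last u))] else [])"
    using hcoord_eq[OF mem(2)] last_visit_False[OF u] ul by (simp add: item_at_def a' u_def[symmetric])
  consider "visit_type u = [True]" | "visit_type u = [False]" | "visit_type u = []"
    using visit_type_cases[of u] by blast
  then have "set (item_at a v) \<subseteq> item_set k \<and> y' = moves k (item_at a v) y \<and>
    (if visit_type u = [True] \<and> y = ones then f else \<one>\<^bsub>F\<^esub>) = lamps k (item_at a v) y"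
  proof cases
    case 1
    have "y' = turn k h y"
      unfolding y'_def hsec_visit_True[OF 1] using turn_eq_hray(1)[OF mem(2) y] ul by simp
    then show ?thesis using 1 mem F_one by (auto simp: it item_set_simps F_simps)
  next
    case 2
    have "sig_of h k (last u) permutes {1..d k}"
      using sig_of(1)[OF mem(2)] last_visit_False[OF u 2] unfolding sig_ok_def
      by (metis One_nat_def Suc_pred add_0 le_eq_less_or_eq less_eq_Suc_le)
    then show ?thesis using 2 F_one ul
      by (auto simp: it item_set_simps F_simps y'_def hsec_visit_False)
  next
    case 3
    then show ?thesis by (simp add: it y'_def hsec_visit_none)
  qed
  then show "set (item_at a v) \<subseteq> item_set k"
    "bd_act d (act (fst a)) (conc v y) = conc (act (fst a) v) (moves k (item_at a v) y)"
    "(if bd_act d (rooted d (fst (fst a))) (conc v y) = ones then snd a else \<one>\<^bsub>F\<^esub>) = lamps k (item_at a v) y"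
    unfolding act1 first by (auto simp: a')
qed

lemma items_item_set:
  assumes "set w \<subseteq> letters" "v \<in> level d k" "k \<ge> 1"
  shows "set (items v w) \<subseteq> item_set k"
  using assms
proof (induction w arbitrary: v)
  case (Cons a w)
  have "ones \<in> bdry_at k" using d_ge1 by (intro ones_tbdry)
  from step_eval(1)[OF _ Cons.prems(2,3) this, of a]
  have "set (item_at a v) \<subseteq> item_set k" using Cons.prems by auto
  moreover have "act (fst a) v \<in> level d k"
    using Cons.prems act_perm vertex_map_level vertex_perm_map by (auto simp: letters_def)
  ultimately show ?case using Cons by simp
qed simp

lemma lamps_append:
  assumes "set is \<subseteq> item_set k" "set js \<subseteq> item_set k"
  shows "lamps k (is @ js) y = lamps k is y \<otimes>\<^bsub>F\<^esub> lamps k js (moves k is y)"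
  using assms
  by (induction "is" arbitrary: y) (auto simp: F_simps lamps_closed lamp_closed)

lemma moves_append: "moves k (is @ js) y = moves k js (moves k is y)"
  by (induction "is" arbitrary: y) auto

lemma moves_bdry: "set is \<subseteq> item_set k \<Longrightarrow> y \<in> bdry_at k \<Longrightarrow> moves k is y \<in> bdry_at k"
  by (induction "is" arbitrary: y) (auto simp: move_bdry)

lemma word_eval:
  assumes "set w \<subseteq> letters" "v \<in> level d k" "k \<ge> 1" "y \<in> bdry_at k"
  shows "cocycle w (conc v y) = lamps k (items v w) y"
    and "bd_act d (walk (map fst w)) (conc v y) = conc (walk (map fst w) v) (moves k (items v w) y)"
proof -
  have "cocycle w (conc v y) = lamps k (items v w) y \<and>
     bd_act d (walk (map fst w)) (conc v y) = conc (walk (map fst w) v) (moves k (items v w) y)"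
    using assms
  proof (induction w arbitrary: v y)
    case Nil
    show ?case by (simp add: bd_act_id bd_act_id[unfolded id_def])
  next
    case (Cons a w)
    have a: "a \<in> letters" and w: "set w \<subseteq> letters" using Cons.prems by auto
    note st = step_eval[OF a Cons.prems(2-4)]
    have am: "vertex_map d (act (fst a))" using a act_perm vertex_perm_map by (auto simp: letters_def)
    have v': "act (fst a) v \<in> level d k" by (rule vertex_map_level[OF am Cons.prems(2)])
    have y': "moves k (item_at a v) y \<in> bdry_at k" by (rule moves_bdry[OF st(1) Cons.prems(4)])
    have vb: "conc v y \<in> tbdry d" using Cons.prems by (simp add: conc_tbdry level_def)
    note IH = Cons.IH[OF w v' Cons.prems(3) y']
    have "cocycle (a # w) (conc v y) = lamps k (items v (a # w)) y"
      unfolding cocycle.simps items.simps st(2,3)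
        lamps_append[OF st(1) items_item_set[OF w v' Cons.prems(3)]]
      using IH by simp
    moreover have "bd_act d (walk (map fst (a # w))) (conc v y)
       = conc (walk (map fst (a # w)) v) (moves k (items v (a # w)) y)"
      using bd_act_comp[OF am vb, of "walk (map fst w)"] IH unfolding st(2) items.simps moves_append
      by (simp add: o_def)
    ultimately show ?case ..
  qed
  then show "cocycle w (conc v y) = lamps k (items v w) y"
    "bd_act d (walk (map fst w)) (conc v y) = conc (walk (map fst w) v) (moves k (items v w) y)" by auto
qed

text \<open>\<open>restrict\<close> makes codes elements of a \<open>PiE\<close>, over which product
  weights factorise.\<close>

definition code :: "nat \<Rightarrow> (((nat \<Rightarrow> nat) \<times> (nat list \<Rightarrow> nat list) \<times> (nat \<Rightarrow> nat)) \<times> 'f) list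
    \<Rightarrow> nat list \<Rightarrow> nat list \<times> 'f item list" where
  "code k w = restrict (\<lambda>v. (walk (map fst w) v, collapse (items v w))) (level d k)"

text \<open>Every ray splits as a level-k vertex and a tail; the code gives the image of the vertex,
  and the collapsed items give the effect on the tail together with the lamp value.\<close>

lemma code_determines:
  assumes "set w \<subseteq> letters" "set w' \<subseteq> letters" "k \<ge> 1" "code k w = code k w'"
  shows "elt w = elt w'"
proof -
  have eq: "cocycle w x = cocycle w' x \<and> bd_act d (walk (map fst w)) x = bd_act d (walk (map fst w')) x"
    if x: "x \<in> tbdry d" for x
  proof -
    define v where "v = map x [0..<k]"
    define y where "y = (\<lambda>j. x (j + k))"
    have xv: "x = conc v y" by (simp add: v_def y_def conc_prefix_suffix)
    have v: "v \<in> level d k" using prefix_tverts[OF x] by (simp add: v_def level_def)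
    have y: "y \<in> bdry_at k" using x v unfolding xv conc_tbdry by (simp add: level_def)
    have c: "walk (map fst w) v = walk (map fst w') v" "collapse (items v w) = collapse (items v w')"
      using fun_cong[OF assms(4), of v] v by (auto simp: code_def)
    have "lamps k (items v w) y = lamps k (items v w') y" "moves k (items v w) y = moves k (items v w') y"
      using collapse_eval[OF items_item_set[OF assms(1) v assms(3)] y]
        collapse_eval[OF items_item_set[OF assms(2) v assms(3)] y] c(2) by auto
    then show ?thesis
      unfolding xv using word_eval[OF assms(1) v assms(3) y] word_eval[OF assms(2) v assms(3) y] c(1) by simp
  qed
  have "walk (map fst w) = walk (map fst w')"
  proof (rule vertex_map_eqI)
    show "vertex_map d (walk (map fst w))" "vertex_map d (walk (map fst w'))"
      using assms(1,2) by (intro vertex_perm_map walk_perm; force simp: letters_def)+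
  qed (use eq d_ge1 in auto)
  then show ?thesis using eq by (auto simp: elt_def)
qed

section \<open>Weights on codes and the entropy estimate\<close>

lemma finite_item_set: "finite (item_set k)"
  unfolding item_set_def using H_fin F_fin by (auto intro: finite_permutations)

lemma item_set_nonempty: "item_set k \<noteq> {}"
  using H_id F_one by (auto simp: item_set_def)

lemma card_item_set: "card (item_set k) \<le> card H * card (carrier F) + fact (d k)"
proof -
  let ?T = "(\<lambda>(h, f). Turn h f) ` (H \<times> carrier F)"
  let ?S = "Swap ` {\<pi>. \<pi> permutes {1..d k}} :: 'f item set"
  have "card (item_set k) \<le> card ?T + card ?S"
    unfolding item_set_def by (rule card_Un_le)
  also have "card ?T \<le> card H * card (carrier F)"
    using card_image_le[of "H \<times> carrier F" "\<lambda>(h, f). Turn h f"] H_fin F_fin by (simp add: card_cartesian_product)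
  also have "card ?S \<le> card {\<pi>. \<pi> permutes {1..d k}}"
    by (rule card_image_le) (simp add: finite_permutations)
  also have "card {\<pi>. \<pi> permutes {1..d k}} = fact (d k)"
    using card_permutations[of "{1..d k}" "d k"] by simp
  finally show ?thesis by simp
qed

lemma entropy_le:
  assumes k: "k \<ge> 1" and small: "(\<Prod>i<k. pexp d i) * real n \<le> 1"
  shows "rw_entropy F d H n
    \<le> real (\<Prod>i<k. d i) * (ln (2 * real (\<Prod>i<k. d i)) + 5 * ln (2 * real (card (item_set k))))"
proof -
  let ?W = "words letters n" and ?L = "level d k"
  define D where "D = real (card ?L)"
  define A where "A = real (card (item_set k))"
  have W: "finite ?W" "?W \<noteq> {}" using finite_words[OF finite_letters] words_nonempty[OF letters_nonempty] by auto
  then have cW: "real (card ?W) > 0" by (simp add: card_gt_0_iff)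
  have D: "D \<ge> 1" unfolding D_def card_level using prod_ge_1[of "{..<k}" d] d_ge1
    by (simp del: of_nat_prod One_nat_def)
  have "card (item_set k) > 0" using finite_item_set item_set_nonempty by (simp add: card_gt_0_iff)
  then have A: "A \<ge> 1" by (simp add: A_def)
  have wl: "set w \<subseteq> letters" if "w \<in> ?W" for w using that by (simp add: words_def)
  define T where "T = (\<lambda>(v, w). collapse (items v w)) ` (?L \<times> ?W)"
  have T: "finite T" unfolding T_def using W finite_level by auto
  have Ti: "set t \<subseteq> item_set k" if t: "t \<in> T" for t
  proof -
    obtain v w where "v \<in> ?L" "w \<in> ?W" "t = collapse (items v w)" using t by (auto simp: T_def)
    then show ?thesis using collapse_items[OF items_item_set[OF wl _ k]] by blast
  qed
  \<comment> \<open>The position of a vertex gets weight 1/D and the item list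
    \<open>(1/(2*A))^length\<close>; the lists have total weight at most 2, which the remaining 1/2
    compensates.\<close>
  define q where "q p = 1 / (2 * D) * (1 / (2 * A)) ^ length (snd p)" for p :: "nat list \<times> 'f item list"
  have q: "q p > 0" for p using D A by (simp add: q_def)
  define Q where "Q c = (\<Prod>v\<in>?L. q (c v))" for c
  have walk_level: "walk (map fst w) v \<in> ?L" if "w \<in> ?W" "v \<in> ?L" for w v
    using walk_perm[of "map fst w"] wl[OF that(1)]
    by (intro vertex_map_level[OF vertex_perm_map that(2)]) (force simp: letters_def)
  have codes: "code k ` ?W \<subseteq> PiE ?L (\<lambda>_. ?L \<times> T)"
    using walk_level by (auto simp: code_def T_def)
  \<comment> \<open>Enlarging the set of codes to the full product lets the sum factorise over the
    vertices of the level.\<close>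
  have "(\<Sum>c\<in>code k ` ?W. Q c) \<le> (\<Sum>c\<in>PiE ?L (\<lambda>_. ?L \<times> T). Q c)"
  proof (rule sum_mono2[OF _ codes])
    show "finite (PiE ?L (\<lambda>_. ?L \<times> T))" using finite_level T by (intro finite_PiE) auto
    show "0 \<le> Q c" for c unfolding Q_def by (intro prod_nonneg less_imp_le q)
  qed
  also have "\<dots> = (\<Prod>v\<in>?L. \<Sum>p\<in>?L \<times> T. q p)"
    unfolding Q_def using finite_level T by (subst prod_sum_PiE) auto
  also have "\<dots> \<le> 1"
  proof (rule prod_le_1)
    fix v
    have "(\<Sum>p\<in>?L \<times> T. q p) = (\<Sum>u\<in>?L. 1 / (2 * D) * (\<Sum>t\<in>T. (1 / (2 * A)) ^ length t))"
      by (simp add: q_def sum.cartesian_product' sum_distrib_left)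
    also have "\<dots> = (\<Sum>t\<in>T. (1 / (2 * A)) ^ length t) / 2" using D by (simp add: D_def)
    also have "\<dots> \<le> 1"
      using sum_list_weight_le[OF finite_item_set item_set_nonempty T Ti] unfolding A_def by simp
    finally show "0 \<le> (\<Sum>p\<in>?L \<times> T. q p) \<and> (\<Sum>p\<in>?L \<times> T. q p) \<le> 1"
      using q by (auto intro: sum_nonneg less_imp_le)
  qed
  finally have Qsum: "(\<Sum>c\<in>code k ` ?W. Q c) \<le> 1" .
  have lnQ: "- ln (Q (code k w)) \<le> (\<Sum>v\<in>?L. ln (2 * D) + ln (2 * A) * (2 * real (blocks False (visits v (map fst w))) + 1))"
    for w
  proof -
    have "- ln (Q (code k w)) = (\<Sum>v\<in>?L. - ln (q (code k w v)))"
    proof -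
      have "ln (Q (code k w)) = (\<Sum>v\<in>?L. ln (q (code k w v)))"
        unfolding Q_def using q by (intro ln_prod finite_level) (metis less_irrefl)
      then show ?thesis by (simp add: sum_negf)
    qed
    also have "\<dots> \<le> (\<Sum>v\<in>?L. ln (2 * D) + ln (2 * A) * (2 * real (blocks False (visits v (map fst w))) + 1))"
    proof (rule sum_mono)
      fix v assume v: "v \<in> ?L"
      let ?l = "length (collapse (items v w))"
      have "- ln (q (code k w v)) = ln (2 * D) + real ?l * ln (2 * A)"
        using D A v by (simp add: q_def code_def ln_mult ln_div ln_realpow algebra_simps)
      moreover have "real ?l \<le> 2 * real (blocks False (visits v (map fst w))) + 1"
        using collapse_length[of "items v w"] unfolding items_visits by (auto split: if_splits)
      ultimately show "- ln (q (code k w v))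
         \<le> ln (2 * D) + ln (2 * A) * (2 * real (blocks False (visits v (map fst w))) + 1)"
        using A by (simp add: mult.commute mult_right_mono)
    qed
    finally show ?thesis .
  qed
  have "rw_entropy F d H n * real (card ?W) \<le> (\<Sum>w\<in>?W. - ln (Q (code k w)))"
    unfolding rw_entropy_def conv_pow_eq
  proof (rule pmf_entropy_le_code[OF W, where C = "code k" and Q = Q])
    show "Q (code k w) > 0" for w unfolding Q_def using q by (intro prod_pos) auto
    show "elt w = elt w'" if "w \<in> ?W" "w' \<in> ?W" "code k w = code k w'" for w w'
      using code_determines[OF wl[OF that(1)] wl[OF that(2)] k that(3)] .
  qed (rule Qsum)
  also have "\<dots> \<le> (\<Sum>w\<in>?W. \<Sum>v\<in>?L. ln (2 * D) + ln (2 * A) * (2 * real (blocks False (visits v (map fst w))) + 1))"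
    by (intro sum_mono lnQ)
  also have "\<dots> = (\<Sum>v\<in>?L. \<Sum>w\<in>?W. ln (2 * D) + ln (2 * A) * (2 * real (blocks False (visits v (map fst w))) + 1))"
    by (rule sum.swap)
  also have "\<dots> = real (card ?W) * D * (ln (2 * D) + ln (2 * A))
      + 2 * ln (2 * A) * (\<Sum>v\<in>?L. \<Sum>w\<in>?W. real (blocks False (visits v (map fst w))))"
    by (simp add: sum.distrib sum_distrib_left D_def algebra_simps)
  also have "(\<Sum>v\<in>?L. \<Sum>w\<in>?W. real (blocks False (visits v (map fst w))))
      = real (card ?W) * D * level_mean d k (\<lambda>u. real (blocks False u)) (steps n)"
    unfolding D_def by (rule sum_level_words_visits[OF k])
  also have "real (card ?W) * D * (ln (2 * D) + ln (2 * A)) + 2 * ln (2 * A) * \<dots>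
     \<le> real (card ?W) * D * (ln (2 * D) + ln (2 * A)) + 2 * ln (2 * A) * (real (card ?W) * D * 2)"
  proof -
    \<comment> \<open>The mean number of blocks is at most 2, so the mean collapsed length is at
      most 2 * 2 + 1 = 5, the constant in the statement.\<close>
    have "level_mean d k (\<lambda>u. real (blocks False u)) (steps n)
       \<le> (\<Prod>i<k. pexp d i) * real n + (1 - (1 / 4) ^ k)"
      using level_mean_blocks_le[of d k "steps n"] d_ge2 by (simp add: blocks_steps)
    also have "\<dots> \<le> 2" using small zero_le_power[of "1/4 :: real" k] by linarith
    finally show ?thesis using D A cW by (intro add_left_mono mult_left_mono) auto
  qed
  also have "\<dots> = real (card ?W) * (D * (ln (2 * D) + 5 * ln (2 * A)))"
    by (simp add: algebra_simps)
  finally have "rw_entropy F d H n \<le> D * (ln (2 * D) + 5 * ln (2 * A))"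
    using cW by (simp add: mult.commute[of "rw_entropy F d H n"])
  then show ?thesis unfolding D_def A_def card_level .
qed

end

section \<open>The entropy exponent\<close>

lemma ln_affine_ln_over_ln:
  fixes a b :: real
  assumes "0 < a" "0 < b"
  shows "(\<lambda>n. ln (a * ln (real n) + b) / ln (real n)) \<longlonglongrightarrow> 0"
  using assms by real_asymp

section \<open>The threshold k(n) and the comparison of the two bounds\<close>

context directed_group
begin

text \<open>The least k exists because k = n already qualifies, \<open>pexp\<close> being at most
  1/4. The definition of k(n) includes the index k itself, so the threshold level is k(n) +
  1.\<close>

lemma kfun_prop: "(\<Prod>i<Suc (kfun d n). pexp d i) * real n \<le> 1"
proof -
  have "(\<Prod>i\<le>n. pexp d i) * real n \<le> (1 / 4) ^ Suc n * real n"
    using prod_pexp_le[of d "Suc n"] d_ge1 by (intro mult_right_mono) (auto simp: lessThan_Suc_atMost)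
  also have "\<dots> \<le> 1"
  proof -
    have "n < 4 ^ n" by (rule power_gt_expt) simp
    then have "n < 4 ^ Suc n" by simp
    then have "real n \<le> 4 ^ Suc n" by (metis less_imp_le of_nat_le_iff of_nat_numeral of_nat_power)
    then show ?thesis by (simp add: power_one_over field_simps)
  qed
  finally have "(\<Prod>i\<le>n. pexp d i) * real n \<le> 1" .
  then show ?thesis
    unfolding kfun_def lessThan_Suc_atMost by (rule LeastI)
qed

lemma kfun_minimal:
  assumes "j < kfun d n"
  shows "(\<Prod>i<Suc j. pexp d i) * real n > 1"
  using not_less_Least[of j "\<lambda>k. (\<Prod>i\<le>k. pexp d i) * real n \<le> 1"] assms
  unfolding kfun_def lessThan_Suc_atMost by auto

text \<open>Minimality and \<open>pexp\<close> \<le> 1/4 give 4^k(n) < n when k(n) > 0, and ln 4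
  \<ge> 1.\<close>

lemma kfun_le_ln:
  assumes "n \<ge> 1"
  shows "real (kfun d n) \<le> ln (real n)"
proof (cases "kfun d n")
  case (Suc j)
  have "1 < (\<Prod>i<Suc j. pexp d i) * real n" using kfun_minimal[of j n] Suc by simp
  also have "\<dots> \<le> (1 / 4) ^ Suc j * real n"
    using prod_pexp_le[of d "Suc j"] d_ge1 by (intro mult_right_mono) auto
  finally have "4 ^ Suc j < real n" by (simp add: power_one_over field_simps)
  then have "ln (4 ^ Suc j) < ln (real n)" using assms by (subst ln_less_cancel_iff) auto
  then have "real (Suc j) * ln 4 < ln (real n)" by (subst (asm) ln_realpow) auto
  moreover have "real (Suc j) * 1 \<le> real (Suc j) * ln 4"
  proof (intro mult_left_mono)
    have "exp 1 \<le> (4 :: real)" using exp_le by simp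
    then show "1 \<le> ln (4 :: real)" by (simp add: ln_ge_iff)
  qed simp
  ultimately have "real (Suc j) * 1 < ln (real n)" by (rule le_less_trans[rotated])
  then show ?thesis using Suc by simp
qed (use assms in simp)

text \<open>The lower bound is applied at level k(n) and the upper bound at level k(n) + 1. The two
  sizes differ by a factor at most B, and the upper bound loses a further factor affine in ln n;
  both vanish after dividing logarithms by ln n.\<close>

lemma entropy_exponent:
  assumes bdd: "\<And>j. d j \<le> B" and nontriv: "carrier F \<noteq> {\<one>\<^bsub>F\<^esub>}"
  shows "(\<lambda>n. ln (rw_entropy F d H n) / ln (real n) - beta d n) \<longlonglongrightarrow> 0"
proof -
  define q where "q = real (card (carrier F))"
  define A where "A = real (card H * card (carrier F) + fact B)"
  define c1 where "c1 = ln (real B)"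
  define c2 where "c2 = ln 2 + c1 + 5 * ln (2 * A)"
  \<comment> \<open>The 1/5 is the visit probability; the factor B passes from level k(n) to level
    k(n) + 1.\<close>
  define c3 where "c3 = ln q / (5 * real B)"
  define K where "K n = \<bar>ln c3\<bar> + \<bar>ln (c1 * ln (real n) + c2)\<bar>" for n
  have B: "2 \<le> B" using d_ge2[of 0] bdd[of 0] by simp
  have c1: "0 < c1" using B by (simp add: c1_def)
  have "1 \<le> card H * card (carrier F) + fact B" using fact_ge_1[of B, where 'a = nat] by (rule trans_le_add2)
  then have "real 1 \<le> A" unfolding A_def by (rule of_nat_mono)
  then have A: "1 \<le> A" by simp
  then have c2: "0 < c2" using c1 by (simp add: c2_def add_pos_pos)
  have "2 \<le> card (carrier F)"
  proof -
    obtain f where "f \<in> carrier F" "f \<noteq> \<one>\<^bsub>F\<^esub>" using nontriv F_one by blast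
    then have "card {f, \<one>\<^bsub>F\<^esub>} \<le> card (carrier F)" using F_one F_fin by (intro card_mono) auto
    then show ?thesis using \<open>f \<noteq> \<one>\<^bsub>F\<^esub>\<close> by simp
  qed
  then have q: "2 \<le> q" by (simp add: q_def)
  have c3: "0 < c3" using q B by (simp add: c3_def)
  have p0: "0 < pexp d 0" using d_ge2 by (intro pexp_pos)
  have main: "\<bar>ln (rw_entropy F d H n) / ln (real n) - beta d n\<bar> \<le> K n / ln (real n)"
    \<comment> \<open>This range of n forces k(n) \<ge> 1, as both entropy bounds need a level below
      the root.\<close>
    if n: "real n > 1 / pexp d 0" for n
  proof -
    let ?H = "rw_entropy F d H n" and ?k = "kfun d n"
    define D where "D = real (\<Prod>i<Suc ?k. d i)"
    have "1 < 1 / pexp d 0" using p0 pexp_le[of d 0] by (simp add: field_simps)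
    then have n1: "real n > 1" using n by linarith
    have lnn: "ln (real n) > 0" using n1 by simp
    have k: "?k \<ge> 1"
    proof (rule ccontr)
      assume "\<not> ?k \<ge> 1"
      then have "?k = 0" by simp
      then have "pexp d 0 * real n \<le> 1" using kfun_prop[of n] by simp
      then show False using n p0 by (simp add: field_simps)
    qed
    have D1: "1 \<le> D" unfolding D_def using prod_ge_1[of "{..<Suc ?k}" d] d_ge1
      by (simp del: of_nat_prod One_nat_def prod.lessThan_Suc)
    \<comment> \<open>D is at most B^(k(n) + 1), and k(n) \<le> ln n.\<close>
    have lnD: "ln D \<le> c1 * ln (real n) + c1"
    proof -
      have "(\<Prod>i<Suc ?k. d i) \<le> (\<Prod>i<Suc ?k. B)" by (intro prod_mono) (use bdd in auto)
      then have "D \<le> real B ^ Suc ?k" unfolding D_def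
        by (metis card_lessThan of_nat_le_iff of_nat_power prod_constant)
      then have "ln D \<le> ln (real B ^ Suc ?k)" using D1 B by (subst ln_le_cancel_iff) auto
      also have "\<dots> = (real ?k + 1) * c1" using B by (subst ln_realpow) (auto simp: c1_def)
      also have "\<dots> \<le> (ln (real n) + 1) * c1"
        using kfun_le_ln[of n] n1 c1 by (intro mult_right_mono) auto
      finally show ?thesis by (simp add: algebra_simps)
    qed
    have low: "c3 * D \<le> ?H"
    proof -
      obtain j where j: "?k = Suc j" using k by (cases ?k) auto
      have "1 \<le> (\<Prod>i<?k. pexp d i) * real n" using kfun_minimal[of j n] j by simp
      from entropy_ge[OF k this] have "ln q * real (\<Prod>i<?k. d i) / 5 \<le> ?H" by (simp add: q_def)
      moreover have "c3 * D \<le> ln q * real (\<Prod>i<?k. d i) / 5"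
      proof -
        have "D \<le> real (\<Prod>i<?k. d i) * real B" unfolding D_def
          using bdd[of ?k] by (simp add: mult_left_mono prod_nonneg)
        then have "c3 * D \<le> c3 * (real (\<Prod>i<?k. d i) * real B)" using c3 by (intro mult_left_mono) auto
        also have "\<dots> = ln q * real (\<Prod>i<?k. d i) / 5" using B by (simp add: c3_def)
        finally show ?thesis .
      qed
      ultimately show ?thesis by linarith
    qed
    have up: "?H \<le> D * (c1 * ln (real n) + c2)"
    proof -
      have a: "real (card (item_set (Suc ?k))) \<le> A"
      proof -
        have "card (item_set (Suc ?k)) \<le> card H * card (carrier F) + fact (d (Suc ?k))" by (rule card_item_set)
        also have "\<dots> \<le> card H * card (carrier F) + fact B" using bdd by (intro add_left_mono fact_mono) auto
        finally show ?thesis unfolding A_def by (simp only: of_nat_le_iff)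
      qed
      have a0: "0 < card (item_set (Suc ?k))"
        using finite_item_set item_set_nonempty by (simp add: card_gt_0_iff)
      have "?H \<le> D * (ln (2 * D) + 5 * ln (2 * real (card (item_set (Suc ?k)))))"
        unfolding D_def by (rule entropy_le[OF _ kfun_prop]) simp
      also have "\<dots> \<le> D * (c1 * ln (real n) + c2)"
      proof (rule mult_left_mono)
        have "ln (2 * real (card (item_set (Suc ?k)))) \<le> ln (2 * A)" using a a0 by simp
        moreover have "ln (2 * D) = ln 2 + ln D" using D1 by (simp add: ln_mult)
        ultimately show "ln (2 * D) + 5 * ln (2 * real (card (item_set (Suc ?k)))) \<le> c1 * ln (real n) + c2"
          using lnD by (simp add: c2_def)
      qed (use D1 in simp)
      finally show ?thesis .
    qed
    have pos: "0 < c1 * ln (real n) + c2" using c1 c2 lnn by (simp add: add_pos_pos)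
    have Hpos: "0 < ?H" using less_le_trans[OF mult_pos_pos[OF c3] low] D1 by simp
    have "ln (c3 * D) \<le> ln ?H" using low Hpos c3 D1 by (subst ln_le_cancel_iff) auto
    then have l: "ln c3 + ln D \<le> ln ?H" using c3 D1 by (simp add: ln_mult)
    have "ln ?H \<le> ln (D * (c1 * ln (real n) + c2))" using up Hpos pos D1 by (subst ln_le_cancel_iff) auto
    then have u: "ln ?H \<le> ln D + ln (c1 * ln (real n) + c2)" using pos D1 by (simp add: ln_mult)
    have "\<bar>ln ?H - ln D\<bar> \<le> K n"
      using l u abs_ge_self[of "ln (c1 * ln (real n) + c2)"] abs_ge_minus_self[of "ln c3"]
      unfolding K_def by linarith
    moreover have "ln ?H / ln (real n) - beta d n = (ln ?H - ln D) / ln (real n)"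
      by (simp add: beta_def D_def lessThan_Suc_atMost diff_divide_distrib)
    ultimately show ?thesis using lnn by (simp add: divide_right_mono)
  qed
  have "eventually (\<lambda>n. real n > 1 / pexp d 0) sequentially"
    using filterlim_real_sequentially by (simp add: filterlim_at_top_dense)
  then have ev: "eventually (\<lambda>n. norm (ln (rw_entropy F d H n) / ln (real n) - beta d n) \<le> K n / ln (real n)) sequentially"
    by eventually_elim (use main in simp)
  moreover have "(\<lambda>n. K n / ln (real n)) \<longlonglongrightarrow> 0"
  proof -
    have "(\<lambda>n. ln (c1 * ln (real n) + c2) / ln (real n)) \<longlonglongrightarrow> 0"
      by (rule ln_affine_ln_over_ln[OF c1 c2])
    from tendsto_rabs[OF this] have "(\<lambda>n. \<bar>ln (c1 * ln (real n) + c2) / ln (real n)\<bar>) \<longlonglongrightarrow> 0" by simp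
    moreover have "(\<lambda>n. \<bar>ln c3\<bar> / ln (real n)) \<longlonglongrightarrow> 0" by real_asymp
    ultimately have "(\<lambda>n. \<bar>ln c3\<bar> / ln (real n) + \<bar>ln (c1 * ln (real n) + c2) / ln (real n)\<bar>) \<longlonglongrightarrow> 0 + 0"
      by (intro tendsto_add)
    \<comment> \<open>For n > 1 the denominator is positive, so absolute values pass through the
      quotient.\<close>
    moreover have "eventually (\<lambda>n. \<bar>ln c3\<bar> / ln (real n) + \<bar>ln (c1 * ln (real n) + c2) / ln (real n)\<bar>
        = K n / ln (real n)) sequentially"
      using eventually_gt_at_top[of 1] by eventually_elim (simp add: K_def add_divide_distrib)
    ultimately show ?thesis by (simp add: tendsto_cong)
  qed
  ultimately show ?thesis by (rule Lim_null_comparison)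
qed

end

text \<open>Write u = (u - v) + v: adding a null sequence changes neither the upper nor the lower
  limit in the extended reals.\<close>

lemma limsup_liminf_cong:
  fixes u v :: "nat \<Rightarrow> real"
  assumes "(\<lambda>n. u n - v n) \<longlonglongrightarrow> 0"
  shows "limsup (\<lambda>n. ereal (u n)) = limsup (\<lambda>n. ereal (v n))"
    and "liminf (\<lambda>n. ereal (u n)) = liminf (\<lambda>n. ereal (v n))"
proof -
  have lim: "(\<lambda>n. ereal (u n - v n)) \<longlonglongrightarrow> 0"
    using assms by (simp add: zero_ereal_def)
  have sum: "(\<lambda>n. ereal (u n - v n) + ereal (v n)) = (\<lambda>n. ereal (u n))" by simp
  show "limsup (\<lambda>n. ereal (u n)) = limsup (\<lambda>n. ereal (v n))"
    using ereal_limsup_lim_add[OF lim, of "\<lambda>n. ereal (v n)"] unfolding sum by simp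
  show "liminf (\<lambda>n. ereal (u n)) = liminf (\<lambda>n. ereal (v n))"
    using ereal_liminf_lim_add[OF lim, of "\<lambda>n. ereal (v n)"] unfolding sum by simp
qed

theorem mainTheorem10:
  fixes d :: "nat \<Rightarrow> nat"
    and H :: "(nat list \<Rightarrow> nat list) set"
    and F :: "('f, 'z) monoid_scheme"
  assumes d_ge2: "\<forall>j. d j \<ge> 2"
    and d_bdd: "\<exists>B. \<forall>j. d j \<le> B"
    and H_sub: "H \<subseteq> Hd d"
    and H_fin: "finite H"
    and H_id: "id \<in> H"
    and H_mult: "\<forall>a\<in>H. \<forall>b\<in>H. b \<circ> a \<in> H"
    and H_inv: "\<forall>a\<in>H. Hilbert_Choice.inv a \<in> H"
    and H_unif: "\<forall>l\<ge>1. \<forall>t\<in>{2..d (l - 1)}.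
                   map_pmf (\<lambda>h. hcoord d h l t) (pmf_of_set H)
                   = pmf_of_set {\<pi>. \<pi> permutes {1..d l}}"
    and F_grp: "group F"
    and F_fin: "finite (carrier F)"
    and F_nontriv: "carrier F \<noteq> {\<one>\<^bsub>F\<^esub>}"
  shows "(\<forall>\<epsilon>>0. eventually (\<lambda>n. \<bar>ln (rw_entropy F d H n) / ln (real n) - beta d n\<bar> \<le> \<epsilon>) sequentially)
       \<and> limsup (\<lambda>n. ereal (ln (rw_entropy F d H n) / ln (real n))) = limsup (\<lambda>n. ereal (beta d n))
       \<and> liminf (\<lambda>n. ereal (ln (rw_entropy F d H n) / ln (real n))) = liminf (\<lambda>n. ereal (beta d n))"
proof -
  interpret directed_group d H F
    by (rule directed_group.intro) (use assms in auto)
  obtain B where "\<And>j. d j \<le> B" using d_bdd by blast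
  from entropy_exponent[OF this F_nontriv]
  have lim: "(\<lambda>n. ln (rw_entropy F d H n) / ln (real n) - beta d n) \<longlonglongrightarrow> 0" .
  have "eventually (\<lambda>n. \<bar>ln (rw_entropy F d H n) / ln (real n) - beta d n\<bar> \<le> \<epsilon>) sequentially"
    if "\<epsilon> > 0" for \<epsilon>
    using tendstoD[OF lim that] by eventually_elim (simp add: dist_real_def)
  then show ?thesis using limsup_liminf_cong[OF lim] by blast
qed

end
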